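(* Let $\mathbb{G}$ be a Carnot group of topological dimension $m$, step $s$ and rank $k$, identified with $\mathbb{R}^m$ via exponential coordinates of the first kind. Then its Endpoint map $\mathrm{End}:L^2([0,1],\mathbb{R}^k)\to\mathbb{R}^m$ belongs to $\mathscr{P}^m_s(L^2([0,1],\mathbb{R}^k))$.
   Context: A Carnot group of step $s$ is a connected, simply connected Lie group $\mathbb{G}$ whose Lie algebra $\mathfrak{g}$ of left-invariant vector fields has a stratification $\mathfrak{g}=\mathfrak{g}_1\oplus\cdots\oplus\mathfrak{g}_s$ with $\mathfrak{g}_i\ne0$, $\mathfrak{g}_{i+1}=[\mathfrak{g}_1,\mathfrak{g}_i]$ for $i<s$ and $[\mathfrak{g}_1,\mathfrak{g}_s]=0$; the rank is $k=\dim\mathfrak{g}_1$ and $m=\dim\mathbb{G}$. Choose an adapted basis $v_1,\dots,v_m$ of $\mathfrak{g}$ (successive blocks form bases of $\mathfrak{g}_1,\dots,\mathfrak{g}_s$), identify $\mathbb{G}$ with $\mathbb{R}^m$ via $x\mapsto\exp_{\mathbb{G}}(\sum x_iv_i)$ (so the identity is $0$), and let $X_1,\dots,X_k$ be the left-invariant vector fields corresponding to $v_1,\dots,v_k$. For $u=(u_1,\dots,u_k)\in L^2([0,1],\mathbb{R}^k)$ let $\gamma_u:[0,1]\to\mathbb{G}$ be the unique absolutely continuous solution of $\dot\gamma(t)=\sum_{j=1}^ku_j(t)X_j(\gamma(t))$, $\gamma(0)=0$; then $\mathrm{End}(u)=\gamma_u(1)$. For a Hilbert space $H$, $\mathscr{P}^m_d(H)$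 is the set of maps $f:H\to\mathbb{R}^m$ that are $C^1$ in the Fréchet sense, whose differential $Df:H\to\mathcal{L}(H,\mathbb{R}^m)$ is weakly continuous and locally Lipschitz, and such that for every finite-dimensional linear subspace $E\subset H$ the restriction $f|_E$ is a polynomial map of degree at most $d$. *)

theory Defs
  imports "HOL-Analysis.Analysis"
begin

coinductive smooth_map :: "('a::euclidean_space \<Rightarrow> 'b::real_normed_vector) \<Rightarrow> bool" where
  "(\<forall>x. f differentiable (at x)) \<Longrightarrow>
   (\<forall>b\<in>Basis. smooth_map (\<lambda>x. frechet_derivative f (at x) b)) \<Longrightarrow> smooth_map f"

definition lie_field :: "('v::real_normed_vector \<Rightarrow> 'v \<Rightarrow> 'v) \<Rightarrow> 'v \<Rightarrow> 'v \<Rightarrow> 'v" where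
  "lie_field gmul v x = frechet_derivative (gmul x) (at 0) v"

text \<open>Value at 0 of the vector-field bracket of the left-invariant fields with values v, w at 0.\<close>
definition lie_bracket :: "('v::real_normed_vector \<Rightarrow> 'v \<Rightarrow> 'v) \<Rightarrow> 'v \<Rightarrow> 'v \<Rightarrow> 'v" where
  "lie_bracket gmul v w =
     frechet_derivative (lie_field gmul w) (at 0) v - frechet_derivative (lie_field gmul v) (at 0) w"

definition layer :: "('m::finite \<Rightarrow> nat) \<Rightarrow> nat \<Rightarrow> (real^'m) set" where
  "layer deg j = span {axis i 1 | i. deg i = j}"

text \<open>gmul is a Carnot group law of step s on R^m, in exponential coordinates of the first kind
  with respect to the standard basis, which is adapted to the stratification given by deg.\<close>
definition carnot_exp_coords ::
  "(real^'m \<Rightarrow> real^'m \<Rightarrow> real^'m) \<Rightarrow> ('m::finite \<Rightarrow> nat) \<Rightarrow> nat \<Rightarrow> bool" where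
  "carnot_exp_coords gmul deg s \<longleftrightarrow>
     (\<forall>x y z. gmul (gmul x y) z = gmul x (gmul y z)) \<and>
     (\<forall>x. gmul 0 x = x \<and> gmul x 0 = x) \<and>
     (\<forall>x. \<exists>y. gmul x y = 0 \<and> gmul y x = 0) \<and>
     smooth_map (\<lambda>p::(real^'m) \<times> (real^'m). gmul (fst p) (snd p)) \<and>
     (\<forall>x a b. gmul (a *\<^sub>R x) (b *\<^sub>R x) = (a + b) *\<^sub>R x) \<and>
     (\<forall>i. 1 \<le> deg i \<and> deg i \<le> s) \<and>
     (\<forall>j\<in>{1..s}. \<exists>i. deg i = j) \<and>
     (\<forall>j. 1 \<le> j \<and> j < s \<longrightarrow>
        layer deg (Suc j) = span {lie_bracket gmul v w | v w. v \<in> layer deg 1 \<and> w \<in> layer deg j}) \<and>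
     (\<forall>v\<in>layer deg 1. \<forall>w\<in>layer deg s. lie_bracket gmul v w = 0)"

definition horizontal_curve ::
  "(real^'m \<Rightarrow> real^'m \<Rightarrow> real^'m) \<Rightarrow> ('k::finite \<Rightarrow> 'm::finite) \<Rightarrow> (real \<Rightarrow> real^'k)
     \<Rightarrow> (real \<Rightarrow> real^'m) \<Rightarrow> bool" where
  "horizontal_curve gmul \<iota> u \<gamma> \<longleftrightarrow>
     continuous_on {0..1} \<gamma> \<and> \<gamma> 0 = 0 \<and>
     (\<forall>t\<in>{0..1}.
        ((\<lambda>\<tau>. \<Sum>j\<in>UNIV. (u \<tau> $ j) *\<^sub>R lie_field gmul (axis (\<iota> j) 1) (\<gamma> \<tau>)) has_integral \<gamma> t) {0..t})"

definition endpoint ::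
  "(real^'m \<Rightarrow> real^'m \<Rightarrow> real^'m) \<Rightarrow> ('k::finite \<Rightarrow> 'm::finite) \<Rightarrow> (real \<Rightarrow> real^'k) \<Rightarrow> real^'m" where
  "endpoint gmul \<iota> u = (THE p. \<exists>\<gamma>. horizontal_curve gmul \<iota> u \<gamma> \<and> \<gamma> 1 = p)"

definition L2 :: "(real \<Rightarrow> 'a::euclidean_space) \<Rightarrow> bool" where
  "L2 u \<longleftrightarrow> (\<lambda>t. indicator {0..1} t *\<^sub>R u t) \<in> borel_measurable lebesgue \<and>
           integrable lebesgue (\<lambda>t. indicator {0..1} t * (norm (u t))\<^sup>2)"

definition L2_inner :: "(real \<Rightarrow> 'a::euclidean_space) \<Rightarrow> (real \<Rightarrow> 'a) \<Rightarrow> real" where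
  "L2_inner u v = (LINT t|lebesgue. indicator {0..1} t * (u t \<bullet> v t))"

definition L2_norm :: "(real \<Rightarrow> 'a::euclidean_space) \<Rightarrow> real" where
  "L2_norm u = sqrt (L2_inner u u)"

definition has_L2_deriv ::
  "((real \<Rightarrow> 'a::euclidean_space) \<Rightarrow> 'b::euclidean_space) \<Rightarrow> (real \<Rightarrow> 'a) \<Rightarrow> ((real \<Rightarrow> 'a) \<Rightarrow> 'b) \<Rightarrow> bool" where
  "has_L2_deriv F u L \<longleftrightarrow>
     (\<forall>h g. L2 h \<longrightarrow> L2 g \<longrightarrow> L (\<lambda>t. h t + g t) = L h + L g) \<and>
     (\<forall>c h. L2 h \<longrightarrow> L (\<lambda>t. c *\<^sub>R h t) = c *\<^sub>R L h) \<and>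
     (\<exists>C. \<forall>h. L2 h \<longrightarrow> norm (L h) \<le> C * L2_norm h) \<and>
     (\<forall>\<epsilon>>0. \<exists>\<delta>>0. \<forall>h. L2 h \<longrightarrow> L2_norm h < \<delta> \<longrightarrow>
        norm (F (\<lambda>t. u t + h t) - F u - L h) \<le> \<epsilon> * L2_norm h)"

definition poly_le :: "nat \<Rightarrow> nat \<Rightarrow> ((nat \<Rightarrow> real) \<Rightarrow> 'b::real_vector) \<Rightarrow> bool" where
  "poly_le n d P \<longleftrightarrow>
     (\<exists>a. \<forall>c. P c = (\<Sum>\<alpha>\<in>{\<alpha>::nat\<Rightarrow>nat. (\<forall>i. n \<le> i \<longrightarrow> \<alpha> i = 0) \<and> sum \<alpha> {..<n} \<le> d}.
                          (\<Prod>i<n. c i ^ \<alpha> i) *\<^sub>R a \<alpha>))"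

definition P_class :: "nat \<Rightarrow> ((real \<Rightarrow> 'a::euclidean_space) \<Rightarrow> 'b::euclidean_space) \<Rightarrow> bool" where
  "P_class d F \<longleftrightarrow>
     (\<exists>DF. (\<forall>u. L2 u \<longrightarrow> has_L2_deriv F u (DF u)) \<and>
       (\<forall>u. L2 u \<longrightarrow> (\<forall>\<epsilon>>0. \<exists>\<delta>>0. \<forall>v. L2 v \<longrightarrow> L2_norm (\<lambda>t. v t - u t) < \<delta> \<longrightarrow>
           (\<forall>h. L2 h \<longrightarrow> norm (DF v h - DF u h) \<le> \<epsilon> * L2_norm h))) \<and>
       (\<forall>v u. (\<forall>n. L2 (v n)) \<longrightarrow> L2 u \<longrightarrow>
          (\<forall>h. L2 h \<longrightarrow> (\<lambda>n. L2_inner (v n) h) \<longlonglongrightarrow> L2_inner u h) \<longrightarrow>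
          (\<forall>\<epsilon>>0. \<exists>N. \<forall>n\<ge>N. \<forall>h. L2 h \<longrightarrow> norm (DF (v n) h - DF u h) \<le> \<epsilon> * L2_norm h)) \<and>
       (\<forall>u. L2 u \<longrightarrow> (\<exists>r>0. \<exists>C. \<forall>v w. L2 v \<longrightarrow> L2 w \<longrightarrow>
           L2_norm (\<lambda>t. v t - u t) < r \<longrightarrow> L2_norm (\<lambda>t. w t - u t) < r \<longrightarrow>
           (\<forall>h. L2 h \<longrightarrow> norm (DF v h - DF w h) \<le> C * L2_norm (\<lambda>t. v t - w t) * L2_norm h))) \<and>
       (\<forall>n hs. (\<forall>i<n. L2 (hs i)) \<longrightarrow> poly_le n d (\<lambda>c. F (\<lambda>t. \<Sum>i<n. c i *\<^sub>R hs i t))))"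

end

theory Submission
  imports Defs
begin

text \<open>
  The Maurer--Cartan equation for left-invariant fields gives the Jacobi identity at the origin, so the
  bracket respects the grading and is nilpotent. In exponential coordinates the frame \<open>v \<mapsto> X v x\<close> solves
  a Riccati equation along rays, whence it is the inverse of \<open>(1 - exp (- ad x)) / ad x\<close>. By nilpotency
  the \<open>i\<close>-th component of a left-invariant field is a polynomial of weighted degree at most \<open>deg i - 1\<close>;
  in particular it only involves coordinates of smaller weight. The horizontal equation is therefore
  triangular: Picard iteration stops after \<open>s\<close> steps, and the \<open>i\<close>-th coordinate of the solution is built
  from constants by sums, products and at most \<open>deg i\<close> integrations against components of the control.

  Integration against an \<open>L2\<close> control is bounded
  for the 1/2-Hoelder norm, which yields the derivative and its local Lipschitz bound. Weak continuity of
  the derivative rests on equicontinuity: a bounded weakly null sequence integrates to zero uniformly over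
  Hoelder balls, and weakly convergent sequences are bounded.
\<close>

subsection \<open>Square integrable controls\<close>

text \<open>Cauchy-Schwarz bounds the increment of \<open>prim j u f\<close> over [a, b] by sup |f|
  times the norm of \<open>u\<close> times sqrt (b - a); this is the origin of the exponent 1/2. A
  supremum norm would not do for weak continuity: weak convergence concerns one test function at a
  time, whereas the derivative integrates the varying control against \<open>D u h\<close> with
  \<open>h\<close> ranging over a whole ball. Hoelder bounds make that family equicontinuous, so
  that finitely many pairings with grid cells control all of it at once.

  The degree \<open>s\<close> is a weight count: each integration restores the unit missing from the
  weight \<open>deg i - 1\<close> of a field component, so the degree of coordinate \<open>i\<close>
  stays at most \<open>deg i\<close> however often Picard iteration is applied.

  The Riccati equation degenerates at the start of the ray, where its factor \<open>t\<close>
  vanishes, so the usual uniqueness theorem does not apply there. This is why the candidate inverse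
  is tested through a defect that carries a factor \<open>t\<close> itself.

  Controls are functions rather than classes. Completeness is used in a single place, for one
  explicit series behind uniform boundedness.\<close>

abbreviation unit_lebesgue :: "real measure" where
  "unit_lebesgue \<equiv> lebesgue_on {0..1}"

lemma L2_iff:
  "L2 u \<longleftrightarrow> u \<in> borel_measurable unit_lebesgue \<and> integrable unit_lebesgue (\<lambda>t. (norm (u t))\<^sup>2)"
proof -
  have "u \<in> borel_measurable unit_lebesgue \<longleftrightarrow> (\<lambda>t. indicator {0..1} t *\<^sub>R u t) \<in> borel_measurable lebesgue"
    by (rule borel_measurable_restrict_space_iff) auto
  moreover have "integrable unit_lebesgue (\<lambda>t. (norm (u t))\<^sup>2)
      \<longleftrightarrow> integrable lebesgue (\<lambda>t. indicator {0..1} t * (norm (u t))\<^sup>2)"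
    by (subst integrable_restrict_space) auto
  ultimately show ?thesis by (simp add: L2_def)
qed

lemma L2_inner_eq: "L2_inner u v = (LINT t|unit_lebesgue. u t \<bullet> v t)"
  unfolding L2_inner_def by (subst integral_restrict_space) auto

lemma L2_measurable [measurable_dest]: "L2 u \<Longrightarrow> u \<in> borel_measurable unit_lebesgue"
  by (simp add: L2_iff)

lemma L2_integrable_inner:
  assumes "L2 u" "L2 v"
  shows "integrable unit_lebesgue (\<lambda>t. u t \<bullet> v t)"
proof (rule Bochner_Integration.integrable_bound)
  show "integrable unit_lebesgue (\<lambda>t. (norm (u t))\<^sup>2 + (norm (v t))\<^sup>2)"
    using assms by (simp add: L2_iff)
  show "(\<lambda>t. u t \<bullet> v t) \<in> borel_measurable unit_lebesgue"
    using L2_measurable[OF assms(1)] L2_measurable[OF assms(2)] by measurable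
  have "\<bar>x \<bullet> y\<bar> \<le> (norm x)\<^sup>2 + (norm y)\<^sup>2" for x y :: 'a
  proof -
    have "\<bar>x \<bullet> y\<bar> \<le> norm x * norm y" by (rule Cauchy_Schwarz_ineq2)
    also have "\<dots> \<le> (norm x)\<^sup>2 + (norm y)\<^sup>2"
      using sum_squares_bound[of "norm x" "norm y"] mult_nonneg_nonneg[OF norm_ge_zero norm_ge_zero, of x y]
      by linarith
    finally show ?thesis .
  qed
  then show "AE t in unit_lebesgue. norm (u t \<bullet> v t) \<le> norm ((norm (u t))\<^sup>2 + (norm (v t))\<^sup>2)"
    by simp
qed

lemma L2_iff_inner:
  "L2 u \<longleftrightarrow> u \<in> borel_measurable unit_lebesgue \<and> integrable unit_lebesgue (\<lambda>t. u t \<bullet> u t)"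
  by (simp add: L2_iff power2_norm_eq_inner)

lemma L2_scaleR: "L2 u \<Longrightarrow> L2 (\<lambda>t. c *\<^sub>R u t)"
  by (auto simp: L2_iff_inner)

lemma L2_add:
  assumes "L2 u" "L2 v"
  shows "L2 (\<lambda>t. u t + v t)"
  unfolding L2_iff_inner
proof
  show "(\<lambda>t. u t + v t) \<in> borel_measurable unit_lebesgue"
    using L2_measurable[OF assms(1)] L2_measurable[OF assms(2)] by measurable
  show "integrable unit_lebesgue (\<lambda>t. (u t + v t) \<bullet> (u t + v t))"
    unfolding inner_simps using assms by (intro Bochner_Integration.integrable_add L2_integrable_inner)
qed

lemma L2_diff: "L2 u \<Longrightarrow> L2 v \<Longrightarrow> L2 (\<lambda>t. u t - v t)"
  using L2_add[of u "\<lambda>t. (-1) *\<^sub>R v t"] L2_scaleR[of v "-1"] by simp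

lemma L2_zero: "L2 (\<lambda>t. 0)"
  by (simp add: L2_iff)

lemma L2_sum: "(\<And>i. i \<in> I \<Longrightarrow> L2 (h i)) \<Longrightarrow> L2 (\<lambda>t. \<Sum>i\<in>I. h i t)"
  by (induction I rule: infinite_finite_induct) (auto simp: L2_zero L2_add)

section \<open>Inner product and norm of controls\<close>

lemma L2_inner_add_left:
  "L2 u \<Longrightarrow> L2 v \<Longrightarrow> L2 w \<Longrightarrow> L2_inner (\<lambda>t. u t + v t) w = L2_inner u w + L2_inner v w"
  unfolding L2_inner_eq inner_add_left
  by (intro Bochner_Integration.integral_add L2_integrable_inner)

lemma L2_inner_commute: "L2_inner u v = L2_inner v u"
  by (simp add: L2_inner_eq inner_commute)

lemma L2_inner_scaleR_left: "L2_inner (\<lambda>t. c *\<^sub>R u t) v = c * L2_inner u v"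
  by (simp add: L2_inner_eq)

lemma L2_inner_scaleR_right: "L2_inner u (\<lambda>t. c *\<^sub>R v t) = c * L2_inner u v"
  by (simp add: L2_inner_eq)

lemma L2_inner_add_right:
  "L2 u \<Longrightarrow> L2 v \<Longrightarrow> L2 w \<Longrightarrow> L2_inner w (\<lambda>t. u t + v t) = L2_inner w u + L2_inner w v"
  using L2_inner_add_left[of u v w] by (simp add: L2_inner_commute)

lemma L2_inner_diff_left:
  "L2 u \<Longrightarrow> L2 v \<Longrightarrow> L2 w \<Longrightarrow> L2_inner (\<lambda>t. u t - v t) w = L2_inner u w - L2_inner v w"
  unfolding L2_inner_eq inner_diff_left
  by (intro Bochner_Integration.integral_diff L2_integrable_inner)

lemma L2_inner_self_nonneg: "0 \<le> L2_inner u u"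
  by (simp add: L2_inner_eq)

lemma L2_norm_nonneg [simp]: "0 \<le> L2_norm u"
  by (simp add: L2_norm_def L2_inner_self_nonneg)

lemma L2_norm_square: "(L2_norm u)\<^sup>2 = L2_inner u u"
  by (simp add: L2_norm_def L2_inner_self_nonneg)

lemma L2_norm_scaleR: "L2_norm (\<lambda>t. c *\<^sub>R u t) = \<bar>c\<bar> * L2_norm u"
proof -
  have "L2_inner (\<lambda>t. c *\<^sub>R u t) (\<lambda>t. c *\<^sub>R u t) = c\<^sup>2 * L2_inner u u"
    by (simp add: L2_inner_scaleR_left L2_inner_scaleR_right power2_eq_square)
  then show ?thesis by (simp add: L2_norm_def real_sqrt_mult)
qed

lemma L2_Cauchy_Schwarz:
  assumes u: "L2 u" and v: "L2 v"
  shows "\<bar>L2_inner u v\<bar> \<le> L2_norm u * L2_norm v"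
proof -
  define a b c where "a = L2_inner u u" and "b = L2_inner u v" and "c = L2_inner v v"
  have ac: "0 \<le> a" "0 \<le> c" by (auto simp: a_def c_def L2_inner_self_nonneg)
  have q: "0 \<le> a + 2 * r * b + r\<^sup>2 * c" for r
  proof -
    have rv: "L2 (\<lambda>t. r *\<^sub>R v t)" by (rule L2_scaleR[OF v])
    have "L2_inner (\<lambda>t. u t + r *\<^sub>R v t) (\<lambda>t. u t + r *\<^sub>R v t) = a + 2 * r * b + r\<^sup>2 * c"
      using u v rv L2_add[OF u rv]
      by (simp add: L2_inner_add_left L2_inner_add_right L2_inner_scaleR_left L2_inner_scaleR_right
          a_def b_def c_def L2_inner_commute[of v u] power2_eq_square algebra_simps)
    then show ?thesis using L2_inner_self_nonneg by metis
  qed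
  have "b\<^sup>2 \<le> a * c"
  \<comment> \<open>\<open>c = 0\<close> does not force \<open>v\<close> to be the zero function, so
    this case is argued separately: the quadratic in \<open>r\<close> becomes affine, and
    \<open>r = - (a + 1) / (2 * b)\<close> would give it the value -1. Otherwise
    \<open>r = - b / c\<close> is its minimiser.\<close>
  proof (cases "c = 0")
    case True
    have "b = 0"
    proof (rule ccontr)
      assume "b \<noteq> 0"
      then have "2 * (- (a + 1) / (2 * b)) * b = - (a + 1)" by simp
      then show False using q[of "- (a + 1) / (2 * b)"] True by simp
    qed
    then show ?thesis using True by simp
  next
    case False
    then have "0 \<le> a - b\<^sup>2 / c"
      using q[of "- b / c"] by (simp add: power2_eq_square field_simps)
    then show ?thesis using False ac by (simp add: field_simps)
  qed
  then have "sqrt (b\<^sup>2) \<le> sqrt (a * c)" by (rule real_sqrt_le_mono)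
  then show ?thesis by (simp add: L2_norm_def real_sqrt_mult a_def b_def c_def)
qed

lemma L2_norm_triangle:
  assumes u: "L2 u" and v: "L2 v"
  shows "L2_norm (\<lambda>t. u t + v t) \<le> L2_norm u + L2_norm v"
proof (rule power2_le_imp_le)
  have "(L2_norm (\<lambda>t. u t + v t))\<^sup>2 = L2_inner u u + 2 * L2_inner u v + L2_inner v v"
    using u v L2_add[OF u v]
    by (simp add: L2_norm_square L2_inner_add_left L2_inner_add_right L2_inner_commute[of v u])
  also have "\<dots> \<le> (L2_norm u + L2_norm v)\<^sup>2"
    using L2_Cauchy_Schwarz[OF u v] by (simp add: power2_sum L2_norm_square)
  finally show "(L2_norm (\<lambda>t. u t + v t))\<^sup>2 \<le> (L2_norm u + L2_norm v)\<^sup>2" .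
qed simp

lemma L2_norm_le_add_diff:
  assumes "L2 u" "L2 v"
  shows "L2_norm v \<le> L2_norm u + L2_norm (\<lambda>t. v t - u t)"
proof -
  have "(\<lambda>t. u t + (v t - u t)) = v" by (simp add: fun_eq_iff)
  then show ?thesis using L2_norm_triangle[OF assms(1) L2_diff[OF assms(2,1)]] by metis
qed

lemma L2_norm_triangle_diff:
  assumes "L2 u" "L2 v"
  shows "L2_norm (\<lambda>t. u t - v t) \<le> L2_norm u + L2_norm v"
  using L2_norm_triangle[of u "\<lambda>t. (-1) *\<^sub>R v t"] assms L2_scaleR[of v "-1"]
    L2_norm_scaleR[of "-1" v] by simp

subsection \<open>Integrals of a component against bounded functions\<close>

text \<open>The test function that turns the integral of \<open>u t $ j * f t\<close> over {a..b}
  into an inner product with \<open>u\<close>, so that both Cauchy-Schwarz and weak convergence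
  apply to such integrals.\<close>

definition window :: "'k::finite \<Rightarrow> real \<Rightarrow> real \<Rightarrow> (real \<Rightarrow> real) \<Rightarrow> real \<Rightarrow> real^'k" where
  "window j a b f t = (indicator {a..b} t * f t) *\<^sub>R axis j 1"

lemma L2_window:
  fixes j :: "'k::finite"
  assumes f: "f \<in> borel_measurable unit_lebesgue" and B: "\<forall>t\<in>{0..1}. \<bar>f t\<bar> \<le> B"
    and ab: "0 \<le> a" "a \<le> b" "b \<le> 1"
  shows "L2 (window j a b f)" and "L2_norm (window j a b f) \<le> B * sqrt (b - a)"
proof -
  have B0: "0 \<le> B" using B[rule_format, of 0] by simp
  have ind: "(indicator {a..b} :: real \<Rightarrow> real) \<in> borel_measurable unit_lebesgue"
    by (intro measurable_restrict_space1 borel_measurable_indicator) auto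
  have meas: "(\<lambda>t. indicator {a..b} t * f t) \<in> borel_measurable unit_lebesgue"
    using ind f by measurable
  have sq: "(norm (window j a b f t))\<^sup>2 = indicator {a..b} t * (f t)\<^sup>2" for t
    by (simp add: window_def power_mult_distrib norm_axis_1 indicator_def)
  have iB: "integrable unit_lebesgue (\<lambda>t. indicator {a..b} t * B\<^sup>2)"
    using ab by (intro integrable_mult_left integrable_real_indicator)
       (auto simp: sets_restrict_space_iff emeasure_restrict_space)
  have le: "indicator {a..b} t * (f t)\<^sup>2 \<le> indicator {a..b} t * B\<^sup>2" if "t \<in> {0..1}" for t
  proof -
    have "\<bar>f t\<bar>\<^sup>2 \<le> B\<^sup>2" using B that by (intro power_mono abs_ge_zero) blast
    then show ?thesis by (simp add: indicator_def)
  qed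
  have i2: "integrable unit_lebesgue (\<lambda>t. (norm (window j a b f t))\<^sup>2)"
    unfolding sq
  proof (rule Bochner_Integration.integrable_bound[OF iB])
    show "(\<lambda>t. indicator {a..b} t * (f t)\<^sup>2) \<in> borel_measurable unit_lebesgue"
      using ind f by measurable
    show "AE t in unit_lebesgue. norm (indicator {a..b} t * (f t)\<^sup>2) \<le> norm (indicator {a..b} t * B\<^sup>2)"
      using le by (intro AE_I2) (simp add: abs_mult)
  qed
  show L: "L2 (window j a b f)"
    unfolding L2_iff using i2 meas by (simp add: window_def[abs_def])
  have "(L2_norm (window j a b f))\<^sup>2 = (LINT t|unit_lebesgue. indicator {a..b} t * (f t)\<^sup>2)"
    by (simp add: L2_norm_square L2_inner_eq power2_norm_eq_inner[symmetric] sq)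
  also have "\<dots> \<le> (LINT t|unit_lebesgue. indicator {a..b} t * B\<^sup>2)"
    using i2 iB le unfolding sq by (intro integral_mono) auto
  also have "\<dots> = (b - a) * B\<^sup>2"
    using ab by (simp add: measure_restrict_space inf.absorb1)
  also have "\<dots> = (B * sqrt (b - a))\<^sup>2"
    using ab by (simp add: power_mult_distrib)
  finally show "L2_norm (window j a b f) \<le> B * sqrt (b - a)"
    by (rule power2_le_imp_le) (use B0 ab in simp)
qed

lemma L2_inner_window:
  assumes u: "L2 u" and f: "f \<in> borel_measurable unit_lebesgue"
    and B: "\<forall>t\<in>{0..1}. \<bar>f t\<bar> \<le> B" and ab: "0 \<le> a" "a \<le> b" "b \<le> 1"
  shows "(\<lambda>t. u t $ j * f t) absolutely_integrable_on {a..b}"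
    and "L2_inner u (window j a b f) = integral {a..b} (\<lambda>t. u t $ j * f t)"
proof -
  note w = L2_window[where j = j, OF f B ab]
  have eq: "u t \<bullet> window j a b f t = indicator {a..b} t * (u t $ j * f t)" for t
    by (simp add: window_def inner_axis)
  have "integrable unit_lebesgue (\<lambda>t. indicator {a..b} t * (u t $ j * f t))"
    using L2_integrable_inner[OF u w(1)] by (simp add: eq)
  moreover have ind: "indicator {0..1} t *\<^sub>R (indicator {a..b} t * (u t $ j * f t)) = indicator {a..b} t *\<^sub>R (u t $ j * f t)" for t :: real
    using ab by (simp add: indicator_def)
  moreover have "{0..1} \<inter> space lebesgue \<in> sets (lebesgue :: real measure)" by simp
  ultimately show ai: "(\<lambda>t. u t $ j * f t) absolutely_integrable_on {a..b}"
    unfolding set_integrable_def by (simp only: integrable_restrict_space ind)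
  have "L2_inner u (window j a b f) = (LINT t|unit_lebesgue. indicator {a..b} t * (u t $ j * f t))"
    by (simp add: L2_inner_eq eq)
  also have "\<dots> = (LINT t:{a..b}|lebesgue. u t $ j * f t)"
    unfolding set_lebesgue_integral_def by (subst integral_restrict_space) (simp_all only: ind, simp)
  also have "\<dots> = integral {a..b} (\<lambda>t. u t $ j * f t)"
    by (rule set_lebesgue_integral_eq_integral[OF ai])
  finally show "L2_inner u (window j a b f) = integral {a..b} (\<lambda>t. u t $ j * f t)" .
qed

text \<open>Cauchy-Schwarz against the window: its norm is at most \<open>B * sqrt (b - a)\<close>,
  and this square root becomes the Hoelder exponent of every primitive below.\<close>

lemma abs_integral_component_le:
  assumes u: "L2 u" and f: "f \<in> borel_measurable unit_lebesgue"
    and B: "\<forall>t\<in>{0..1}. \<bar>f t\<bar> \<le> B" and ab: "0 \<le> a" "a \<le> b" "b \<le> 1"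
  shows "\<bar>integral {a..b} (\<lambda>t. u t $ j * f t)\<bar> \<le> B * L2_norm u * sqrt (b - a)"
proof -
  have "\<bar>L2_inner u (window j a b f)\<bar> \<le> L2_norm u * L2_norm (window j a b f)"
    by (rule L2_Cauchy_Schwarz[OF u L2_window(1)[OF f B ab]])
  also have "\<dots> \<le> L2_norm u * (B * sqrt (b - a))"
    by (intro mult_left_mono L2_window(2)[OF f B ab]) auto
  finally show ?thesis unfolding L2_inner_window(2)[OF u f B ab] by (simp add: mult_ac)
qed

lemma measurable_component [measurable_dest]:
  fixes u :: "real \<Rightarrow> real^'k"
  assumes "L2 u" shows "(\<lambda>t. u t $ j) \<in> borel_measurable unit_lebesgue"
proof -
  have "(\<lambda>t. u t \<bullet> axis j 1) \<in> borel_measurable unit_lebesgue"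
    using L2_measurable[OF assms] by measurable
  then show ?thesis by (simp add: inner_axis)
qed

subsection \<open>Uniform boundedness\<close>

text \<open>A geometric tail, uniform in its upper end; 3/2 is 1 / (1 - 1/3).\<close>

lemma sum_third_power_le: "(\<Sum>k=K..<M. (1/3::real)^k) \<le> 3/2 * (1/3)^K"
proof -
  have "(\<Sum>k=K..<M. (1/3::real)^k) \<le> 3/2 * (1/3)^K - 3/2 * (1/3)^M" if "K \<le> M"
    using that by (induction M rule: dec_induct) auto
  moreover have "0 \<le> 3/2 * (1/3::real)^M" "0 \<le> 3/2 * (1/3::real)^K" by simp_all
  ultimately show ?thesis by (cases "K \<le> M") (linarith, simp)
qed

text \<open>Cauchy-Schwarz with the weight (1/3)^k split evenly between the two factors. The
  right-hand side is then linear in the squared norms and can be integrated term by term.\<close>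

lemma norm_sum_third_power_le:
  fixes e :: "nat \<Rightarrow> 'a::real_normed_vector"
  assumes c: "\<And>k. \<bar>c k\<bar> \<le> (1/3::real)^k"
  shows "(norm (\<Sum>k=K..<M. c k *\<^sub>R e k))\<^sup>2 \<le> 3/2 * (1/3)^K * (\<Sum>k=K..<M. (1/3)^k * (norm (e k))\<^sup>2)"
proof -
  define r where "r k = sqrt ((1/3::real)^k)" for k
  have r: "r k * r k = (1/3)^k" for k by (simp add: r_def)
  have "norm (\<Sum>k=K..<M. c k *\<^sub>R e k) \<le> (\<Sum>k=K..<M. r k * (r k * norm (e k)))"
  proof (rule sum_norm_le)
    fix k
    have "norm (c k *\<^sub>R e k) \<le> (1/3)^k * norm (e k)"
      using c[of k] by (simp add: mult_right_mono)
    then show "norm (c k *\<^sub>R e k) \<le> r k * (r k * norm (e k))"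
      by (simp add: mult.assoc[symmetric] r)
  qed
  then have "(norm (\<Sum>k=K..<M. c k *\<^sub>R e k))\<^sup>2 \<le> (\<Sum>k=K..<M. r k * (r k * norm (e k)))\<^sup>2"
    by (intro power_mono) auto
  also have "\<dots> \<le> (\<Sum>k=K..<M. (r k)\<^sup>2) * (\<Sum>k=K..<M. (r k * norm (e k))\<^sup>2)"
    by (rule Cauchy_Schwarz_ineq_sum)
  also have "\<dots> = (\<Sum>k=K..<M. (1/3)^k) * (\<Sum>k=K..<M. (1/3)^k * (norm (e k))\<^sup>2)"
    by (simp add: power_mult_distrib) (simp add: power2_eq_square r)
  also have "\<dots> \<le> 3/2 * (1/3)^K * (\<Sum>k=K..<M. (1/3)^k * (norm (e k))\<^sup>2)"
    by (intro mult_right_mono sum_third_power_le sum_nonneg) auto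
  finally show ?thesis .
qed

text \<open>The instance of completeness that the gliding hump needs. The majorants
  \<open>q k\<close> have integrals at most (1/3)^k, so their sum is finite almost everywhere; there
  the series converges absolutely and the weighted Cauchy-Schwarz bound passes to the limit.\<close>

lemma L2_geometric_series:
  fixes e :: "nat \<Rightarrow> real \<Rightarrow> 'a::euclidean_space"
  assumes e: "\<And>k. L2 (e k)" and e1: "\<And>k. L2_norm (e k) \<le> 1" and c: "\<And>k. \<bar>c k\<bar> \<le> (1/3::real)^k"
  shows "\<exists>x. L2 x \<and> (\<forall>K. L2_norm (\<lambda>t. x t - (\<Sum>k<K. c k *\<^sub>R e k t)) \<le> 3/2 * (1/3)^K)"
proof -
  define q where "q k t = (1/3)^k * (norm (e k t))\<^sup>2" for k t
  define x where "x t = (\<Sum>k. c k *\<^sub>R e k t)" for t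
  have q0: "0 \<le> q k t" for k t by (simp add: q_def)
  have iq: "integrable unit_lebesgue (q k)" for k
    using e[of k] by (simp add: q_def[abs_def] L2_iff)
  have e1': "(LINT t|unit_lebesgue. (norm (e k t))\<^sup>2) \<le> 1" for k
  proof -
    have "(LINT t|unit_lebesgue. (norm (e k t))\<^sup>2) = (L2_norm (e k))\<^sup>2"
      by (simp add: L2_norm_square L2_inner_eq power2_norm_eq_inner)
    also have "\<dots> \<le> 1" using e1[of k] by (simp add: power_le_one)
    finally show ?thesis .
  qed
  have Iq: "(LINT t|unit_lebesgue. q k t) \<le> (1/3)^k" for k
    using mult_left_mono[OF e1'[of k], of "(1/3)^k"] by (simp add: q_def)
  have qm: "q k \<in> borel_measurable unit_lebesgue" for k
    using iq[of k] by (rule borel_measurable_integrable)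
  have Iq0: "0 \<le> (LINT t|unit_lebesgue. q k t)" for k by (simp add: q0)
  have geo: "summable (\<lambda>k. (1/3::real)^k)" by (rule summable_geometric) simp
  have "(\<integral>\<^sup>+t. (\<Sum>k. ennreal (q k t)) \<partial>unit_lebesgue) = (\<Sum>k. \<integral>\<^sup>+t. ennreal (q k t) \<partial>unit_lebesgue)"
    using qm by (intro nn_integral_suminf) auto
  also have "\<dots> = (\<Sum>k. ennreal (LINT t|unit_lebesgue. q k t))"
    using iq q0 by (intro suminf_cong nn_integral_eq_integral) auto
  also have "\<dots> \<noteq> top"
  proof (rule ennreal_suminf_neq_top[OF _ Iq0])
    show "summable (\<lambda>k. LINT t|unit_lebesgue. q k t)"
      by (rule summable_comparison_test'[OF geo, of 0]) (simp only: real_norm_def abs_of_nonneg[OF Iq0] Iq)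
  qed
  finally have fin: "(\<integral>\<^sup>+t. (\<Sum>k. ennreal (q k t)) \<partial>unit_lebesgue) \<noteq> \<infinity>" by simp
  have "AE t in unit_lebesgue. (\<Sum>k. ennreal (q k t)) \<noteq> \<infinity>"
    using qm by (intro nn_integral_noteq_infinite fin) measurable
  then have AEs: "AE t in unit_lebesgue. summable (\<lambda>k. q k t)"
    by eventually_elim (use q0 in \<open>auto intro: summable_suminf_not_top\<close>)
  have xm: "x \<in> borel_measurable unit_lebesgue"
    unfolding x_def using e[THEN L2_measurable] by measurable
  have tail: "L2 (\<lambda>t. x t - (\<Sum>k<K. c k *\<^sub>R e k t)) \<and>
      L2_norm (\<lambda>t. x t - (\<Sum>k<K. c k *\<^sub>R e k t)) \<le> 3/2 * (1/3)^K" for K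
  proof -
    define d where "d t = x t - (\<Sum>k<K. c k *\<^sub>R e k t)" for t
    define Q where "Q t = (\<Sum>k. q (k + K) t)" for t
    have dm: "d \<in> borel_measurable unit_lebesgue"
      unfolding d_def using e[THEN L2_measurable] xm by measurable
    have pw: "(norm (d t))\<^sup>2 \<le> 3/2 * (1/3)^K * Q t" if s: "summable (\<lambda>k. q k t)" for t
    proof -
      have sK: "summable (\<lambda>k. q (k + K) t)" using s summable_iff_shift[of "\<lambda>k. q k t" K] by simp
      have "summable (\<lambda>k. norm (c k *\<^sub>R e k t))"
      proof (rule summable_comparison_test')
        show "summable (\<lambda>k. (1/3)^k + q k t)" by (intro summable_add geo s)
        fix k :: nat
        \<comment> \<open>Trades the norm for its square, whose weighted series is the one known to
          converge; the geometric series pays for the summand 1.\<close>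
        have "norm (e k t) \<le> 1 + (norm (e k t))\<^sup>2"
          using zero_le_power2[of "norm (e k t) - 1"] norm_ge_zero[of "e k t"]
          unfolding power2_diff one_power2 mult_1_right by linarith
        then have "(1/3)^k * norm (e k t) \<le> (1/3)^k * (1 + (norm (e k t))\<^sup>2)"
          by (intro mult_left_mono) auto
        moreover have "\<bar>c k\<bar> * norm (e k t) \<le> (1/3)^k * norm (e k t)"
          using c[of k] by (intro mult_right_mono) auto
        ultimately show "norm (norm (c k *\<^sub>R e k t)) \<le> (1/3)^k + q k t"
          by (simp add: q_def algebra_simps)
      qed
      then have "summable (\<lambda>k. c k *\<^sub>R e k t)" by (rule summable_norm_cancel)
      then have "(\<lambda>M. \<Sum>k<M. c k *\<^sub>R e k t) \<longlonglongrightarrow> x t"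
        unfolding x_def by (rule summable_LIMSEQ)
      then have lim: "(\<lambda>M. (norm ((\<Sum>k<M. c k *\<^sub>R e k t) - (\<Sum>k<K. c k *\<^sub>R e k t)))\<^sup>2) \<longlonglongrightarrow> (norm (d t))\<^sup>2"
        unfolding d_def by (intro tendsto_intros)
      have "(norm ((\<Sum>k<M. c k *\<^sub>R e k t) - (\<Sum>k<K. c k *\<^sub>R e k t)))\<^sup>2 \<le> 3/2 * (1/3)^K * Q t" if "K \<le> M" for M
      proof -
        have "(\<Sum>k<M. c k *\<^sub>R e k t) - (\<Sum>k<K. c k *\<^sub>R e k t) = (\<Sum>k=K..<M. c k *\<^sub>R e k t)"
          using that sum_diff_nat_ivl[of 0 K M "\<lambda>k. c k *\<^sub>R e k t"] by (simp add: atLeast0LessThan)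
        then have "(norm ((\<Sum>k<M. c k *\<^sub>R e k t) - (\<Sum>k<K. c k *\<^sub>R e k t)))\<^sup>2
            \<le> 3/2 * (1/3)^K * (\<Sum>k=K..<M. q k t)"
          using norm_sum_third_power_le[OF c, of "\<lambda>k. e k t" K M] by (simp add: q_def)
        also have "(\<Sum>k=K..<M. q k t) = (\<Sum>k<M-K. q (k + K) t)"
          using sum.shift_bounds_nat_ivl[of "\<lambda>k. q k t" 0 K "M - K"] that by (simp add: atLeast0LessThan)
        also have "\<dots> \<le> Q t" unfolding Q_def by (intro sum_le_suminf sK) (auto simp: q0)
        finally show ?thesis by (simp add: mult_left_mono)
      qed
      then show ?thesis by (intro LIMSEQ_le_const2[OF lim]) auto
    qed
    have AEs': "AE t in unit_lebesgue. summable (\<lambda>k. norm (q (k + K) t))"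
      using AEs by eventually_elim (use summable_iff_shift[of "\<lambda>k. q k _" K] q0 in simp)
    have geoK: "summable (\<lambda>k. (1/3::real)^(k + K))" using geo summable_iff_shift[of "\<lambda>k. (1/3::real)^k" K] by simp
    have sI: "summable (\<lambda>k. LINT t|unit_lebesgue. norm (q (k + K) t))"
      by (rule summable_comparison_test'[OF geoK, of 0]) (use Iq q0 in \<open>auto simp: abs_of_nonneg Iq0\<close>)
    have iQ: "integrable unit_lebesgue Q"
      unfolding Q_def by (rule integrable_suminf[OF iq AEs' sI])
    have "(LINT t|unit_lebesgue. Q t) = (\<Sum>k. LINT t|unit_lebesgue. q (k + K) t)"
      unfolding Q_def by (rule integral_suminf[OF iq AEs' sI])
    also have "\<dots> \<le> (\<Sum>k. (1/3)^(k + K))"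
      using sI by (intro suminf_le Iq geoK) (simp add: q0)
    also have "\<dots> = 3/2 * (1/3)^K"
      using suminf_mult2[OF geo, of "(1/3)^K"] suminf_geometric[of "1/3::real"] by (simp add: power_add)
    finally have IQ: "(LINT t|unit_lebesgue. Q t) \<le> 3/2 * (1/3)^K" .
    have Q0: "AE t in unit_lebesgue. (norm (d t))\<^sup>2 \<le> 3/2 * (1/3)^K * Q t"
      using AEs by eventually_elim (rule pw)
    have id: "integrable unit_lebesgue (\<lambda>t. (norm (d t))\<^sup>2)"
    proof (rule Bochner_Integration.integrable_bound)
      show "integrable unit_lebesgue (\<lambda>t. 3/2 * (1/3)^K * Q t)" using iQ by simp
      show "AE t in unit_lebesgue. norm ((norm (d t))\<^sup>2) \<le> norm (3/2 * (1/3)^K * Q t)"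
        using Q0 by eventually_elim simp
    qed (use dm in measurable)
    have "(LINT t|unit_lebesgue. (norm (d t))\<^sup>2) \<le> (LINT t|unit_lebesgue. 3/2 * (1/3)^K * Q t)"
      using id iQ Q0 by (intro integral_mono_AE) auto
    also have "\<dots> \<le> 3/2 * (1/3)^K * (3/2 * (1/3)^K)"
      using mult_left_mono[OF IQ, of "3/2 * (1/3)^K"] by simp
    \<comment> \<open>The factor \<open>3/2 * (1/3)^K\<close> has come in twice, from the pointwise
      estimate and from the integral of the tail \<open>Q\<close>; hence a perfect square.\<close>
    finally have "(L2_norm d)\<^sup>2 \<le> (3/2 * (1/3)^K)\<^sup>2"
      unfolding L2_norm_square L2_inner_eq power2_norm_eq_inner by (simp only: power2_eq_square)
    then have "L2_norm d \<le> 3/2 * (1/3)^K"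
      by (rule power2_le_imp_le) simp
    moreover have "L2 d" using id dm by (simp add: L2_iff)
    ultimately show ?thesis by (simp add: d_def[abs_def])
  qed
  have "L2 x" using tail[of 0] by simp
  then show ?thesis using tail by blast
qed

text \<open>Gliding hump: adding plus or minus \<open>3^(-k) v k / norm (v k)\<close> with the right sign keeps the
  pairing with \<open>v k\<close> at least \<open>3^(-k) norm (v k)\<close>, and the later terms of the series can destroy
  at most half of that.\<close>
lemma L2_uniform_boundedness:
  fixes v :: "nat \<Rightarrow> real \<Rightarrow> 'a::euclidean_space"
  assumes v: "\<And>n. L2 (v n)" and bd: "\<And>h. L2 h \<Longrightarrow> \<exists>C. \<forall>n. \<bar>L2_inner (v n) h\<bar> \<le> C"
  shows "\<exists>R. \<forall>n. L2_norm (v n) \<le> R"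
proof (rule ccontr)
  assume "\<not> ?thesis"
  \<comment> \<open>The rate 4 has to beat the decay rate 3 of the coefficients: the pairings will
    be at least half of (4/3)^k.\<close>
  then have "\<forall>k. \<exists>n. 4^k < L2_norm (v n)" by (meson not_le)
  then obtain N where N: "\<And>k. 4^k < L2_norm (v (N k))" by metis
  define w where "w k = v (N k)" for k
  define l where "l k = L2_norm (w k)" for k
  have l: "4^k < l k" for k by (simp add: l_def w_def N)
  have l0: "0 < l k" for k using l[of k] by (meson less_trans zero_less_numeral zero_less_power)
  define e where "e k t = (1 / l k) *\<^sub>R w k t" for k t
  have w2: "L2 (w k)" for k by (simp add: w_def v)
  have e2: "L2 (e k)" for k unfolding e_def by (rule L2_scaleR[OF w2])
  have e1: "L2_norm (e k) = 1" for k
    using l0[of k] unfolding e_def by (simp add: L2_norm_scaleR l_def[symmetric])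
  have we: "L2_inner (w k) (e k) = l k" for k
    using l0[of k] unfolding e_def
    by (simp add: L2_inner_scaleR_right L2_norm_square[symmetric] l_def[symmetric] power2_eq_square)
  \<comment> \<open>A sign that is never 0: with \<open>sgn\<close> the hump would be lost whenever
    the previous pairing vanishes.\<close>
  define sg where "sg k a = (if a \<ge> (0::real) then (1/3)^k else - ((1/3::real)^k))" for k :: nat and a
  define y where "y = rec_nat (\<lambda>t. 0) (\<lambda>k z t. z t + sg k (L2_inner (w k) z) *\<^sub>R e k t)"
  have y0: "y 0 = (\<lambda>t. 0)" and yS: "y (Suc k) = (\<lambda>t. y k t + sg k (L2_inner (w k) (y k)) *\<^sub>R e k t)" for k
    by (simp_all add: y_def)
  define c where "c k = sg k (L2_inner (w k) (y k))" for k
  have ysum: "y K = (\<lambda>t. \<Sum>k<K. c k *\<^sub>R e k t)" for K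
    by (induction K) (simp_all add: y0 yS c_def)
  have c3: "\<bar>c k\<bar> \<le> (1/3)^k" for k by (simp add: c_def sg_def)
  have y2: "L2 (y K)" for K unfolding ysum by (intro L2_sum L2_scaleR e2)
  obtain x where x: "L2 x" and xt: "\<And>K. L2_norm (\<lambda>t. x t - y K t) \<le> 3/2 * (1/3)^K"
    using L2_geometric_series[of e c] e2 e1 c3 unfolding ysum by auto
  have big: "1/2 * (4/3)^k \<le> \<bar>L2_inner (w k) x\<bar>" for k
  proof -
    have "L2_inner (w k) (y (Suc k)) = L2_inner (w k) (y k) + c k * l k"
      unfolding yS c_def[symmetric]
      by (simp add: L2_inner_add_right[OF y2 L2_scaleR[OF e2] w2] L2_inner_scaleR_right we)
    then have 1: "(1/3)^k * l k \<le> \<bar>L2_inner (w k) (y (Suc k))\<bar>"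
      using mult_pos_pos[OF zero_less_power[of "1/3::real" k] l0[of k]]
      by (cases "L2_inner (w k) (y k) \<ge> 0") (simp_all add: c_def sg_def)
    have "L2_inner (w k) x = L2_inner (w k) (y (Suc k)) + L2_inner (w k) (\<lambda>t. x t - y (Suc k) t)"
      using L2_inner_add_right[OF y2[of "Suc k"] L2_diff[OF x y2[of "Suc k"]] w2[of k]] by simp
    moreover have "\<bar>L2_inner (w k) (\<lambda>t. x t - y (Suc k) t)\<bar> \<le> l k * (3/2 * (1/3)^Suc k)"
      using L2_Cauchy_Schwarz[OF w2[of k] L2_diff[OF x y2[of "Suc k"]]] xt[of "Suc k"] l0[of k]
      unfolding l_def[symmetric] by (meson less_imp_le mult_left_mono order_trans)
    moreover have "l k * (3/2 * (1/3)^Suc k) = 1/2 * ((1/3)^k * l k)" by simp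
    ultimately have 2: "1/2 * (1/3)^k * l k \<le> \<bar>L2_inner (w k) x\<bar>"
      using 1 by linarith
    have "1/2 * (4/3)^k = 1/2 * (1/3)^k * (4::real)^k" by (simp add: power_divide)
    also have "\<dots> \<le> 1/2 * (1/3)^k * l k" using l[of k] by (intro mult_left_mono) auto
    finally show ?thesis using 2 by simp
  qed
  obtain C where C: "\<And>n. \<bar>L2_inner (v n) x\<bar> \<le> C" using bd[OF x] by auto
  obtain k where "2 * C < (4/3::real)^k"
    using real_arch_pow[of "4/3" "2 * C"] by auto
  then show False using big[of k] C[of "N k"] by (simp add: w_def)
qed

lemma L2_weakly_convergent_bounded:
  assumes v: "\<And>n. L2 (v n)" and lim: "\<And>h. L2 h \<Longrightarrow> (\<lambda>n. L2_inner (v n) h) \<longlonglongrightarrow> L2_inner u h"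
  shows "\<exists>R. \<forall>n. L2_norm (v n) \<le> R"
proof (rule L2_uniform_boundedness[OF v])
  fix h :: "real \<Rightarrow> 'a" assume "L2 h"
  then have "Bseq (\<lambda>n. L2_inner (v n) h)" using lim convergentI convergent_imp_Bseq by metis
  then show "\<exists>C. \<forall>n. \<bar>L2_inner (v n) h\<bar> \<le> C" unfolding Bseq_def by auto
qed

subsection \<open>Half-Hoelder bounds\<close>

text \<open>A single constant for the supremum and for the 1/2-Hoelder seminorm keeps the bounds
  closed under sums, products (at the price of a factor 2) and primitives, so each later estimate is
  one induction.\<close>

definition holder_bound :: "real \<Rightarrow> (real \<Rightarrow> real) \<Rightarrow> bool" where
  "holder_bound B f \<longleftrightarrow> (\<forall>t\<in>{0..1}. \<bar>f t\<bar> \<le> B) \<and>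
     (\<forall>s\<in>{0..1}. \<forall>t\<in>{0..1}. \<bar>f t - f s\<bar> \<le> B * sqrt \<bar>t - s\<bar>)"

lemma holder_boundD:
  assumes "holder_bound B f"
  shows "t \<in> {0..1} \<Longrightarrow> \<bar>f t\<bar> \<le> B"
    and "s \<in> {0..1} \<Longrightarrow> t \<in> {0..1} \<Longrightarrow> \<bar>f t - f s\<bar> \<le> B * sqrt \<bar>t - s\<bar>"
  using assms by (auto simp: holder_bound_def)

lemma holder_bound_nonneg: "holder_bound B f \<Longrightarrow> 0 \<le> B"
  using holder_boundD(1)[of B f 0] by simp

lemma holder_bound_cong:
  assumes "holder_bound B f" "\<And>t. t \<in> {0..1} \<Longrightarrow> g t = f t" "B = C"
  shows "holder_bound C g"
  using assms unfolding holder_bound_def by simp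

lemma holder_bound_mono:
  assumes f: "holder_bound B f" and le: "B \<le> C" shows "holder_bound C f"
  unfolding holder_bound_def
proof (intro conjI ballI)
  fix t :: real assume t: "t \<in> {0..1}"
  show "\<bar>f t\<bar> \<le> C" using holder_boundD(1)[OF f t] le by simp
  fix s :: real assume s: "s \<in> {0..1}"
  have "\<bar>f s - f t\<bar> \<le> B * sqrt \<bar>s - t\<bar>" by (rule holder_boundD(2)[OF f t s])
  also have "\<dots> \<le> C * sqrt \<bar>s - t\<bar>" using le by (intro mult_right_mono) auto
  finally show "\<bar>f s - f t\<bar> \<le> C * sqrt \<bar>s - t\<bar>" .
qed

lemma holder_bound_const: "\<bar>c\<bar> \<le> B \<Longrightarrow> holder_bound B (\<lambda>t. c)"
  by (auto simp: holder_bound_def)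

lemma holder_bound_add:
  assumes f: "holder_bound B f" and g: "holder_bound C g"
  shows "holder_bound (B + C) (\<lambda>t. f t + g t)"
  unfolding holder_bound_def
proof (intro conjI ballI)
  fix t :: real assume t: "t \<in> {0..1}"
  show "\<bar>f t + g t\<bar> \<le> B + C" using holder_boundD(1)[OF f t] holder_boundD(1)[OF g t] by simp
  fix s :: real assume s: "s \<in> {0..1}"
  show "\<bar>f s + g s - (f t + g t)\<bar> \<le> (B + C) * sqrt \<bar>s - t\<bar>"
    using holder_boundD(2)[OF f t s] holder_boundD(2)[OF g t s] by (simp add: distrib_right)
qed

lemma holder_bound_mult:
  assumes f: "holder_bound B f" and g: "holder_bound C g"
  shows "holder_bound (2 * B * C) (\<lambda>t. f t * g t)"
  unfolding holder_bound_def
proof (intro conjI ballI)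
  note nn = holder_bound_nonneg[OF f] holder_bound_nonneg[OF g]
  fix t :: real assume t: "t \<in> {0..1}"
  have "\<bar>f t * g t\<bar> \<le> B * C"
    unfolding abs_mult using holder_boundD(1)[OF f t] holder_boundD(1)[OF g t] nn by (intro mult_mono) auto
  also have "\<dots> \<le> 2 * B * C" using nn by simp
  finally show "\<bar>f t * g t\<bar> \<le> 2 * B * C" .
  fix s :: real assume s: "s \<in> {0..1}"
  have "f s * g s - f t * g t = f s * (g s - g t) + (f s - f t) * g t" by (simp add: algebra_simps)
  then have "\<bar>f s * g s - f t * g t\<bar> \<le> \<bar>f s\<bar> * \<bar>g s - g t\<bar> + \<bar>f s - f t\<bar> * \<bar>g t\<bar>"
    by (metis abs_mult abs_triangle_ineq)
  also have "\<dots> \<le> B * (C * sqrt \<bar>s - t\<bar>) + (B * sqrt \<bar>s - t\<bar>) * C"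
    using holder_boundD(1)[OF f s] holder_boundD(1)[OF g t]
      holder_boundD(2)[OF f t s] holder_boundD(2)[OF g t s] nn by (intro add_mono mult_mono) auto
  also have "\<dots> = 2 * B * C * sqrt \<bar>s - t\<bar>" by simp
  finally show "\<bar>f s * g s - f t * g t\<bar> \<le> 2 * B * C * sqrt \<bar>s - t\<bar>" .
qed

lemma holder_bound_continuous:
  assumes f: "holder_bound B f" shows "continuous_on {0..1} f"
  unfolding continuous_on_def
proof
  fix t :: real assume t: "t \<in> {0..1}"
  have "((\<lambda>s. B * sqrt \<bar>s - t\<bar>) \<longlongrightarrow> B * sqrt \<bar>t - t\<bar>) (at t within {0..1})"
    by (intro tendsto_intros)
  then have lim: "((\<lambda>s. B * sqrt \<bar>s - t\<bar>) \<longlongrightarrow> 0) (at t within {0..1})" by simp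
  have "((\<lambda>s. f s - f t) \<longlongrightarrow> 0) (at t within {0..1})"
    by (rule Lim_null_comparison[OF _ lim])
       (auto simp: eventually_at_filter intro!: always_eventually holder_boundD(2)[OF f t])
  then show "(f \<longlongrightarrow> f t) (at t within {0..1})" by (simp add: LIM_zero_iff)
qed

subsection \<open>Primitives against a component\<close>

definition prim :: "'k::finite \<Rightarrow> (real \<Rightarrow> real^'k) \<Rightarrow> (real \<Rightarrow> real) \<Rightarrow> real \<Rightarrow> real" where
  "prim j u f t = integral {0..t} (\<lambda>\<tau>. u \<tau> $ j * f \<tau>)"

lemma continuous_on_unit_measurable:
  "continuous_on {0..1} f \<Longrightarrow> (f :: real \<Rightarrow> real) \<in> borel_measurable unit_lebesgue"
  by (rule continuous_imp_measurable_on_sets_lebesgue) auto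

lemma continuous_on_unit_bounded:
  assumes "continuous_on {0..1} (f :: real \<Rightarrow> real)"
  shows "\<exists>B. \<forall>t\<in>{0..1}. \<bar>f t\<bar> \<le> B"
proof -
  have "bounded (f ` {0..1})" using assms by (intro compact_imp_bounded compact_continuous_image) auto
  then show ?thesis unfolding bounded_iff by auto
qed

lemma integrable_component_mult:
  fixes f :: "real \<Rightarrow> real"
  assumes "L2 u" "continuous_on {0..1} f" "0 \<le> a" "a \<le> b" "b \<le> 1"
  shows "(\<lambda>\<tau>. u \<tau> $ j * f \<tau>) integrable_on {a..b}"
  using continuous_on_unit_bounded[OF assms(2)]
    L2_inner_window(1)[OF assms(1) continuous_on_unit_measurable[OF assms(2)] _ assms(3-5)]
    set_lebesgue_integral_eq_integral(1) by blast

lemma prim_add_right: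
  assumes "L2 u" "continuous_on {0..1} f" "continuous_on {0..1} g" "t \<in> {0..1}"
  shows "prim j u (\<lambda>\<tau>. f \<tau> + g \<tau>) t = prim j u f t + prim j u g t"
  unfolding prim_def distrib_left
  using assms by (intro integral_add integrable_component_mult) auto

lemma prim_diff_right:
  assumes "L2 u" "continuous_on {0..1} f" "continuous_on {0..1} g" "t \<in> {0..1}"
  shows "prim j u (\<lambda>\<tau>. f \<tau> - g \<tau>) t = prim j u f t - prim j u g t"
  unfolding prim_def right_diff_distrib
  using assms by (intro integral_diff integrable_component_mult) auto

lemma prim_scale_right: "prim j u (\<lambda>\<tau>. c * f \<tau>) t = c * prim j u f t"
  using integral_mult_right[of "{0..t}" c "\<lambda>\<tau>. u \<tau> $ j * f \<tau>"] by (simp add: prim_def mult_ac)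

lemma prim_add_left:
  assumes "L2 u" "L2 v" "continuous_on {0..1} f" "t \<in> {0..1}"
  shows "prim j (\<lambda>\<tau>. u \<tau> + v \<tau>) f t = prim j u f t + prim j v f t"
  unfolding prim_def vector_add_component distrib_right
  using assms by (intro integral_add integrable_component_mult) auto

lemma prim_diff_left:
  assumes "L2 u" "L2 v" "continuous_on {0..1} f" "t \<in> {0..1}"
  shows "prim j (\<lambda>\<tau>. u \<tau> - v \<tau>) f t = prim j u f t - prim j v f t"
  unfolding prim_def vector_minus_component left_diff_distrib
  using assms by (intro integral_diff integrable_component_mult) auto

lemma prim_scale_left: "prim j (\<lambda>\<tau>. c *\<^sub>R u \<tau>) f t = c * prim j u f t"
  using integral_mult_right[of "{0..t}" c "\<lambda>\<tau>. u \<tau> $ j * f \<tau>"] by (simp add: prim_def mult_ac)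

lemma prim_cong: "t \<in> {0..1} \<Longrightarrow> (\<And>\<tau>. \<tau> \<in> {0..1} \<Longrightarrow> f \<tau> = g \<tau>) \<Longrightarrow> prim j u f t = prim j u g t"
  unfolding prim_def by (rule integral_cong) simp

lemma abs_prim_le:
  assumes u: "L2 u" and f: "continuous_on {0..1} f" and B: "\<forall>t\<in>{0..1}. \<bar>f t\<bar> \<le> B" and t: "t \<in> {0..1}"
  shows "\<bar>prim j u f t\<bar> \<le> B * L2_norm u"
proof -
  have B0: "0 \<le> B" using B[rule_format, of 0] by simp
  have "\<bar>prim j u f t\<bar> \<le> B * L2_norm u * sqrt (t - 0)"
    unfolding prim_def
    using t by (intro abs_integral_component_le[OF u continuous_on_unit_measurable[OF f] B]) auto
  also have "\<dots> \<le> B * L2_norm u * 1" using t B0 by (intro mult_left_mono) auto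
  finally show ?thesis by simp
qed

lemma prim_diff_eq:
  assumes "L2 u" "continuous_on {0..1} f" "0 \<le> s" "s \<le> t" "t \<le> 1"
  shows "prim j u f t - prim j u f s = integral {s..t} (\<lambda>\<tau>. u \<tau> $ j * f \<tau>)"
  using Henstock_Kurzweil_Integration.integral_combine[of 0 s t "\<lambda>\<tau>. u \<tau> $ j * f \<tau>"]
    integrable_component_mult[OF assms(1,2), of 0 t j] assms(3-5) by (simp add: prim_def)

text \<open>Only the supremum of \<open>f\<close> is spent: integration against the control
  regenerates the Hoelder seminorm through the factor sqrt (t - s) of Cauchy-Schwarz.\<close>

lemma holder_bound_prim:
  assumes u: "L2 u" and R: "L2_norm u \<le> R" and f: "holder_bound B f"
  shows "holder_bound (B * R) (prim j u f)"
proof -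
  note c = holder_bound_continuous[OF f] and B0 = holder_bound_nonneg[OF f]
  have B: "\<forall>t\<in>{0..1}. \<bar>f t\<bar> \<le> B" using f by (simp add: holder_bound_def)
  have le: "\<bar>prim j u f t - prim j u f s\<bar> \<le> B * L2_norm u * sqrt \<bar>t - s\<bar>"
    if "0 \<le> s" "s \<le> t" "t \<le> 1" for s t
    using abs_integral_component_le[OF u continuous_on_unit_measurable[OF c] B that, of j] that
    by (simp add: prim_diff_eq[OF u c that])
  have "holder_bound (B * L2_norm u) (prim j u f)"
    unfolding holder_bound_def
  proof (intro conjI ballI)
    fix t :: real assume t: "t \<in> {0..1}"
    show "\<bar>prim j u f t\<bar> \<le> B * L2_norm u" by (rule abs_prim_le[OF u c B t])
    fix s :: real assume s: "s \<in> {0..1}"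
    show "\<bar>prim j u f s - prim j u f t\<bar> \<le> B * L2_norm u * sqrt \<bar>s - t\<bar>"
      using le[of s t] le[of t s] s t by (cases "s \<le> t") (auto simp: abs_minus_commute)
  qed
  then show ?thesis by (rule holder_bound_mono) (use R B0 in \<open>auto intro: mult_left_mono\<close>)
qed

subsection \<open>Weak convergence and primitives\<close>

text \<open>On each cell of length 1/N replace \<open>f\<close> by its value at the left end. What
  remains of the main part are cell integrals of \<open>w\<close>, which depend neither on
  \<open>f\<close> nor on \<open>t\<close>. The replacement costs at most \<open>B / sqrt N\<close>
  times the integral of the modulus of the component, hence one \<open>R / sqrt N\<close>; the
  incomplete last cell costs the other.\<close>

lemma abs_prim_grid_le:
  fixes w :: "real \<Rightarrow> real^'k::finite"
  assumes w: "L2 w" and R: "L2_norm w \<le> R" and f: "holder_bound B f" and t: "t \<in> {0..1}" and N: "0 < N"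
  shows "\<bar>prim j w f t\<bar> \<le>
    B * ((\<Sum>k<N. \<bar>integral {real k / N..real (Suc k) / N} (\<lambda>\<tau>. w \<tau> $ j)\<bar>) + 2 * R / sqrt N)"
proof -
  define p where "p k = real k / N" for k :: nat
  define S where "S k = \<bar>integral {p k..p (Suc k)} (\<lambda>\<tau>. w \<tau> $ j)\<bar>" for k
  \<comment> \<open>Testing with the sign of the component makes its absolute value an integrand of
    the form already treated, which gives both integrability and the bound by
    \<open>R\<close>.\<close>
  define \<sigma> where "\<sigma> \<tau> = sgn (w \<tau> $ j)" for \<tau>
  have B0: "0 \<le> B" by (rule holder_bound_nonneg[OF f])
  have R0: "0 \<le> R" using R L2_norm_nonneg[of w] by linarith
  note c = holder_bound_continuous[OF f]
  have p0: "0 \<le> p k" and pS: "p k \<le> p (Suc k)" and pd: "p (Suc k) - p k = 1 / N" for k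
    by (auto simp: p_def field_simps N)
  have p1: "p k \<le> 1" if "k \<le> N" for k using that N by (simp add: p_def)
  have \<sigma>m: "\<sigma> \<in> borel_measurable unit_lebesgue" unfolding \<sigma>_def
    using measurable_component[OF w, of j] by measurable
  have \<sigma>1: "\<forall>\<tau>\<in>{0..1}. \<bar>\<sigma> \<tau>\<bar> \<le> 1" by (auto simp: \<sigma>_def sgn_if)
  have abs_eq: "w \<tau> $ j * \<sigma> \<tau> = \<bar>w \<tau> $ j\<bar>" for \<tau> by (simp add: \<sigma>_def sgn_if)
  have ia: "(\<lambda>\<tau>. \<bar>w \<tau> $ j\<bar>) integrable_on {a..b}" if "0 \<le> a" "a \<le> b" "b \<le> 1" for a b
    using set_lebesgue_integral_eq_integral(1)[OF L2_inner_window(1)[OF w \<sigma>m \<sigma>1 that, of j]]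
    by (simp add: abs_eq)
  have iw: "(\<lambda>\<tau>. w \<tau> $ j) integrable_on {a..b}" if "0 \<le> a" "a \<le> b" "b \<le> 1" for a b
    using integrable_component_mult[OF w continuous_on_const that, of j 1] by simp
  have grid: "\<bar>prim j w f (p K)\<bar> \<le> B * (\<Sum>k<K. S k) + B / sqrt N * integral {0..p K} (\<lambda>\<tau>. \<bar>w \<tau> $ j\<bar>)"
    if "K \<le> N" for K
    using that
  proof (induction K)
    case 0
    then show ?case by (simp add: p_def prim_def)
  next
    case (Suc K)
    then have K: "Suc K \<le> N" "K < N" by auto
    note pp = p0[of K] pS[of K] p1[OF K(1)]
    let ?I = "{p K..p (Suc K)}"
    have step: "prim j w f (p (Suc K)) = prim j w f (p K) + integral ?I (\<lambda>\<tau>. w \<tau> $ j * f \<tau>)"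
      using prim_diff_eq[OF w c pp, of j] by simp
    have split: "integral ?I (\<lambda>\<tau>. w \<tau> $ j * f \<tau>)
        = f (p K) * integral ?I (\<lambda>\<tau>. w \<tau> $ j) + integral ?I (\<lambda>\<tau>. w \<tau> $ j * (f \<tau> - f (p K)))"
    proof -
      have "integral ?I (\<lambda>\<tau>. f (p K) * (w \<tau> $ j) + w \<tau> $ j * (f \<tau> - f (p K)))
         = integral ?I (\<lambda>\<tau>. f (p K) * (w \<tau> $ j)) + integral ?I (\<lambda>\<tau>. w \<tau> $ j * (f \<tau> - f (p K)))"
        using iw[OF pp] c by (intro integral_add integrable_component_mult[OF w _ pp])
          (auto intro!: integrable_on_mult_right continuous_intros)
      then show ?thesis by (simp add: algebra_simps)
    qed
    have a1: "\<bar>f (p K) * integral ?I (\<lambda>\<tau>. w \<tau> $ j)\<bar> \<le> B * S K"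
      unfolding abs_mult S_def using holder_boundD(1)[OF f, of "p K"] pp by (intro mult_right_mono) auto
    have a2: "\<bar>integral ?I (\<lambda>\<tau>. w \<tau> $ j * (f \<tau> - f (p K)))\<bar> \<le> integral ?I (\<lambda>\<tau>. B / sqrt N * \<bar>w \<tau> $ j\<bar>)"
    proof (rule integral_norm_bound_integral[where 'a = real, unfolded real_norm_def])
      show "(\<lambda>\<tau>. w \<tau> $ j * (f \<tau> - f (p K))) integrable_on ?I"
        using c by (intro integrable_component_mult[OF w _ pp] continuous_intros)
      show "(\<lambda>\<tau>. B / sqrt N * \<bar>w \<tau> $ j\<bar>) integrable_on ?I"
        by (intro integrable_on_mult_right ia[OF pp])
      fix \<tau> assume \<tau>: "\<tau> \<in> ?I"
      then have "\<bar>f \<tau> - f (p K)\<bar> \<le> B * sqrt \<bar>\<tau> - p K\<bar>"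
        using pp by (intro holder_boundD(2)[OF f]) auto
      also have "\<dots> \<le> B * sqrt (1 / N)"
        using \<tau> pd[of K] B0 by (intro mult_left_mono real_sqrt_le_mono) auto
      finally have "\<bar>f \<tau> - f (p K)\<bar> \<le> B / sqrt N" by (simp add: real_sqrt_divide)
      then show "\<bar>w \<tau> $ j * (f \<tau> - f (p K))\<bar> \<le> B / sqrt N * \<bar>w \<tau> $ j\<bar>"
        unfolding abs_mult by (metis abs_ge_zero mult.commute mult_left_mono)
    qed
    have comb: "integral {0..p K} (\<lambda>\<tau>. \<bar>w \<tau> $ j\<bar>) + integral ?I (\<lambda>\<tau>. \<bar>w \<tau> $ j\<bar>) = integral {0..p (Suc K)} (\<lambda>\<tau>. \<bar>w \<tau> $ j\<bar>)"
      using pp by (intro Henstock_Kurzweil_Integration.integral_combine ia) auto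
    have "\<bar>prim j w f (p (Suc K))\<bar> \<le> \<bar>prim j w f (p K)\<bar> + B * S K + B / sqrt N * integral ?I (\<lambda>\<tau>. \<bar>w \<tau> $ j\<bar>)"
      using a1 a2 unfolding step split by simp
    also have "\<dots> \<le> B * (\<Sum>k<K. S k) + B / sqrt N * integral {0..p K} (\<lambda>\<tau>. \<bar>w \<tau> $ j\<bar>)
        + B * S K + B / sqrt N * integral ?I (\<lambda>\<tau>. \<bar>w \<tau> $ j\<bar>)"
      using Suc by simp
    also have "\<dots> = B * (\<Sum>k<Suc K. S k) + B / sqrt N * integral {0..p (Suc K)} (\<lambda>\<tau>. \<bar>w \<tau> $ j\<bar>)"
      unfolding comb[symmetric] by (simp add: distrib_left add_ac)
    finally show ?case .
  qed
  \<comment> \<open>\<open>p K\<close> is the last grid point not after \<open>t\<close>; the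
    remaining piece is estimated by the Hoelder bound of the primitive itself.\<close>
  define K where "K = nat \<lfloor>t * N\<rfloor>"
  have Kt: "p K \<le> t" and tK: "t - p K \<le> 1 / N" and KN: "K \<le> N"
  proof -
    have "real K = of_int \<lfloor>t * N\<rfloor>" using t by (simp add: K_def)
    then have 1: "real K \<le> t * N" "t * N \<le> real K + 1" by linarith+
    then show "p K \<le> t" using N by (simp add: p_def field_simps)
    have "t \<le> (real K + 1) / N" using 1 N by (simp add: field_simps)
    then show "t - p K \<le> 1 / N" by (simp add: p_def add_divide_distrib)
    have "t * N \<le> 1 * real N" using t by (intro mult_right_mono) auto
    then show "K \<le> N" using 1 by simp
  qed
  have pK: "0 \<le> p K" "p K \<le> 1" using p0 p1[OF KN] by auto
  have "integral {0..p K} (\<lambda>\<tau>. \<bar>w \<tau> $ j\<bar>) \<le> 1 * L2_norm w * sqrt (p K - 0)"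
    using abs_integral_component_le[OF w \<sigma>m \<sigma>1 order_refl pK, of j] by (simp add: abs_eq)
  also have "\<dots> \<le> 1 * L2_norm w * 1" using pK by (intro mult_left_mono) auto
  also have "\<dots> \<le> R" using R by simp
  finally have iR: "integral {0..p K} (\<lambda>\<tau>. \<bar>w \<tau> $ j\<bar>) \<le> R" .
  have "\<bar>prim j w f t - prim j w f (p K)\<bar> \<le> B * R * sqrt \<bar>t - p K\<bar>"
    using t pK by (intro holder_boundD(2)[OF holder_bound_prim[OF w R f]]) auto
  also have "\<dots> \<le> B * R * sqrt (1 / N)"
    using Kt tK B0 R0 by (intro mult_left_mono real_sqrt_le_mono) auto
  finally have last: "\<bar>prim j w f t - prim j w f (p K)\<bar> \<le> B * (R / sqrt N)" by (simp add: real_sqrt_divide)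
  have "B / sqrt N * integral {0..p K} (\<lambda>\<tau>. \<bar>w \<tau> $ j\<bar>) \<le> B / sqrt N * R"
    using iR B0 by (intro mult_left_mono) auto
  moreover have "B * (\<Sum>k<K. S k) \<le> B * (\<Sum>k<N. S k)"
    using KN B0 by (intro mult_left_mono sum_mono2) (auto simp: S_def)
  ultimately have "\<bar>prim j w f t\<bar> \<le> B * (\<Sum>k<N. S k) + B / sqrt N * R + B * (R / sqrt N)"
    using grid[OF KN] last by linarith
  also have "\<dots> = B * ((\<Sum>k<N. S k) + 2 * R / sqrt N)" by (simp add: distrib_left)
  finally show ?thesis by (simp add: S_def p_def)
qed

text \<open>Where weak convergence becomes uniform. For a fixed grid the cell integrals are finitely
  many pairings with windows and tend to 0, while the discretisation error is small in the grid size
  uniformly in \<open>n\<close>.\<close>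

lemma weakly_null_prim:
  fixes w :: "nat \<Rightarrow> real \<Rightarrow> real^'k::finite"
  assumes w: "\<And>n. L2 (w n)" and R: "\<And>n. L2_norm (w n) \<le> R"
    and lim: "\<And>h. L2 h \<Longrightarrow> (\<lambda>n. L2_inner (w n) h) \<longlonglongrightarrow> 0"
  shows "\<exists>\<eta>. \<eta> \<longlonglongrightarrow> 0 \<and>
    (\<forall>n B f. holder_bound B f \<longrightarrow> (\<forall>t\<in>{0..1}. \<bar>prim j (w n) f t\<bar> \<le> B * \<eta> n))"
proof -
  have R0: "0 \<le> R" using R[of 0] L2_norm_nonneg[of "w 0"] by linarith
  define S where "S N n = (\<Sum>k<N. \<bar>integral {real k / N..real (Suc k) / N} (\<lambda>\<tau>. w n \<tau> $ j)\<bar>)" for N n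
  define b where "b n N = S (Suc N) n + 2 * R / sqrt (Suc N)" for n N
  \<comment> \<open>Taking the infimum over all grids removes the choice of \<open>N\<close>, so one
    null sequence serves every \<open>f\<close>, every \<open>t\<close> and every \<open>B\<close>.
    Grids have \<open>Suc N\<close> cells to keep the mesh meaningful.\<close>
  define \<eta> where "\<eta> n = (INF N. b n N)" for n
  have b0: "0 \<le> b n N" for n N by (simp add: b_def S_def R0 sum_nonneg)
  have bdd: "bdd_below (range (b n))" for n using b0 by (intro bdd_belowI2[of _ 0]) auto
  have S0: "S N \<longlonglongrightarrow> 0" if N: "0 < N" for N
  proof -
    have "(\<lambda>n. \<Sum>k<N. \<bar>L2_inner (w n) (window j (real k / N) (real (Suc k) / N) (\<lambda>t. 1))\<bar>) \<longlonglongrightarrow> (\<Sum>k<N. \<bar>0\<bar>)"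
      using N by (intro tendsto_sum tendsto_rabs lim L2_window(1)[where B = 1]) (auto simp: field_simps)
    moreover have "L2_inner (w n) (window j (real k / N) (real (Suc k) / N) (\<lambda>t. 1))
        = integral {real k / N..real (Suc k) / N} (\<lambda>\<tau>. w n \<tau> $ j)" if "k < N" for n k
      using L2_inner_window(2)[OF w, of "\<lambda>t. 1" 1 "real k / N" "real (Suc k) / N" n j] that N
      by (simp add: field_simps)
    ultimately show ?thesis by (simp add: S_def[abs_def])
  qed
  have "\<eta> \<longlonglongrightarrow> 0"
  proof (rule LIMSEQ_I)
    fix r :: real assume r: "0 < r"
    have "(\<lambda>N. 2 * R / sqrt (real (Suc N))) \<longlonglongrightarrow> 0"
      by (intro real_tendsto_divide_at_top[OF tendsto_const] filterlim_compose[OF sqrt_at_top]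
          filterlim_compose[OF filterlim_real_sequentially] filterlim_Suc)
    then obtain N where N: "2 * R / sqrt (real (Suc N)) < r / 2"
      using order_tendstoD(2)[of _ 0 sequentially "r / 2"] r eventually_happens' sequentially_bot
      by (metis (no_types, lifting) half_gt_zero)
    obtain n0 where n0: "\<And>n. n \<ge> n0 \<Longrightarrow> S (Suc N) n < r / 2"
      using order_tendstoD(2)[OF S0[of "Suc N"], of "r / 2"] r by (auto simp: eventually_sequentially)
    have "norm (\<eta> n - 0) < r" if "n \<ge> n0" for n
    proof -
      have "\<eta> n \<le> b n N" unfolding \<eta>_def by (rule cINF_lower[OF bdd]) simp
      also have "\<dots> < r" using N n0[OF that] by (simp add: b_def)
      finally show ?thesis using cINF_greatest[of UNIV 0 "b n"] b0 by (simp add: \<eta>_def)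
    qed
    then show "\<exists>n0. \<forall>n\<ge>n0. norm (\<eta> n - 0) < r" by blast
  qed
  moreover have "\<bar>prim j (w n) f t\<bar> \<le> B * \<eta> n" if f: "holder_bound B f" and t: "t \<in> {0..1}" for n B f t
  proof -
    have le: "\<bar>prim j (w n) f t\<bar> \<le> B * b n N" for N
      using abs_prim_grid_le[OF w R f t, of "Suc N" j n] by (simp add: b_def S_def)
    show ?thesis
    proof (cases "B = 0")
      case True
      then show ?thesis using le by simp
    next
      case False
      then have B: "0 < B" using holder_bound_nonneg[OF f] by simp
      then have "\<bar>prim j (w n) f t\<bar> / B \<le> \<eta> n"
        unfolding \<eta>_def using le by (intro cINF_greatest) (auto simp: field_simps)
      then show ?thesis using B by (simp add: field_simps)
    qed
  qed
  ultimately show ?thesis by blast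
qed

subsection \<open>Iterated integrals\<close>

text \<open>The functional \<open>\<Phi>\<close> together with its derivative \<open>D\<close>, where \<open>d\<close> bounds the degree in the control.\<close>
inductive iterated ::
  "nat \<Rightarrow> ((real \<Rightarrow> real^'k::finite) \<Rightarrow> real \<Rightarrow> real) \<Rightarrow>
    ((real \<Rightarrow> real^'k) \<Rightarrow> (real \<Rightarrow> real^'k) \<Rightarrow> real \<Rightarrow> real) \<Rightarrow> bool" where
  const: "iterated 0 (\<lambda>u t. c) (\<lambda>u h t. 0)"
| mono: "iterated d \<Phi> D \<Longrightarrow> d \<le> e \<Longrightarrow> iterated e \<Phi> D"
| add: "iterated d \<Phi> D \<Longrightarrow> iterated d \<Psi> E \<Longrightarrow> iterated d (\<lambda>u t. \<Phi> u t + \<Psi> u t) (\<lambda>u h t. D u h t + E u h t)"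
| mult: "iterated d \<Phi> D \<Longrightarrow> iterated e \<Psi> E \<Longrightarrow>
    iterated (d + e) (\<lambda>u t. \<Phi> u t * \<Psi> u t) (\<lambda>u h t. \<Phi> u t * E u h t + D u h t * \<Psi> u t)"
| prim: "iterated d \<Phi> D \<Longrightarrow>
    iterated (Suc d) (\<lambda>u. prim j u (\<Phi> u)) (\<lambda>u h t. prim j h (\<Phi> u) t + prim j u (D u h) t)"

section \<open>Uniform estimates for iterated integrals and their derivatives\<close>

lemma iterated_bound:
  "iterated d \<Phi> D \<Longrightarrow> \<exists>C. \<forall>u. L2 u \<longrightarrow> L2_norm u \<le> R \<longrightarrow> holder_bound C (\<Phi> u)"
proof (induction rule: iterated.induct)
  case (const c)
  show ?case by (rule exI[of _ "\<bar>c\<bar>"]) (auto intro: holder_bound_const)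
next
  case (add d \<Phi> D \<Psi> E)
  then obtain C C' where "\<forall>u. L2 u \<longrightarrow> L2_norm u \<le> R \<longrightarrow> holder_bound C (\<Phi> u)"
    "\<forall>u. L2 u \<longrightarrow> L2_norm u \<le> R \<longrightarrow> holder_bound C' (\<Psi> u)" by blast
  then show ?case by (intro exI[of _ "C + C'"]) (simp add: holder_bound_add)
next
  case (mult d \<Phi> D e \<Psi> E)
  then obtain C C' where "\<forall>u. L2 u \<longrightarrow> L2_norm u \<le> R \<longrightarrow> holder_bound C (\<Phi> u)"
    "\<forall>u. L2 u \<longrightarrow> L2_norm u \<le> R \<longrightarrow> holder_bound C' (\<Psi> u)" by blast
  then show ?case by (intro exI[of _ "2 * C * C'"]) (simp add: holder_bound_mult)
next
  case (prim d \<Phi> D j)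
  then show ?case by (meson holder_bound_prim)
qed auto

lemma iterated_deriv_bound:
  "iterated d \<Phi> D \<Longrightarrow> \<exists>C. \<forall>u h. L2 u \<longrightarrow> L2 h \<longrightarrow> L2_norm u \<le> R \<longrightarrow> holder_bound (C * L2_norm h) (D u h)"
proof (induction rule: iterated.induct)
  case (const c)
  show ?case by (rule exI[of _ 0]) (auto intro: holder_bound_const)
next
  case (add d \<Phi> D \<Psi> E)
  then obtain C C' where C: "\<And>u h. L2 u \<Longrightarrow> L2 h \<Longrightarrow> L2_norm u \<le> R \<Longrightarrow> holder_bound (C * L2_norm h) (D u h)"
    "\<And>u h. L2 u \<Longrightarrow> L2 h \<Longrightarrow> L2_norm u \<le> R \<Longrightarrow> holder_bound (C' * L2_norm h) (E u h)" by blast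
  show ?case
  proof (intro exI[of _ "C + C'"] allI impI)
    fix u h :: "real \<Rightarrow> real^'a" assume u: "L2 u" "L2 h" "L2_norm u \<le> R"
    show "holder_bound ((C + C') * L2_norm h) (\<lambda>t. D u h t + E u h t)"
      using holder_bound_add[OF C(1)[OF u] C(2)[OF u]] by (simp add: algebra_simps)
  qed
next
  case (mult d \<Phi> D e \<Psi> E)
  then obtain C C' where C: "\<And>u h. L2 u \<Longrightarrow> L2 h \<Longrightarrow> L2_norm u \<le> R \<Longrightarrow> holder_bound (C * L2_norm h) (D u h)"
    "\<And>u h. L2 u \<Longrightarrow> L2 h \<Longrightarrow> L2_norm u \<le> R \<Longrightarrow> holder_bound (C' * L2_norm h) (E u h)" by blast
  obtain B B' where B: "\<And>u. L2 u \<Longrightarrow> L2_norm u \<le> R \<Longrightarrow> holder_bound B (\<Phi> u)"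
     "\<And>u. L2 u \<Longrightarrow> L2_norm u \<le> R \<Longrightarrow> holder_bound B' (\<Psi> u)"
    using iterated_bound[OF mult(1)] iterated_bound[OF mult(2)] by blast
  show ?case
  proof (intro exI[of _ "2 * B * C' + 2 * C * B'"] allI impI)
    fix u h :: "real \<Rightarrow> real^'a" assume u: "L2 u" "L2 h" "L2_norm u \<le> R"
    note b = B(1)[OF u(1,3)] B(2)[OF u(1,3)] C(1)[OF u] C(2)[OF u]
    show "holder_bound ((2 * B * C' + 2 * C * B') * L2_norm h) (\<lambda>t. \<Phi> u t * E u h t + D u h t * \<Psi> u t)"
      by (rule holder_bound_cong[OF holder_bound_add[OF holder_bound_mult[OF b(1,4)] holder_bound_mult[OF b(3,2)]]])
         (simp_all add: algebra_simps)
  qed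
next
  case (prim d \<Phi> D j)
  then obtain C where C: "\<And>u h. L2 u \<Longrightarrow> L2 h \<Longrightarrow> L2_norm u \<le> R \<Longrightarrow> holder_bound (C * L2_norm h) (D u h)" by blast
  obtain B where B: "\<And>u. L2 u \<Longrightarrow> L2_norm u \<le> R \<Longrightarrow> holder_bound B (\<Phi> u)"
    using iterated_bound[OF prim(1)] by blast
  show ?case
  proof (intro exI[of _ "B + C * R"] allI impI)
    fix u h :: "real \<Rightarrow> real^'a" assume u: "L2 u" "L2 h" "L2_norm u \<le> R"
    show "holder_bound ((B + C * R) * L2_norm h) (\<lambda>t. prim j h (\<Phi> u) t + prim j u (D u h) t)"
      by (rule holder_bound_cong[OF holder_bound_add[OF holder_bound_prim[OF u(2) order_refl B[OF u(1,3)]]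
            holder_bound_prim[OF u(1,3) C[OF u]]]])
         (simp_all add: algebra_simps)
  qed
qed auto

lemma iterated_deriv_bound_nonneg:
  assumes "iterated d \<Phi> D"
  shows "\<exists>C\<ge>0. \<forall>u h. L2 u \<longrightarrow> L2 h \<longrightarrow> L2_norm u \<le> R \<longrightarrow> holder_bound (C * L2_norm h) (D u h)"
proof -
  obtain C where "\<And>u h. L2 u \<Longrightarrow> L2 h \<Longrightarrow> L2_norm u \<le> R \<Longrightarrow> holder_bound (C * L2_norm h) (D u h)"
    using iterated_deriv_bound[OF assms] by blast
  moreover have "C * L2_norm h \<le> \<bar>C\<bar> * L2_norm h" for h :: "real \<Rightarrow> real^'a"
    by (intro mult_right_mono) auto
  ultimately show ?thesis by (intro exI[of _ "\<bar>C\<bar>"]) (blast intro: holder_bound_mono abs_ge_zero)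
qed

lemma iterated_continuous: "iterated d \<Phi> D \<Longrightarrow> L2 u \<Longrightarrow> continuous_on {0..1} (\<Phi> u)"
  using iterated_bound[of d \<Phi> D "L2_norm u"] holder_bound_continuous by blast

lemma iterated_deriv_continuous: "iterated d \<Phi> D \<Longrightarrow> L2 u \<Longrightarrow> L2 h \<Longrightarrow> continuous_on {0..1} (D u h)"
  using iterated_deriv_bound[of d \<Phi> D "L2_norm u"] holder_bound_continuous by blast

lemma iterated_deriv_add:
  assumes "iterated d \<Phi> D" "L2 u" "L2 h" "L2 g"
  shows "t \<in> {0..1} \<Longrightarrow> D u (\<lambda>\<tau>. h \<tau> + g \<tau>) t = D u h t + D u g t"
  using assms(1)
proof (induction arbitrary: t rule: iterated.induct)
  case (prim d \<Phi> D j)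
  have "prim j u (D u (\<lambda>\<tau>. h \<tau> + g \<tau>)) t = prim j u (\<lambda>\<tau>. D u h \<tau> + D u g \<tau>) t"
    by (rule prim_cong) (use prim in auto)
  then show ?case
    using assms(2-4) prim iterated_continuous[OF prim(1)] iterated_deriv_continuous[OF prim(1)]
    by (simp add: prim_add_left prim_add_right)
qed (auto simp: algebra_simps)

lemma iterated_deriv_scale:
  assumes "iterated d \<Phi> D"
  shows "t \<in> {0..1} \<Longrightarrow> D u (\<lambda>\<tau>. c *\<^sub>R h \<tau>) t = c * D u h t"
  using assms
proof (induction arbitrary: t rule: iterated.induct)
  case (prim d \<Phi> D j)
  have "prim j u (D u (\<lambda>\<tau>. c *\<^sub>R h \<tau>)) t = prim j u (\<lambda>\<tau>. c * D u h \<tau>) t"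
    by (rule prim_cong) (use prim in auto)
  then show ?case
    by (simp add: prim_scale_left prim_scale_right algebra_simps)
qed (auto simp: algebra_simps)

text \<open>In the primitive case the difference splits into \<open>prim j u\<close> of the
  difference of the integrands plus \<open>prim j\<close> of \<open>u - v\<close> against the second
  integrand; each part is linear in something small.\<close>

lemma iterated_Lipschitz:
  "iterated d \<Phi> D \<Longrightarrow> \<exists>C. \<forall>u v. L2 u \<longrightarrow> L2 v \<longrightarrow> L2_norm u \<le> R \<longrightarrow> L2_norm v \<le> R \<longrightarrow>
    holder_bound (C * L2_norm (\<lambda>t. u t - v t)) (\<lambda>t. \<Phi> u t - \<Phi> v t)"
proof (induction rule: iterated.induct)
  case (const c)
  show ?case by (rule exI[of _ 0]) (auto intro: holder_bound_const)
next
  case (add d \<Phi> D \<Psi> E)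
  then obtain C C' where C: "\<And>u v. L2 u \<Longrightarrow> L2 v \<Longrightarrow> L2_norm u \<le> R \<Longrightarrow> L2_norm v \<le> R \<Longrightarrow>
     holder_bound (C * L2_norm (\<lambda>t. u t - v t)) (\<lambda>t. \<Phi> u t - \<Phi> v t)"
    "\<And>u v. L2 u \<Longrightarrow> L2 v \<Longrightarrow> L2_norm u \<le> R \<Longrightarrow> L2_norm v \<le> R \<Longrightarrow>
     holder_bound (C' * L2_norm (\<lambda>t. u t - v t)) (\<lambda>t. \<Psi> u t - \<Psi> v t)" by blast
  show ?case
  proof (intro exI[of _ "C + C'"] allI impI)
    fix u v :: "real \<Rightarrow> real^'a" assume u: "L2 u" "L2 v" "L2_norm u \<le> R" "L2_norm v \<le> R"
    show "holder_bound ((C + C') * L2_norm (\<lambda>t. u t - v t)) (\<lambda>t. \<Phi> u t + \<Psi> u t - (\<Phi> v t + \<Psi> v t))"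
      by (rule holder_bound_cong[OF holder_bound_add[OF C(1)[OF u] C(2)[OF u]]]) (simp_all add: algebra_simps)
  qed
next
  case (mult d \<Phi> D e \<Psi> E)
  then obtain C C' where C: "\<And>u v. L2 u \<Longrightarrow> L2 v \<Longrightarrow> L2_norm u \<le> R \<Longrightarrow> L2_norm v \<le> R \<Longrightarrow>
     holder_bound (C * L2_norm (\<lambda>t. u t - v t)) (\<lambda>t. \<Phi> u t - \<Phi> v t)"
    "\<And>u v. L2 u \<Longrightarrow> L2 v \<Longrightarrow> L2_norm u \<le> R \<Longrightarrow> L2_norm v \<le> R \<Longrightarrow>
     holder_bound (C' * L2_norm (\<lambda>t. u t - v t)) (\<lambda>t. \<Psi> u t - \<Psi> v t)" by blast
  obtain B B' where B: "\<And>u. L2 u \<Longrightarrow> L2_norm u \<le> R \<Longrightarrow> holder_bound B (\<Phi> u)"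
     "\<And>u. L2 u \<Longrightarrow> L2_norm u \<le> R \<Longrightarrow> holder_bound B' (\<Psi> u)"
    using iterated_bound[OF mult(1)] iterated_bound[OF mult(2)] by blast
  show ?case
  proof (intro exI[of _ "2 * B * C' + 2 * C * B'"] allI impI)
    fix u v :: "real \<Rightarrow> real^'a" assume u: "L2 u" "L2 v" "L2_norm u \<le> R" "L2_norm v \<le> R"
    note b = B(1)[OF u(1,3)] B(2)[OF u(2,4)] C(1)[OF u] C(2)[OF u]
    show "holder_bound ((2 * B * C' + 2 * C * B') * L2_norm (\<lambda>t. u t - v t)) (\<lambda>t. \<Phi> u t * \<Psi> u t - \<Phi> v t * \<Psi> v t)"
      by (rule holder_bound_cong[OF holder_bound_add[OF holder_bound_mult[OF b(1,4)] holder_bound_mult[OF b(3,2)]]])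
         (simp_all add: algebra_simps)
  qed
next
  case (prim d \<Phi> D j)
  then obtain C where C: "\<And>u v. L2 u \<Longrightarrow> L2 v \<Longrightarrow> L2_norm u \<le> R \<Longrightarrow> L2_norm v \<le> R \<Longrightarrow>
     holder_bound (C * L2_norm (\<lambda>t. u t - v t)) (\<lambda>t. \<Phi> u t - \<Phi> v t)" by blast
  obtain B where B: "\<And>u. L2 u \<Longrightarrow> L2_norm u \<le> R \<Longrightarrow> holder_bound B (\<Phi> u)"
    using iterated_bound[OF prim(1)] by blast
  note cont = iterated_continuous[OF prim(1)]
  show ?case
  proof (intro exI[of _ "C * R + B"] allI impI)
    fix u v :: "real \<Rightarrow> real^'a" assume u: "L2 u" "L2 v" "L2_norm u \<le> R" "L2_norm v \<le> R"
    show "holder_bound ((C * R + B) * L2_norm (\<lambda>t. u t - v t)) (\<lambda>t. prim j u (\<Phi> u) t - prim j v (\<Phi> v) t)"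
      by (rule holder_bound_cong[OF holder_bound_add[OF holder_bound_prim[OF u(1,3) C[OF u], of j]
            holder_bound_prim[OF L2_diff[OF u(1,2)] order_refl B[OF u(2,4)], of j]]])
         (simp_all add: prim_diff_left prim_diff_right u cont algebra_simps)
  qed
qed auto

text \<open>Every term is telescoped so that exactly one factor is a difference; hence the bounds
  for values, derivatives and differences of values have to be available first.\<close>

lemma iterated_deriv_Lipschitz:
  "iterated d \<Phi> D \<Longrightarrow> \<exists>C. \<forall>u v h. L2 u \<longrightarrow> L2 v \<longrightarrow> L2 h \<longrightarrow> L2_norm u \<le> R \<longrightarrow> L2_norm v \<le> R \<longrightarrow>
    holder_bound (C * L2_norm (\<lambda>t. u t - v t) * L2_norm h) (\<lambda>t. D u h t - D v h t)"
proof (induction rule: iterated.induct)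
  case (const c)
  show ?case by (rule exI[of _ 0]) (auto intro: holder_bound_const)
next
  case (add d \<Phi> D \<Psi> E)
  then obtain C C' where C: "\<And>u v h. L2 u \<Longrightarrow> L2 v \<Longrightarrow> L2 h \<Longrightarrow> L2_norm u \<le> R \<Longrightarrow> L2_norm v \<le> R \<Longrightarrow>
     holder_bound (C * L2_norm (\<lambda>t. u t - v t) * L2_norm h) (\<lambda>t. D u h t - D v h t)"
    "\<And>u v h. L2 u \<Longrightarrow> L2 v \<Longrightarrow> L2 h \<Longrightarrow> L2_norm u \<le> R \<Longrightarrow> L2_norm v \<le> R \<Longrightarrow>
     holder_bound (C' * L2_norm (\<lambda>t. u t - v t) * L2_norm h) (\<lambda>t. E u h t - E v h t)" by blast
  show ?case
  proof (intro exI[of _ "C + C'"] allI impI)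
    fix u v h :: "real \<Rightarrow> real^'a" assume u: "L2 u" "L2 v" "L2 h" "L2_norm u \<le> R" "L2_norm v \<le> R"
    show "holder_bound ((C + C') * L2_norm (\<lambda>t. u t - v t) * L2_norm h) (\<lambda>t. D u h t + E u h t - (D v h t + E v h t))"
      by (rule holder_bound_cong[OF holder_bound_add[OF C(1)[OF u] C(2)[OF u]]]) (simp_all add: algebra_simps)
  qed
next
  case (mult d \<Phi> D e \<Psi> E)
  then obtain C C' where C: "\<And>u v h. L2 u \<Longrightarrow> L2 v \<Longrightarrow> L2 h \<Longrightarrow> L2_norm u \<le> R \<Longrightarrow> L2_norm v \<le> R \<Longrightarrow>
     holder_bound (C * L2_norm (\<lambda>t. u t - v t) * L2_norm h) (\<lambda>t. D u h t - D v h t)"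
    "\<And>u v h. L2 u \<Longrightarrow> L2 v \<Longrightarrow> L2 h \<Longrightarrow> L2_norm u \<le> R \<Longrightarrow> L2_norm v \<le> R \<Longrightarrow>
     holder_bound (C' * L2_norm (\<lambda>t. u t - v t) * L2_norm h) (\<lambda>t. E u h t - E v h t)" by blast
  obtain B B' where B: "\<And>u. L2 u \<Longrightarrow> L2_norm u \<le> R \<Longrightarrow> holder_bound B (\<Phi> u)"
     "\<And>u. L2 u \<Longrightarrow> L2_norm u \<le> R \<Longrightarrow> holder_bound B' (\<Psi> u)"
    using iterated_bound[OF mult(1)] iterated_bound[OF mult(2)] by blast
  obtain A A' where A: "\<And>u h. L2 u \<Longrightarrow> L2 h \<Longrightarrow> L2_norm u \<le> R \<Longrightarrow> holder_bound (A * L2_norm h) (D u h)"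
     "\<And>u h. L2 u \<Longrightarrow> L2 h \<Longrightarrow> L2_norm u \<le> R \<Longrightarrow> holder_bound (A' * L2_norm h) (E u h)"
    using iterated_deriv_bound[OF mult(1)] iterated_deriv_bound[OF mult(2)] by blast
  obtain K K' where K: "\<And>u v. L2 u \<Longrightarrow> L2 v \<Longrightarrow> L2_norm u \<le> R \<Longrightarrow> L2_norm v \<le> R \<Longrightarrow>
     holder_bound (K * L2_norm (\<lambda>t. u t - v t)) (\<lambda>t. \<Phi> u t - \<Phi> v t)"
    "\<And>u v. L2 u \<Longrightarrow> L2 v \<Longrightarrow> L2_norm u \<le> R \<Longrightarrow> L2_norm v \<le> R \<Longrightarrow>
     holder_bound (K' * L2_norm (\<lambda>t. u t - v t)) (\<lambda>t. \<Psi> u t - \<Psi> v t)"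
    using iterated_Lipschitz[OF mult(1)] iterated_Lipschitz[OF mult(2)] by blast
  show ?case
  proof (intro exI[of _ "2 * B * C' + 2 * K * A' + (2 * A * K' + 2 * C * B')"] allI impI)
    fix u v h :: "real \<Rightarrow> real^'a" assume u: "L2 u" "L2 v" "L2 h" "L2_norm u \<le> R" "L2_norm v \<le> R"
    note b = holder_bound_mult[OF B(1)[OF u(1,4)] C(2)[OF u]] holder_bound_mult[OF K(1)[OF u(1,2,4,5)] A(2)[OF u(2,3,5)]]
      holder_bound_mult[OF A(1)[OF u(1,3,4)] K(2)[OF u(1,2,4,5)]] holder_bound_mult[OF C(1)[OF u] B(2)[OF u(2,5)]]
    show "holder_bound ((2 * B * C' + 2 * K * A' + (2 * A * K' + 2 * C * B')) * L2_norm (\<lambda>t. u t - v t) * L2_norm h)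
       (\<lambda>t. \<Phi> u t * E u h t + D u h t * \<Psi> u t - (\<Phi> v t * E v h t + D v h t * \<Psi> v t))"
      by (rule holder_bound_cong[OF holder_bound_add[OF holder_bound_add[OF b(1,2)] holder_bound_add[OF b(3,4)]]])
         (simp_all add: algebra_simps)
  qed
next
  case (prim d \<Phi> D j)
  then obtain C where C: "\<And>u v h. L2 u \<Longrightarrow> L2 v \<Longrightarrow> L2 h \<Longrightarrow> L2_norm u \<le> R \<Longrightarrow> L2_norm v \<le> R \<Longrightarrow>
     holder_bound (C * L2_norm (\<lambda>t. u t - v t) * L2_norm h) (\<lambda>t. D u h t - D v h t)" by blast
  obtain A where A: "\<And>u h. L2 u \<Longrightarrow> L2 h \<Longrightarrow> L2_norm u \<le> R \<Longrightarrow> holder_bound (A * L2_norm h) (D u h)"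
    using iterated_deriv_bound[OF prim(1)] by blast
  obtain K where K: "\<And>u v. L2 u \<Longrightarrow> L2 v \<Longrightarrow> L2_norm u \<le> R \<Longrightarrow> L2_norm v \<le> R \<Longrightarrow>
     holder_bound (K * L2_norm (\<lambda>t. u t - v t)) (\<lambda>t. \<Phi> u t - \<Phi> v t)"
    using iterated_Lipschitz[OF prim(1)] by blast
  note cont = iterated_continuous[OF prim(1)] iterated_deriv_continuous[OF prim(1)]
  show ?case
  proof (intro exI[of _ "K + (C * R + A)"] allI impI)
    fix u v h :: "real \<Rightarrow> real^'a" assume u: "L2 u" "L2 v" "L2 h" "L2_norm u \<le> R" "L2_norm v \<le> R"
    note b = holder_bound_prim[OF u(3) order_refl K[OF u(1,2,4,5)], of j] holder_bound_prim[OF u(1,4) C[OF u], of j]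
      holder_bound_prim[OF L2_diff[OF u(1,2)] order_refl A[OF u(2,3,5)], of j]
    show "holder_bound ((K + (C * R + A)) * L2_norm (\<lambda>t. u t - v t) * L2_norm h)
      (\<lambda>t. prim j h (\<Phi> u) t + prim j u (D u h) t - (prim j h (\<Phi> v) t + prim j v (D v h) t))"
      by (rule holder_bound_cong[OF holder_bound_add[OF b(1) holder_bound_add[OF b(2,3)]]])
         (simp_all add: prim_diff_left prim_diff_right u cont algebra_simps)
  qed
qed auto

text \<open>Besides the remainders of the constituents, a product leaves the derivative of one
  factor times the increment of the other, and a primitive leaves \<open>prim j h\<close> of the
  increment. Both are quadratic in \<open>h\<close> by the Lipschitz estimate.\<close>

lemma iterated_Taylor:
  "iterated d \<Phi> D \<Longrightarrow> \<exists>C. \<forall>u h. L2 u \<longrightarrow> L2 h \<longrightarrow> L2_norm u \<le> R \<longrightarrow> L2_norm (\<lambda>t. u t + h t) \<le> R \<longrightarrow>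
    holder_bound (C * L2_norm h * L2_norm h) (\<lambda>t. \<Phi> (\<lambda>t. u t + h t) t - \<Phi> u t - D u h t)"
proof (induction rule: iterated.induct)
  case (const c)
  show ?case by (rule exI[of _ 0]) (auto intro: holder_bound_const)
next
  case (add d \<Phi> D \<Psi> E)
  then obtain C C' where C: "\<And>u h. L2 u \<Longrightarrow> L2 h \<Longrightarrow> L2_norm u \<le> R \<Longrightarrow> L2_norm (\<lambda>t. u t + h t) \<le> R \<Longrightarrow>
     holder_bound (C * L2_norm h * L2_norm h) (\<lambda>t. \<Phi> (\<lambda>t. u t + h t) t - \<Phi> u t - D u h t)"
    "\<And>u h. L2 u \<Longrightarrow> L2 h \<Longrightarrow> L2_norm u \<le> R \<Longrightarrow> L2_norm (\<lambda>t. u t + h t) \<le> R \<Longrightarrow>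
     holder_bound (C' * L2_norm h * L2_norm h) (\<lambda>t. \<Psi> (\<lambda>t. u t + h t) t - \<Psi> u t - E u h t)" by blast
  show ?case
  proof (intro exI[of _ "C + C'"] allI impI)
    fix u h :: "real \<Rightarrow> real^'a" assume u: "L2 u" "L2 h" "L2_norm u \<le> R" "L2_norm (\<lambda>t. u t + h t) \<le> R"
    show "holder_bound ((C + C') * L2_norm h * L2_norm h)
      (\<lambda>t. \<Phi> (\<lambda>t. u t + h t) t + \<Psi> (\<lambda>t. u t + h t) t - (\<Phi> u t + \<Psi> u t) - (D u h t + E u h t))"
      by (rule holder_bound_cong[OF holder_bound_add[OF C(1)[OF u] C(2)[OF u]]]) (simp_all add: algebra_simps)
  qed
next
  case (mult d \<Phi> D e \<Psi> E)
  then obtain C C' where C: "\<And>u h. L2 u \<Longrightarrow> L2 h \<Longrightarrow> L2_norm u \<le> R \<Longrightarrow> L2_norm (\<lambda>t. u t + h t) \<le> R \<Longrightarrow>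
     holder_bound (C * L2_norm h * L2_norm h) (\<lambda>t. \<Phi> (\<lambda>t. u t + h t) t - \<Phi> u t - D u h t)"
    "\<And>u h. L2 u \<Longrightarrow> L2 h \<Longrightarrow> L2_norm u \<le> R \<Longrightarrow> L2_norm (\<lambda>t. u t + h t) \<le> R \<Longrightarrow>
     holder_bound (C' * L2_norm h * L2_norm h) (\<lambda>t. \<Psi> (\<lambda>t. u t + h t) t - \<Psi> u t - E u h t)" by blast
  obtain B B' where B: "\<And>u. L2 u \<Longrightarrow> L2_norm u \<le> R \<Longrightarrow> holder_bound B (\<Phi> u)"
     "\<And>u. L2 u \<Longrightarrow> L2_norm u \<le> R \<Longrightarrow> holder_bound B' (\<Psi> u)"
    using iterated_bound[OF mult(1)] iterated_bound[OF mult(2)] by blast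
  obtain A where A: "\<And>u h. L2 u \<Longrightarrow> L2 h \<Longrightarrow> L2_norm u \<le> R \<Longrightarrow> holder_bound (A * L2_norm h) (D u h)"
    using iterated_deriv_bound[OF mult(1)] by blast
  obtain K where K: "\<And>u v. L2 u \<Longrightarrow> L2 v \<Longrightarrow> L2_norm u \<le> R \<Longrightarrow> L2_norm v \<le> R \<Longrightarrow>
     holder_bound (K * L2_norm (\<lambda>t. u t - v t)) (\<lambda>t. \<Psi> u t - \<Psi> v t)"
    using iterated_Lipschitz[OF mult(2)] by blast
  show ?case
  proof (intro exI[of _ "2 * C * B' + (2 * B * C' + 2 * A * K)"] allI impI)
    fix u h :: "real \<Rightarrow> real^'a" assume u: "L2 u" "L2 h" "L2_norm u \<le> R" "L2_norm (\<lambda>t. u t + h t) \<le> R"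
    have uh: "L2 (\<lambda>t. u t + h t)" by (rule L2_add[OF u(1,2)])
    have K': "holder_bound (K * L2_norm h) (\<lambda>t. \<Psi> (\<lambda>t. u t + h t) t - \<Psi> u t)"
      using K[OF uh u(1,4,3)] by simp
    note b = holder_bound_mult[OF C(1)[OF u] B(2)[OF uh u(4)]] holder_bound_mult[OF B(1)[OF u(1,3)] C(2)[OF u]]
      holder_bound_mult[OF A[OF u(1,2,3)] K']
    show "holder_bound ((2 * C * B' + (2 * B * C' + 2 * A * K)) * L2_norm h * L2_norm h)
      (\<lambda>t. \<Phi> (\<lambda>t. u t + h t) t * \<Psi> (\<lambda>t. u t + h t) t - \<Phi> u t * \<Psi> u t - (\<Phi> u t * E u h t + D u h t * \<Psi> u t))"
      by (rule holder_bound_cong[OF holder_bound_add[OF b(1) holder_bound_add[OF b(2,3)]]])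
         (simp_all add: algebra_simps)
  qed
next
  case (prim d \<Phi> D j)
  then obtain C where C: "\<And>u h. L2 u \<Longrightarrow> L2 h \<Longrightarrow> L2_norm u \<le> R \<Longrightarrow> L2_norm (\<lambda>t. u t + h t) \<le> R \<Longrightarrow>
     holder_bound (C * L2_norm h * L2_norm h) (\<lambda>t. \<Phi> (\<lambda>t. u t + h t) t - \<Phi> u t - D u h t)" by blast
  obtain K where K: "\<And>u v. L2 u \<Longrightarrow> L2 v \<Longrightarrow> L2_norm u \<le> R \<Longrightarrow> L2_norm v \<le> R \<Longrightarrow>
     holder_bound (K * L2_norm (\<lambda>t. u t - v t)) (\<lambda>t. \<Phi> u t - \<Phi> v t)"
    using iterated_Lipschitz[OF prim(1)] by blast
  note cont = iterated_continuous[OF prim(1)] iterated_deriv_continuous[OF prim(1)]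
  show ?case
  proof (intro exI[of _ "C * R + K"] allI impI)
    fix u h :: "real \<Rightarrow> real^'a" assume u: "L2 u" "L2 h" "L2_norm u \<le> R" "L2_norm (\<lambda>t. u t + h t) \<le> R"
    have uh: "L2 (\<lambda>t. u t + h t)" by (rule L2_add[OF u(1,2)])
    have K': "holder_bound (K * L2_norm h) (\<lambda>t. \<Phi> (\<lambda>t. u t + h t) t - \<Phi> u t)"
      using K[OF uh u(1,4,3)] by simp
    note b = holder_bound_prim[OF u(1,3) C[OF u], of j] holder_bound_prim[OF u(2) order_refl K', of j]
    show "holder_bound ((C * R + K) * L2_norm h * L2_norm h)
      (\<lambda>t. prim j (\<lambda>t. u t + h t) (\<Phi> (\<lambda>t. u t + h t)) t - prim j u (\<Phi> u) t - (prim j h (\<Phi> u) t + prim j u (D u h) t))"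
    proof (rule holder_bound_cong[OF holder_bound_add[OF b(1,2)]])
      fix t :: real assume t: "t \<in> {0..1}"
      note c = cont(1)[OF uh] cont(1)[OF u(1)] cont(2)[OF u(1,2)]
      show "prim j (\<lambda>t. u t + h t) (\<Phi> (\<lambda>t. u t + h t)) t - prim j u (\<Phi> u) t - (prim j h (\<Phi> u) t + prim j u (D u h) t)
        = prim j u (\<lambda>t. \<Phi> (\<lambda>t. u t + h t) t - \<Phi> u t - D u h t) t + prim j h (\<lambda>t. \<Phi> (\<lambda>t. u t + h t) t - \<Phi> u t) t"
        unfolding prim_diff_right[OF u(1) continuous_on_diff[OF c(1,2)] c(3) t] prim_diff_right[OF u(1) c(1,2) t]
          prim_diff_right[OF u(2) c(1,2) t] prim_add_left[OF u(1,2) c(1) t] by simp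
    qed (simp add: algebra_simps)
  qed
qed auto

lemma abs_mult_diff_le:
  fixes a b c d :: real
  assumes "\<bar>a\<bar> \<le> B" "\<bar>b - d\<bar> \<le> e" "\<bar>a - c\<bar> \<le> f" "\<bar>d\<bar> \<le> A"
  shows "\<bar>a * b - c * d\<bar> \<le> B * e + f * A"
proof -
  have "\<bar>a * b - c * d\<bar> = \<bar>a * (b - d) + (a - c) * d\<bar>" by (simp add: algebra_simps)
  also have "\<dots> \<le> \<bar>a\<bar> * \<bar>b - d\<bar> + \<bar>a - c\<bar> * \<bar>d\<bar>" by (metis abs_mult abs_triangle_ineq)
  also have "\<dots> \<le> B * e + f * A" using assms by (intro add_mono mult_mono) auto
  finally show ?thesis .
qed

text \<open>Values and derivatives are carried through one induction because the derivative of a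
  product or of a primitive involves the values. Convergence is asserted in the supremum norm; the
  Hoelder bounds are used at the limit \<open>u\<close>, where they are linear in the norm of
  \<open>h\<close> and so make the rate uniform over \<open>h\<close>.\<close>

lemma iterated_weakly_continuous:
  assumes v: "\<And>n. L2 (v n)" and u: "L2 u"
    and lim: "\<And>h. L2 h \<Longrightarrow> (\<lambda>n. L2_inner (v n) h) \<longlonglongrightarrow> L2_inner u h"
  shows "iterated d \<Phi> D \<Longrightarrow> \<exists>e. e \<longlonglongrightarrow> 0 \<and> (\<forall>n. \<forall>t\<in>{0..1}. \<bar>\<Phi> (v n) t - \<Phi> u t\<bar> \<le> e n \<and>
     (\<forall>h. L2 h \<longrightarrow> \<bar>D (v n) h t - D u h t\<bar> \<le> e n * L2_norm h))"
proof (induction rule: iterated.induct)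
  case (const c)
  show ?case by (rule exI[of _ "\<lambda>n. 0"]) auto
next
  case (add d \<Phi> D \<Psi> E)
  then obtain e f where e: "e \<longlonglongrightarrow> 0" "\<And>n t. t \<in> {0..1} \<Longrightarrow> \<bar>\<Phi> (v n) t - \<Phi> u t\<bar> \<le> e n"
     "\<And>n t h. t \<in> {0..1} \<Longrightarrow> L2 h \<Longrightarrow> \<bar>D (v n) h t - D u h t\<bar> \<le> e n * L2_norm h"
    and f: "f \<longlonglongrightarrow> 0" "\<And>n t. t \<in> {0..1} \<Longrightarrow> \<bar>\<Psi> (v n) t - \<Psi> u t\<bar> \<le> f n"
     "\<And>n t h. t \<in> {0..1} \<Longrightarrow> L2 h \<Longrightarrow> \<bar>E (v n) h t - E u h t\<bar> \<le> f n * L2_norm h" by blast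
  show ?case
  proof (intro exI[of _ "\<lambda>n. e n + f n"] conjI allI ballI impI)
    show "(\<lambda>n. e n + f n) \<longlonglongrightarrow> 0" using tendsto_add[OF e(1) f(1)] by simp
    fix n and t :: real assume t: "t \<in> {0..1}"
    show "\<bar>\<Phi> (v n) t + \<Psi> (v n) t - (\<Phi> u t + \<Psi> u t)\<bar> \<le> e n + f n"
      using e(2)[OF t, of n] f(2)[OF t, of n] by linarith
    fix h :: "real \<Rightarrow> real^'a" assume h: "L2 h"
    show "\<bar>D (v n) h t + E (v n) h t - (D u h t + E u h t)\<bar> \<le> (e n + f n) * L2_norm h"
      using e(3)[OF t h, of n] f(3)[OF t h, of n] unfolding distrib_right by linarith
  qed
next
  case (mult d \<Phi> D d' \<Psi> E)
  then obtain e f where e: "e \<longlonglongrightarrow> 0" "\<And>n t. t \<in> {0..1} \<Longrightarrow> \<bar>\<Phi> (v n) t - \<Phi> u t\<bar> \<le> e n"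
     "\<And>n t h. t \<in> {0..1} \<Longrightarrow> L2 h \<Longrightarrow> \<bar>D (v n) h t - D u h t\<bar> \<le> e n * L2_norm h"
    and f: "f \<longlonglongrightarrow> 0" "\<And>n t. t \<in> {0..1} \<Longrightarrow> \<bar>\<Psi> (v n) t - \<Psi> u t\<bar> \<le> f n"
     "\<And>n t h. t \<in> {0..1} \<Longrightarrow> L2 h \<Longrightarrow> \<bar>E (v n) h t - E u h t\<bar> \<le> f n * L2_norm h" by blast
  obtain R0 where R0: "\<And>n. L2_norm (v n) \<le> R0" using L2_weakly_convergent_bounded[OF v lim] by blast
  define R where "R = max R0 (L2_norm u)"
  have R: "L2_norm (v n) \<le> R" "L2_norm u \<le> R" for n using R0[of n] by (auto simp: R_def)
  obtain B B' where B: "\<And>u. L2 u \<Longrightarrow> L2_norm u \<le> R \<Longrightarrow> holder_bound B (\<Phi> u)"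
     "\<And>u. L2 u \<Longrightarrow> L2_norm u \<le> R \<Longrightarrow> holder_bound B' (\<Psi> u)"
    using iterated_bound[OF mult(1)] iterated_bound[OF mult(2)] by blast
  obtain A A' where A0: "0 \<le> A" "0 \<le> A'" and A: "\<And>u h. L2 u \<Longrightarrow> L2 h \<Longrightarrow> L2_norm u \<le> R \<Longrightarrow> holder_bound (A * L2_norm h) (D u h)"
     "\<And>u h. L2 u \<Longrightarrow> L2 h \<Longrightarrow> L2_norm u \<le> R \<Longrightarrow> holder_bound (A' * L2_norm h) (E u h)"
    using iterated_deriv_bound_nonneg[OF mult(1), of R] iterated_deriv_bound_nonneg[OF mult(2), of R] by blast
  note Bv = holder_boundD(1)[OF B(1)[OF v R(1)]] holder_boundD(1)[OF B(2)[OF v R(1)]]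
    and Bu = holder_boundD(1)[OF B(1)[OF u R(2)]] holder_boundD(1)[OF B(2)[OF u R(2)]]
    and Av = holder_boundD(1)[OF A(1)[OF v _ R(1)]] and Au = holder_boundD(1)[OF A(2)[OF u _ R(2)]]
  define g where "g n = (B * f n + e n * B') + (e n * A' + A * f n)" for n
  have e0: "0 \<le> e n" and f0: "0 \<le> f n" for n using e(2)[of 0 n] f(2)[of 0 n] by auto
  show ?case
  proof (intro exI[of _ g] conjI allI ballI impI)
    have "g \<longlonglongrightarrow> (B * 0 + 0 * B') + (0 * A' + A * 0)"
      unfolding g_def by (intro tendsto_intros e(1) f(1))
    then show "g \<longlonglongrightarrow> 0" by simp
    fix n and t :: real assume t: "t \<in> {0..1}"
    have 1: "\<bar>\<Phi> (v n) t * \<Psi> (v n) t - \<Phi> u t * \<Psi> u t\<bar> \<le> B * f n + e n * B'"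
      by (rule abs_mult_diff_le[OF Bv(1)[OF t] f(2)[OF t] e(2)[OF t] Bu(2)[OF t]])
    then show "\<bar>\<Phi> (v n) t * \<Psi> (v n) t - \<Phi> u t * \<Psi> u t\<bar> \<le> g n"
      unfolding g_def using A0 e0[of n] f0[of n] by (simp add: add_increasing2)
    fix h :: "real \<Rightarrow> real^'a" assume h: "L2 h"
    have 2: "\<bar>\<Phi> (v n) t * E (v n) h t - \<Phi> u t * E u h t\<bar> \<le> B * (f n * L2_norm h) + e n * (A' * L2_norm h)"
      by (rule abs_mult_diff_le[OF Bv(1)[OF t] f(3)[OF t h] e(2)[OF t] Au[OF h t]])
    have 3: "\<bar>D (v n) h t * \<Psi> (v n) t - D u h t * \<Psi> u t\<bar> \<le> (A * L2_norm h) * f n + (e n * L2_norm h) * B'"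
      by (rule abs_mult_diff_le[OF Av[OF h t] f(2)[OF t] e(3)[OF t h] Bu(2)[OF t]])
    have "g n * L2_norm h = B * (f n * L2_norm h) + e n * (A' * L2_norm h) + ((A * L2_norm h) * f n + (e n * L2_norm h) * B')"
      by (simp add: g_def algebra_simps)
    then show "\<bar>\<Phi> (v n) t * E (v n) h t + D (v n) h t * \<Psi> (v n) t - (\<Phi> u t * E u h t + D u h t * \<Psi> u t)\<bar> \<le> g n * L2_norm h"
      using 2 3 by linarith
  qed
next
  case (prim d \<Phi> D j)
  then obtain e where e: "e \<longlonglongrightarrow> 0" "\<And>n t. t \<in> {0..1} \<Longrightarrow> \<bar>\<Phi> (v n) t - \<Phi> u t\<bar> \<le> e n"
     "\<And>n t h. t \<in> {0..1} \<Longrightarrow> L2 h \<Longrightarrow> \<bar>D (v n) h t - D u h t\<bar> \<le> e n * L2_norm h" by blast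
  obtain R where R: "\<And>n. L2_norm (v n) \<le> R" using L2_weakly_convergent_bounded[OF v lim] by blast
  note cont = iterated_continuous[OF prim(1)] iterated_deriv_continuous[OF prim(1)]
  define w where "w n t = v n t - u t" for n t
  have w: "L2 (w n)" for n unfolding w_def by (rule L2_diff[OF v u])
  have wlim: "(\<lambda>n. L2_inner (w n) h) \<longlonglongrightarrow> 0" if "L2 h" for h
    using tendsto_diff[OF lim[OF that] tendsto_const[of "L2_inner u h"]]
    unfolding w_def by (simp add: L2_inner_diff_left[OF v u that])
  have wR: "L2_norm (w n) \<le> R + L2_norm u" for n
    unfolding w_def using L2_norm_triangle_diff[OF v[of n] u] R[of n] by linarith
  obtain \<eta> where \<eta>: "\<eta> \<longlonglongrightarrow> 0"
     "\<And>n B f t. holder_bound B f \<Longrightarrow> t \<in> {0..1} \<Longrightarrow> \<bar>prim j (w n) f t\<bar> \<le> B * \<eta> n"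
    using weakly_null_prim[OF w wR wlim, of j] by blast
  obtain B where B: "holder_bound B (\<Phi> u)" using iterated_bound[OF prim(1), of "L2_norm u"] u by blast
  obtain A where A0: "0 \<le> A" and A: "\<And>h. L2 h \<Longrightarrow> holder_bound (A * L2_norm h) (D u h)"
    using iterated_deriv_bound_nonneg[OF prim(1), of "L2_norm u"] u by blast
  define g where "g n = (e n * R + B * \<eta> n) + (e n + A * \<eta> n)" for n
  have e0: "0 \<le> e n" for n using e(2)[of 0 n] by auto
  have \<eta>0: "0 \<le> \<eta> n" for n using \<eta>(2)[OF holder_bound_const, of 0 1 0 n] by simp
  have B0: "0 \<le> B" by (rule holder_bound_nonneg[OF B])
  have R0: "0 \<le> R" using R[of 0] L2_norm_nonneg[of "v 0"] by linarith
  \<comment> \<open>The difference splits into the bounded control \<open>v n\<close> against a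
    small function and the weakly null control \<open>w n\<close> against the fixed limit integrand;
    only the latter has to be Hoelder.\<close>
  have main: "\<bar>prim j (v n) f t - prim j u g t\<bar> \<le> a * R + b * \<eta> n"
    if f: "continuous_on {0..1} f" and g: "holder_bound b g" and le: "\<And>t. t \<in> {0..1} \<Longrightarrow> \<bar>f t - g t\<bar> \<le> a"
      and t: "t \<in> {0..1}" for n f g a b t
  proof -
    note gc = holder_bound_continuous[OF g]
    have a0: "0 \<le> a" using le[of 0] by auto
    have "\<bar>prim j (v n) (\<lambda>t. f t - g t) t\<bar> \<le> a * L2_norm (v n)"
      using le by (intro abs_prim_le[OF v _ _ t] continuous_on_diff f gc) auto
    also have "\<dots> \<le> a * R" using R a0 by (intro mult_left_mono) auto
    finally have "\<bar>prim j (v n) (\<lambda>t. f t - g t) t\<bar> \<le> a * R" .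
    moreover have "\<bar>prim j (w n) g t\<bar> \<le> b * \<eta> n" by (rule \<eta>(2)[OF g t])
    moreover have "prim j (v n) f t - prim j u g t = prim j (v n) (\<lambda>t. f t - g t) t + prim j (w n) g t"
      unfolding w_def by (simp add: prim_diff_right[OF v f gc t] prim_diff_left[OF v u gc t])
    ultimately show ?thesis by linarith
  qed
  show ?case
  proof (intro exI[of _ g] conjI allI ballI impI)
    have "g \<longlonglongrightarrow> (0 * R + B * 0) + (0 + A * 0)"
      unfolding g_def by (intro tendsto_intros e(1) \<eta>(1))
    then show "g \<longlonglongrightarrow> 0" by simp
    fix n and t :: real assume t: "t \<in> {0..1}"
    have "\<bar>prim j (v n) (\<Phi> (v n)) t - prim j u (\<Phi> u) t\<bar> \<le> e n * R + B * \<eta> n"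
      by (rule main[OF cont(1)[OF v] B e(2) t])
    then show "\<bar>prim j (v n) (\<Phi> (v n)) t - prim j u (\<Phi> u) t\<bar> \<le> g n"
      unfolding g_def using A0 e0[of n] \<eta>0[of n] by (simp add: add_increasing2)
    fix h :: "real \<Rightarrow> real^'a" assume h: "L2 h"
    have 1: "\<bar>prim j (v n) (D (v n) h) t - prim j u (D u h) t\<bar> \<le> (e n * L2_norm h) * R + (A * L2_norm h) * \<eta> n"
      by (rule main[OF cont(2)[OF v h] A[OF h] e(3)[OF _ h] t])
    have "\<bar>prim j h (\<lambda>t. \<Phi> (v n) t - \<Phi> u t) t\<bar> \<le> e n * L2_norm h"
      using e(2) by (intro abs_prim_le[OF h _ _ t] continuous_on_diff cont(1) v u) auto
    then have 2: "\<bar>prim j h (\<Phi> (v n)) t - prim j h (\<Phi> u) t\<bar> \<le> e n * L2_norm h"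
      by (simp add: prim_diff_right[OF h cont(1)[OF v] cont(1)[OF u] t])
    have "0 \<le> B * \<eta> n * L2_norm h" using B0 \<eta>0[of n] by simp
    moreover have "g n * L2_norm h = (e n * L2_norm h) * R + (A * L2_norm h) * \<eta> n + e n * L2_norm h + B * \<eta> n * L2_norm h"
      by (simp add: g_def algebra_simps)
    ultimately show "\<bar>prim j h (\<Phi> (v n)) t + prim j (v n) (D (v n) h) t - (prim j h (\<Phi> u) t + prim j u (D u h) t)\<bar> \<le> g n * L2_norm h"
      using 1 2 by linarith
  qed
qed auto

subsection \<open>Polynomial dependence\<close>

text \<open>Polynomials in \<open>c\<close> whose coefficients are continuous functions of time,
  generated by multiplication with one variable at a time. Time-dependent coefficients make the
  class stable under \<open>prim\<close>; the generators replace bookkeeping with multi-indices by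
  induction.\<close>

inductive poly_path :: "nat \<Rightarrow> nat \<Rightarrow> ((nat \<Rightarrow> real) \<Rightarrow> real \<Rightarrow> real) \<Rightarrow> bool" for n where
  coeff: "continuous_on {0..1} b \<Longrightarrow> poly_path n 0 (\<lambda>c. b)"
| mono: "poly_path n d P \<Longrightarrow> d \<le> e \<Longrightarrow> poly_path n e P"
| add: "poly_path n d P \<Longrightarrow> poly_path n d Q \<Longrightarrow> poly_path n d (\<lambda>c t. P c t + Q c t)"
| var: "i < n \<Longrightarrow> poly_path n d P \<Longrightarrow> poly_path n (Suc d) (\<lambda>c t. c i * P c t)"

lemma poly_path_continuous: "poly_path n d P \<Longrightarrow> continuous_on {0..1} (P c)"
  by (induction rule: poly_path.induct) (auto intro: continuous_intros)

lemma poly_path_zero: "poly_path n d (\<lambda>c t. 0)"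
  using poly_path.mono[OF poly_path.coeff[OF continuous_on_const[of _ 0]], of d n] by simp

lemma poly_path_sum: "(\<And>i. i \<in> I \<Longrightarrow> poly_path n d (P i)) \<Longrightarrow> poly_path n d (\<lambda>c t. \<Sum>i\<in>I. P i c t)"
  by (induction I rule: infinite_finite_induct) (auto intro: poly_path_zero poly_path.add)

lemma poly_path_coeff_mult:
  assumes b: "continuous_on {0..1} b" and Q: "poly_path n e Q"
  shows "poly_path n e (\<lambda>c t. b t * Q c t)"
  using Q
proof (induction rule: poly_path.induct)
  case (coeff a)
  then show ?case using b by (intro poly_path.coeff continuous_intros)
next
  case (mono d P e)
  then show ?case by (blast intro: poly_path.mono)
next
  case (add d P Q)
  then show ?case using poly_path.add[of n d "\<lambda>c t. b t * P c t" "\<lambda>c t. b t * Q c t"]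
    by (simp add: distrib_left)
next
  case (var i d P)
  then show ?case using poly_path.var[of i n d "\<lambda>c t. b t * P c t"] by (simp add: mult.left_commute)
qed

lemma poly_path_mult:
  assumes P: "poly_path n d P" and Q: "poly_path n e Q"
  shows "poly_path n (d + e) (\<lambda>c t. P c t * Q c t)"
  using P
proof (induction rule: poly_path.induct)
  case (coeff b)
  then show ?case using poly_path_coeff_mult[OF coeff Q] by simp
next
  case (mono d P d')
  then show ?case by (blast intro: poly_path.mono add_right_mono)
next
  case (add d P P')
  then show ?case using poly_path.add[of n "d + e" "\<lambda>c t. P c t * Q c t" "\<lambda>c t. P' c t * Q c t"]
    by (simp add: distrib_right)
next
  case (var i d P)
  then show ?case using poly_path.var[of i n "d + e" "\<lambda>c t. P c t * Q c t"] by (simp add: mult.assoc)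
qed

text \<open>Integration in time acts on the coefficients alone, since the variables
  \<open>c i\<close> come out of the integral.\<close>

lemma poly_path_prim:
  assumes h: "L2 h" and P: "poly_path n d P"
  shows "\<exists>Q. poly_path n d Q \<and> (\<forall>c. \<forall>t\<in>{0..1}. prim j h (P c) t = Q c t)"
  using P
proof (induction rule: poly_path.induct)
  case (coeff b)
  have "continuous_on {0..1} (prim j h b)"
    unfolding prim_def[abs_def]
    by (intro indefinite_integral_continuous_1 integrable_component_mult[OF h coeff]) auto
  then show ?case by (blast intro: poly_path.coeff)
next
  case (mono d P e)
  then show ?case by (blast intro: poly_path.mono)
next
  case (add d P P')
  then obtain Q Q' where Q: "poly_path n d Q" "\<And>c t. t \<in> {0..1} \<Longrightarrow> prim j h (P c) t = Q c t"
    "poly_path n d Q'" "\<And>c t. t \<in> {0..1} \<Longrightarrow> prim j h (P' c) t = Q' c t" by blast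
  show ?case
    using poly_path.add[OF Q(1,3)] Q(2,4)
    by (intro exI[of _ "\<lambda>c t. Q c t + Q' c t"])
       (simp add: prim_add_right[OF h poly_path_continuous[OF add(1)] poly_path_continuous[OF add(2)]])
next
  case (var i d P)
  then obtain Q where "poly_path n d Q" "\<And>c t. t \<in> {0..1} \<Longrightarrow> prim j h (P c) t = Q c t" by blast
  then show ?case using poly_path.var[OF var(1), of d Q]
    by (intro exI[of _ "\<lambda>c t. c i * Q c t"]) (simp add: prim_scale_right)
qed

lemma prim_sum_left:
  assumes "finite I" "\<And>i. i \<in> I \<Longrightarrow> L2 (h i)" "continuous_on {0..1} f" "t \<in> {0..1}"
  shows "prim j (\<lambda>t. \<Sum>i\<in>I. c i *\<^sub>R h i t) f t = (\<Sum>i\<in>I. c i * prim j (h i) f t)"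
  using assms
proof (induction I rule: finite_induct)
  case empty
  then show ?case by (simp add: prim_def)
next
  case (insert x F)
  have "L2 (\<lambda>t. c x *\<^sub>R h x t)" "L2 (\<lambda>t. \<Sum>i\<in>F. c i *\<^sub>R h i t)"
    using insert.prems by (auto intro!: L2_scaleR L2_sum)
  then show ?case using insert by (simp add: prim_add_left prim_scale_left)
qed

text \<open>The integrating control \<open>\<Sum>i<n. c i *\<^sub>R hs i t\<close> is linear in
  \<open>c\<close>, so each primitive contributes one more factor \<open>c i\<close>; this matches
  the step from \<open>d\<close> to \<open>Suc d\<close> in \<open>iterated\<close>.\<close>

lemma iterated_poly_path:
  assumes hs: "\<forall>i<n. L2 (hs i)"
  shows "iterated d \<Phi> D \<Longrightarrow>
    \<exists>P. poly_path n d P \<and> (\<forall>c. \<forall>t\<in>{0..1}. \<Phi> (\<lambda>t. \<Sum>i<n. c i *\<^sub>R hs i t) t = P c t)"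
proof (induction rule: iterated.induct)
  case (const c)
  show ?case using poly_path.coeff[OF continuous_on_const[of _ c], of n] by blast
next
  case (mono d \<Phi> D e)
  then show ?case by (blast intro: poly_path.mono)
next
  case (add d \<Phi> D \<Psi> E)
  then obtain P Q where "poly_path n d P" "\<forall>c. \<forall>t\<in>{0..1}. \<Phi> (\<lambda>t. \<Sum>i<n. c i *\<^sub>R hs i t) t = P c t"
    "poly_path n d Q" "\<forall>c. \<forall>t\<in>{0..1}. \<Psi> (\<lambda>t. \<Sum>i<n. c i *\<^sub>R hs i t) t = Q c t" by blast
  then show ?case by (intro exI[of _ "\<lambda>c t. P c t + Q c t"]) (simp add: poly_path.add)
next
  case (mult d \<Phi> D e \<Psi> E)
  then obtain P Q where "poly_path n d P" "\<forall>c. \<forall>t\<in>{0..1}. \<Phi> (\<lambda>t. \<Sum>i<n. c i *\<^sub>R hs i t) t = P c t"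
    "poly_path n e Q" "\<forall>c. \<forall>t\<in>{0..1}. \<Psi> (\<lambda>t. \<Sum>i<n. c i *\<^sub>R hs i t) t = Q c t" by blast
  then show ?case by (intro exI[of _ "\<lambda>c t. P c t * Q c t"]) (simp add: poly_path_mult)
next
  case (prim d \<Phi> D j)
  then obtain P where P: "poly_path n d P" "\<And>c t. t \<in> {0..1} \<Longrightarrow> \<Phi> (\<lambda>t. \<Sum>i<n. c i *\<^sub>R hs i t) t = P c t"
    by blast
  have "\<forall>i\<in>{..<n}. \<exists>Q. poly_path n d Q \<and> (\<forall>c. \<forall>t\<in>{0..1}. prim j (hs i) (P c) t = Q c t)"
    using poly_path_prim[OF _ P(1)] hs by blast
  then obtain Q where Q: "\<And>i. i < n \<Longrightarrow> poly_path n d (Q i)"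
    "\<And>i c t. i < n \<Longrightarrow> t \<in> {0..1} \<Longrightarrow> prim j (hs i) (P c) t = Q i c t"
    by (metis lessThan_iff)
  show ?case
  proof (intro exI[of _ "\<lambda>c t. \<Sum>i\<in>{..<n}. c i * Q i c t"] conjI allI ballI)
    show "poly_path n (Suc d) (\<lambda>c t. \<Sum>i\<in>{..<n}. c i * Q i c t)"
      by (intro poly_path_sum poly_path.var Q) auto
    fix c and t :: real assume t: "t \<in> {0..1}"
    have "prim j (\<lambda>t. \<Sum>i<n. c i *\<^sub>R hs i t) (\<Phi> (\<lambda>t. \<Sum>i<n. c i *\<^sub>R hs i t)) t
        = prim j (\<lambda>t. \<Sum>i<n. c i *\<^sub>R hs i t) (P c) t"
      by (rule prim_cong[OF t P(2)])
    also have "\<dots> = (\<Sum>i<n. c i * prim j (hs i) (P c) t)"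
      using hs by (intro prim_sum_left poly_path_continuous[OF P(1)] t) auto
    also have "\<dots> = (\<Sum>i<n. c i * Q i c t)" by (intro sum.cong refl) (simp add: Q(2)[OF _ t])
    finally show "prim j (\<lambda>t. \<Sum>i<n. c i *\<^sub>R hs i t) (\<Phi> (\<lambda>t. \<Sum>i<n. c i *\<^sub>R hs i t)) t = (\<Sum>i<n. c i * Q i c t)" .
  qed
qed

section \<open>Polynomials as sums over multi-indices\<close>

abbreviation exponents :: "nat \<Rightarrow> nat \<Rightarrow> (nat \<Rightarrow> nat) set" where
  "exponents n d \<equiv> {\<alpha>. (\<forall>i. n \<le> i \<longrightarrow> \<alpha> i = 0) \<and> sum \<alpha> {..<n} \<le> d}"

lemma finite_exponents: "finite (exponents n d)"
proof (rule finite_subset)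
  show "exponents n d \<subseteq> {\<alpha>. \<forall>x. (x \<in> {..<n} \<longrightarrow> \<alpha> x \<in> {..d}) \<and> (x \<notin> {..<n} \<longrightarrow> \<alpha> x = 0)}"
    by (auto intro: order_trans[OF member_le_sum[of _ "{..<n}"]])
  show "finite {\<alpha>. \<forall>x. (x \<in> {..<n} \<longrightarrow> \<alpha> x \<in> {..d}) \<and> (x \<notin> {..<n} \<longrightarrow> \<alpha> x = (0::nat))}"
    by (rule finite_set_of_finite_funs) auto
qed

lemma poly_le_const: "poly_le n 0 (\<lambda>c. b)"
  unfolding poly_le_def
proof (intro exI[of _ "\<lambda>\<alpha>. b"] allI)
  fix c :: "nat \<Rightarrow> real"
  have "exponents n 0 = {\<lambda>i. 0}" by (auto simp: fun_eq_iff) (metis lessThan_iff not_le)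
  then show "b = (\<Sum>\<alpha>\<in>exponents n 0. (\<Prod>i<n. c i ^ \<alpha> i) *\<^sub>R b)" by simp
qed

lemma poly_le_mono:
  assumes "poly_le n d P" "d \<le> e" shows "poly_le n e P"
proof -
  obtain a where a: "\<And>c. P c = (\<Sum>\<alpha>\<in>exponents n d. (\<Prod>i<n. c i ^ \<alpha> i) *\<^sub>R a \<alpha>)"
    using assms(1) unfolding poly_le_def by blast
  have "P c = (\<Sum>\<alpha>\<in>exponents n e. (\<Prod>i<n. c i ^ \<alpha> i) *\<^sub>R (if \<alpha> \<in> exponents n d then a \<alpha> else 0))" for c
    unfolding a by (rule sum.mono_neutral_cong_left) (use assms(2) in \<open>auto simp: finite_exponents\<close>)
  then show ?thesis unfolding poly_le_def by (intro exI allI)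
qed

lemma poly_le_add:
  assumes "poly_le n d P" "poly_le n d Q" shows "poly_le n d (\<lambda>c. P c + Q c)"
proof -
  obtain a b where "\<And>c. P c = (\<Sum>\<alpha>\<in>exponents n d. (\<Prod>i<n. c i ^ \<alpha> i) *\<^sub>R a \<alpha>)"
     "\<And>c. Q c = (\<Sum>\<alpha>\<in>exponents n d. (\<Prod>i<n. c i ^ \<alpha> i) *\<^sub>R b \<alpha>)"
    using assms unfolding poly_le_def by blast
  then have "P c + Q c = (\<Sum>\<alpha>\<in>exponents n d. (\<Prod>i<n. c i ^ \<alpha> i) *\<^sub>R (a \<alpha> + b \<alpha>))" for c
    by (simp add: scaleR_add_right sum.distrib)
  then show ?thesis unfolding poly_le_def by (intro exI allI)
qed

text \<open>Multiplication by \<open>c i\<close> shifts multi-indices by the injection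
  \<open>up\<close>. Monomials outside its image receive coefficient 0, and the left inverse
  \<open>dn\<close> finds the old coefficient.\<close>

lemma poly_le_var:
  assumes i: "i < n" and P: "poly_le n d P" shows "poly_le n (Suc d) (\<lambda>c. c i *\<^sub>R P c)"
proof -
  obtain a where a: "\<And>c. P c = (\<Sum>\<alpha>\<in>exponents n d. (\<Prod>i<n. c i ^ \<alpha> i) *\<^sub>R a \<alpha>)"
    using P unfolding poly_le_def by blast
  define up where "up \<alpha> = \<alpha>(i := Suc (\<alpha> i))" for \<alpha> :: "nat \<Rightarrow> nat"
  define dn where "dn \<alpha> = \<alpha>(i := \<alpha> i - 1)" for \<alpha> :: "nat \<Rightarrow> nat"
  have du: "dn (up \<alpha>) = \<alpha>" for \<alpha> by (simp add: up_def dn_def)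
  have inj: "inj_on up (exponents n d)" by (rule inj_on_inverseI[where g = dn]) (rule du)
  have sub: "up ` exponents n d \<subseteq> exponents n (Suc d)"
  proof
    fix \<beta> assume "\<beta> \<in> up ` exponents n d"
    then obtain \<alpha> where \<alpha>: "\<alpha> \<in> exponents n d" and \<beta>: "\<beta> = up \<alpha>" by blast
    have "sum (up \<alpha>) {..<n} = Suc (sum \<alpha> {..<n})"
    proof -
      have "sum \<gamma> {..<n} = \<gamma> i + sum \<gamma> ({..<n} - {i})" for \<gamma> :: "nat \<Rightarrow> nat"
        using i by (intro sum.remove) auto
      moreover have "sum (up \<alpha>) ({..<n} - {i}) = sum \<alpha> ({..<n} - {i})" by (rule sum.cong) (auto simp: up_def)
      ultimately show ?thesis by (simp add: up_def)
    qed
    then show "\<beta> \<in> exponents n (Suc d)" using \<alpha> i unfolding \<beta> by (auto simp: up_def)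
  qed
  have mon: "(\<Prod>k<n. c k ^ up \<alpha> k) = c i * (\<Prod>k<n. c k ^ \<alpha> k)" for c :: "nat \<Rightarrow> real" and \<alpha>
  proof -
    have "(\<Prod>k<n. c k ^ \<gamma> k) = c i ^ \<gamma> i * (\<Prod>k\<in>{..<n} - {i}. c k ^ \<gamma> k)" for \<gamma> :: "nat \<Rightarrow> nat"
      using i by (intro prod.remove) auto
    moreover have "(\<Prod>k\<in>{..<n} - {i}. c k ^ up \<alpha> k) = (\<Prod>k\<in>{..<n} - {i}. c k ^ \<alpha> k)"
      by (rule prod.cong) (auto simp: up_def)
    ultimately show ?thesis by (simp add: up_def mult.assoc)
  qed
  have "c i *\<^sub>R P c = (\<Sum>\<beta>\<in>exponents n (Suc d).
      (\<Prod>k<n. c k ^ \<beta> k) *\<^sub>R (if \<beta> \<in> up ` exponents n d then a (dn \<beta>) else 0))" for c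
  proof -
    have "c i *\<^sub>R P c = (\<Sum>\<alpha>\<in>exponents n d. (\<Prod>k<n. c k ^ up \<alpha> k) *\<^sub>R a (dn (up \<alpha>)))"
      unfolding a mon du by (simp add: scaleR_sum_right)
    also have "\<dots> = (\<Sum>\<beta>\<in>up ` exponents n d. (\<Prod>k<n. c k ^ \<beta> k) *\<^sub>R a (dn \<beta>))"
      by (simp add: sum.reindex[OF inj])
    also have "\<dots> = (\<Sum>\<beta>\<in>exponents n (Suc d).
      (\<Prod>k<n. c k ^ \<beta> k) *\<^sub>R (if \<beta> \<in> up ` exponents n d then a (dn \<beta>) else 0))"
      by (rule sum.mono_neutral_cong_left[OF finite_exponents sub]) auto
    finally show ?thesis .
  qed
  then show ?thesis unfolding poly_le_def by (intro exI allI)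
qed

lemma poly_path_poly_le:
  assumes "poly_path n d P" shows "poly_le n d (\<lambda>c. P c t)"
  using assms
proof (induction rule: poly_path.induct)
  case (var i d P)
  then show ?case using poly_le_var[OF var(1), of d "\<lambda>c. P c t"] by simp
qed (auto intro: poly_le_const poly_le_mono poly_le_add)

lemma poly_le_vec:
  fixes P :: "(nat \<Rightarrow> real) \<Rightarrow> real^'m"
  assumes "\<And>i. poly_le n d (\<lambda>c. P c $ i)"
  shows "poly_le n d P"
proof -
  have "\<forall>i. \<exists>a. \<forall>c. P c $ i = (\<Sum>\<alpha>\<in>exponents n d. (\<Prod>i<n. c i ^ \<alpha> i) *\<^sub>R a \<alpha>)"
    using assms unfolding poly_le_def by blast
  from choice[OF this]
  obtain a where a: "\<And>i c. P c $ i = (\<Sum>\<alpha>\<in>exponents n d. (\<Prod>i<n. c i ^ \<alpha> i) *\<^sub>R a i \<alpha>)" by blast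
  have "P c = (\<Sum>\<alpha>\<in>exponents n d. (\<Prod>i<n. c i ^ \<alpha> i) *\<^sub>R (\<chi> i. a i \<alpha>))" for c
    by (simp only: vec_eq_iff a sum_component vector_scaleR_component vec_lambda_beta) simp
  then show ?thesis unfolding poly_le_def by (intro exI allI)
qed

lemma iterated_poly_le:
  assumes "\<forall>i<n. L2 (hs i)" "iterated d \<Phi> D" "t \<in> {0..1}"
  shows "poly_le n d (\<lambda>c. \<Phi> (\<lambda>t. \<Sum>i<n. c i *\<^sub>R hs i t) t)"
  using iterated_poly_path[OF assms(1,2)] poly_path_poly_le[of n d _ t] assms(3) by auto

subsection \<open>Smooth maps\<close>

lemma smooth_map_has_derivative:
  "smooth_map f \<Longrightarrow> (f has_derivative frechet_derivative f (at x)) (at x)"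
  by (erule smooth_map.cases) (simp add: frechet_derivative_works[symmetric])

lemma smooth_map_linear_deriv: "smooth_map f \<Longrightarrow> linear (frechet_derivative f (at x))"
  using smooth_map_has_derivative has_derivative_linear by blast

lemma smooth_map_deriv_Basis:
  "smooth_map f \<Longrightarrow> b \<in> Basis \<Longrightarrow> smooth_map (\<lambda>x. frechet_derivative f (at x) b)"
  by (erule smooth_map.cases) simp

text \<open>Coinduction needs a set of maps closed under directional derivatives; combinations with
  the same coefficients \<open>c\<close> of arbitrary smooth families form one, as differentiation
  only changes the family.\<close>

lemma smooth_map_lincomb:
  fixes g :: "'i \<Rightarrow> 'a::euclidean_space \<Rightarrow> 'b::real_normed_vector"
  assumes "\<forall>i\<in>I. smooth_map (g i)"
  shows "smooth_map (\<lambda>x. \<Sum>i\<in>I. c i *\<^sub>R g i x)"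
  using assms
proof (coinduction arbitrary: g)
  case smooth_map
  have d: "((\<lambda>x. \<Sum>i\<in>I. c i *\<^sub>R g i x) has_derivative
      (\<lambda>v. \<Sum>i\<in>I. c i *\<^sub>R frechet_derivative (g i) (at x) v)) (at x)" for x
    using smooth_map by (intro has_derivative_sum has_derivative_scaleR_right smooth_map_has_derivative) auto
  then have eq: "frechet_derivative (\<lambda>x. \<Sum>i\<in>I. c i *\<^sub>R g i x) (at x)
      = (\<lambda>v. \<Sum>i\<in>I. c i *\<^sub>R frechet_derivative (g i) (at x) v)" for x
    by (rule frechet_derivative_at[symmetric])
  show ?case
  proof (intro exI[of _ "\<lambda>x. \<Sum>i\<in>I. c i *\<^sub>R g i x"] conjI allI ballI disjI1)
    fix x show "(\<lambda>x. \<Sum>i\<in>I. c i *\<^sub>R g i x) differentiable (at x)"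
      using d unfolding differentiable_def by blast
  next
    fix b :: 'a assume b: "b \<in> Basis"
    show "\<exists>g'. (\<lambda>x. frechet_derivative (\<lambda>x. \<Sum>i\<in>I. c i *\<^sub>R g i x) (at x) b) = (\<lambda>x. \<Sum>i\<in>I. c i *\<^sub>R g' i x)
        \<and> (\<forall>i\<in>I. smooth_map (g' i))"
      using smooth_map smooth_map_deriv_Basis[OF _ b]
      by (intro exI[of _ "\<lambda>i x. frechet_derivative (g i) (at x) b"]) (auto simp: eq)
  qed simp
qed

lemma smooth_map_deriv:
  fixes f :: "'a::euclidean_space \<Rightarrow> 'b::real_normed_vector"
  assumes f: "smooth_map f"
  shows "smooth_map (\<lambda>x. frechet_derivative f (at x) w)"
proof -
  have "frechet_derivative f (at x) w = (\<Sum>b\<in>Basis. (w \<bullet> b) *\<^sub>R frechet_derivative f (at x) b)" for x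
  proof -
    interpret linear "frechet_derivative f (at x)" by (rule smooth_map_linear_deriv[OF f])
    show ?thesis by (subst (1) euclidean_representation[of w, symmetric]) (simp add: sum scale)
  qed
  then show ?thesis
    using smooth_map_lincomb[of Basis "\<lambda>b x. frechet_derivative f (at x) b" "\<lambda>b. w \<bullet> b"]
      smooth_map_deriv_Basis[OF f] by simp
qed

lemma frechet_derivative_affine:
  assumes f: "smooth_map f" and L: "bounded_linear L"
  shows "((\<lambda>x. f (c + L x)) has_derivative (\<lambda>v. frechet_derivative f (at (c + L x)) (L v))) (at x)"
proof -
  have "((\<lambda>x. c + L x) has_derivative L) (at x)"
    using bounded_linear_imp_has_derivative[OF L] by (auto intro!: derivative_eq_intros)
  from has_derivative_compose[OF this smooth_map_has_derivative[OF f]] show ?thesis by simp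
qed

text \<open>The derivative in direction \<open>b\<close> is the derivative of \<open>f\<close> in
  direction \<open>L b\<close> composed with the same affine map, so the coinduction generalises
  over \<open>f\<close> alone.\<close>

lemma smooth_map_affine:
  fixes f :: "'a::euclidean_space \<Rightarrow> 'b::real_normed_vector" and L :: "'c::euclidean_space \<Rightarrow> 'a"
  assumes L: "bounded_linear L" and f: "smooth_map f"
  shows "smooth_map (\<lambda>x. f (c + L x))"
  using f
proof (coinduction arbitrary: f)
  case smooth_map
  note d = frechet_derivative_affine[OF smooth_map L]
  have eq: "frechet_derivative (\<lambda>x. f (c + L x)) (at x) = (\<lambda>v. frechet_derivative f (at (c + L x)) (L v))" for x
    using d by (rule frechet_derivative_at[symmetric])
  show ?case
  proof (intro exI[of _ "\<lambda>x. f (c + L x)"] conjI allI ballI disjI1)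
    fix x show "(\<lambda>x. f (c + L x)) differentiable (at x)"
      using d unfolding differentiable_def by blast
  next
    fix b :: 'c
    show "\<exists>f'. (\<lambda>x. frechet_derivative (\<lambda>x. f (c + L x)) (at x) b) = (\<lambda>x. f' (c + L x)) \<and> smooth_map f'"
      using smooth_map_deriv[OF smooth_map, of "L b"]
      by (intro exI[of _ "\<lambda>y. frechet_derivative f (at y) (L b)"]) (auto simp: eq)
  qed simp
qed

subsection \<open>Symmetry of second derivatives\<close>

text \<open>The mean value theorem in direction \<open>a\<close> leaves a difference of the partial
  derivative at two points near \<open>x\<close>; both are expanded to first order at
  \<open>x\<close>, which uses differentiability of that partial derivative at this single point.
  The second difference is symmetric in \<open>a\<close> and \<open>b\<close>, and this is what the
  next lemma exploits.\<close>

lemma second_difference_quotient: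
  fixes f :: "'a::real_normed_vector \<Rightarrow> real"
  assumes f: "\<And>y. (f has_derivative f' y) (at y)" and A: "((\<lambda>y. f' y a) has_derivative A') (at x)"
    and e: "0 < e"
  shows "\<exists>\<delta>>0. \<forall>h. 0 < h \<longrightarrow> h < \<delta> \<longrightarrow>
    \<bar>f (x + h *\<^sub>R a + h *\<^sub>R b) - f (x + h *\<^sub>R a) - f (x + h *\<^sub>R b) + f x - h * (h * A' b)\<bar>
      \<le> h * (h * (2 * e * (norm a + norm b)))"
proof -
  have bl: "bounded_linear A'" by (rule has_derivative_bounded_linear[OF A])
  interpret A': bounded_linear A' by (rule bl)
  obtain d where d: "0 < d" and dd: "\<And>y. norm (y - x) < d \<Longrightarrow> \<bar>f' y a - f' x a - A' (y - x)\<bar> \<le> e * norm (y - x)"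
    using A e unfolding has_derivative_at_alt by (auto simp: real_norm_def)
  define \<delta> where "\<delta> = d / (norm a + norm b + 1)"
  have pos: "0 < norm a + norm b + 1" by (simp add: add_nonneg_pos)
  have "0 < \<delta>" using d pos by (simp add: \<delta>_def)
  moreover have "\<bar>f (x + h *\<^sub>R a + h *\<^sub>R b) - f (x + h *\<^sub>R a) - f (x + h *\<^sub>R b) + f x - h * (h * A' b)\<bar>
      \<le> h * (h * (2 * e * (norm a + norm b)))" if h: "0 < h" "h < \<delta>" for h
  proof -
    define g where "g s = f (x + s *\<^sub>R a + h *\<^sub>R b) - f (x + s *\<^sub>R a)" for s
    have gd: "(g has_real_derivative f' (x + s *\<^sub>R a + h *\<^sub>R b) a - f' (x + s *\<^sub>R a) a) (at s)" for s
    proof -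
      have 1: "((\<lambda>s. f (c + s *\<^sub>R a)) has_derivative (\<lambda>r. r * f' (c + s *\<^sub>R a) a)) (at s)" for c
      proof -
        have "((\<lambda>s. c + s *\<^sub>R a) has_derivative (\<lambda>r. r *\<^sub>R a)) (at s)" by (auto intro!: derivative_eq_intros)
        from has_derivative_compose[OF this f]
        show ?thesis using linear_scale[OF has_derivative_linear[OF f]] by simp
      qed
      have "(g has_derivative (\<lambda>r. r * f' (x + h *\<^sub>R b + s *\<^sub>R a) a - r * f' (x + s *\<^sub>R a) a)) (at s)"
        using has_derivative_diff[OF 1[of "x + h *\<^sub>R b"] 1[of x]]
        by (simp add: g_def[abs_def] add.commute add.left_commute)
      then show ?thesis
        unfolding has_field_derivative_def
        by (rule has_derivative_eq_rhs) (auto simp: fun_eq_iff algebra_simps)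
    qed
    obtain z where z: "0 < z" "z < h" "g h - g 0 = (h - 0) * (f' (x + z *\<^sub>R a + h *\<^sub>R b) a - f' (x + z *\<^sub>R a) a)"
      using MVT2[OF h(1) gd] by blast
    let ?p = "z *\<^sub>R a + h *\<^sub>R b" and ?q = "z *\<^sub>R a"
    have np: "norm ?p \<le> h * (norm a + norm b)"
    proof -
      have "norm ?p \<le> norm (z *\<^sub>R a) + norm (h *\<^sub>R b)" by (rule norm_triangle_ineq)
      also have "\<dots> \<le> h * norm a + h * norm b" using z h by (intro add_mono) (auto intro: mult_right_mono)
      finally show ?thesis by (simp add: distrib_left)
    qed
    have nq: "norm ?q \<le> h * (norm a + norm b)"
    proof -
      have "norm ?q \<le> h * norm a" using z h by (auto intro: mult_right_mono)
      then show ?thesis using h by (simp add: distrib_left add_increasing2)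
    qed
    have small: "h * (norm a + norm b) < d"
    proof -
      have "h * (norm a + norm b) \<le> h * (norm a + norm b + 1)" using h by (intro mult_left_mono) auto
      also have "\<dots> < d" using h(2) pos by (simp add: \<delta>_def field_simps)
      finally show ?thesis .
    qed
    have P: "\<bar>f' (x + ?p) a - f' x a - A' ?p\<bar> \<le> e * (h * (norm a + norm b))"
      using dd[of "x + ?p"] np small e by (auto intro: order_trans mult_left_mono)
    have Q: "\<bar>f' (x + ?q) a - f' x a - A' ?q\<bar> \<le> e * (h * (norm a + norm b))"
      using dd[of "x + ?q"] nq small e by (auto intro: order_trans mult_left_mono)
    have "A' ?p - A' ?q = h * A' b" by (simp add: A'.add A'.scaleR)
    then have "\<bar>f' (x + ?p) a - f' (x + ?q) a - h * A' b\<bar> \<le> h * (2 * e * (norm a + norm b))"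
      using P Q by (simp add: algebra_simps)
    then have "h * \<bar>f' (x + ?p) a - f' (x + ?q) a - h * A' b\<bar> \<le> h * (h * (2 * e * (norm a + norm b)))"
      using h by (intro mult_left_mono) auto
    moreover have "f (x + h *\<^sub>R a + h *\<^sub>R b) - f (x + h *\<^sub>R a) - f (x + h *\<^sub>R b) + f x - h * (h * A' b)
        = h * (f' (x + ?p) a - f' (x + ?q) a - h * A' b)"
      using z(3) by (simp add: g_def algebra_simps)
    ultimately show ?thesis using h by (simp add: abs_mult)
  qed
  ultimately show ?thesis by blast
qed

lemma second_derivative_symmetric_real:
  fixes f :: "'a::real_normed_vector \<Rightarrow> real"
  assumes f: "\<And>y. (f has_derivative f' y) (at y)"
    and A: "((\<lambda>y. f' y a) has_derivative A') (at x)" and B: "((\<lambda>y. f' y b) has_derivative B') (at x)"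
  shows "A' b = B' a"
proof (rule ccontr)
  assume ne: "A' b \<noteq> B' a"
  define n where "n = norm a + norm b + 1"
  have n: "0 < n" by (simp add: n_def add_nonneg_pos)
  \<comment> \<open>The 8 makes the two errors together at most half of the supposed gap:
    \<open>4 * e * n\<close> is half of it.\<close>
  define e where "e = \<bar>A' b - B' a\<bar> / (8 * n)"
  have e: "0 < e" using ne n by (simp add: e_def)
  define \<Delta> where "\<Delta> h = f (x + h *\<^sub>R a + h *\<^sub>R b) - f (x + h *\<^sub>R a) - f (x + h *\<^sub>R b) + f x" for h
  obtain d1 where d1: "0 < d1" "\<And>h. 0 < h \<Longrightarrow> h < d1 \<Longrightarrow> \<bar>\<Delta> h - h * (h * A' b)\<bar> \<le> h * (h * (2 * e * (norm a + norm b)))"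
    using second_difference_quotient[OF f A e, of b] unfolding \<Delta>_def by blast
  obtain d2 where d2: "0 < d2" "\<And>h. 0 < h \<Longrightarrow> h < d2 \<Longrightarrow> \<bar>\<Delta> h - h * (h * B' a)\<bar> \<le> h * (h * (2 * e * (norm a + norm b)))"
    using second_difference_quotient[OF f B e, of a] unfolding \<Delta>_def
    by (auto simp: algebra_simps)
  define h where "h = min d1 d2 / 2"
  have h: "0 < h" "h < d1" "h < d2" using d1(1) d2(1) by (auto simp: h_def)
  have "\<bar>h * (h * A' b) - h * (h * B' a)\<bar> \<le> 2 * (h * (h * (2 * e * (norm a + norm b))))"
    using d1(2)[OF h(1,2)] d2(2)[OF h(1,3)] by linarith
  moreover have "\<bar>h * (h * A' b) - h * (h * B' a)\<bar> = (h * h) * \<bar>A' b - B' a\<bar>"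
    using h by (simp add: right_diff_distrib[symmetric] abs_mult)
  moreover have "2 * (h * (h * (2 * e * (norm a + norm b)))) = (h * h) * (4 * e * (norm a + norm b))" by simp
  ultimately have "\<bar>A' b - B' a\<bar> \<le> 4 * e * (norm a + norm b)"
    using h by (simp add: mult_le_cancel_left_pos)
  also have "\<dots> \<le> 4 * e * n" using e by (simp add: n_def)
  also have "\<dots> = \<bar>A' b - B' a\<bar> / 2" using n by (simp add: e_def)
  finally show False using ne by simp
qed

lemma smooth_map_second_derivative_symmetric:
  fixes f :: "'a::euclidean_space \<Rightarrow> 'b::euclidean_space"
  assumes f: "smooth_map f"
  shows "frechet_derivative (\<lambda>y. frechet_derivative f (at y) a) (at x) b
       = frechet_derivative (\<lambda>y. frechet_derivative f (at y) b) (at x) a"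
proof (rule euclidean_eqI)
  fix i :: 'b
  show "frechet_derivative (\<lambda>y. frechet_derivative f (at y) a) (at x) b \<bullet> i
       = frechet_derivative (\<lambda>y. frechet_derivative f (at y) b) (at x) a \<bullet> i"
    by (rule second_derivative_symmetric_real[where f = "\<lambda>y. f y \<bullet> i" and f' = "\<lambda>y v. frechet_derivative f (at y) v \<bullet> i" and x = x])
       (intro has_derivative_inner_left smooth_map_has_derivative smooth_map_deriv f)+
qed

text \<open>The product rule for evaluating a varying linear map at a varying vector. Expanding in
  \<open>Basis\<close> reduces it to the derivatives of the vectors \<open>G y v\<close>, so no norm
  on linear maps is involved.\<close>

lemma has_derivative_linear_family:
  fixes G :: "'p::real_normed_vector \<Rightarrow> 'v::euclidean_space \<Rightarrow> 'w::real_normed_vector"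
  assumes lin: "\<And>y. linear (G y)" and der: "\<And>v. ((\<lambda>y. G y v) has_derivative G' v) (at y0)"
    and q: "(q has_derivative q') (at y0)"
  shows "((\<lambda>y. G y (q y)) has_derivative (\<lambda>h. G y0 (q' h) + G' (q y0) h)) (at y0)"
proof -
  have rep: "G y v = (\<Sum>b\<in>Basis. (v \<bullet> b) *\<^sub>R G y b)" for y v
  proof -
    interpret linear "G y" by (rule lin)
    show ?thesis by (subst (1) euclidean_representation[of v, symmetric]) (simp add: sum scale)
  qed
  have rep': "G' v = (\<lambda>h. \<Sum>b\<in>Basis. (v \<bullet> b) *\<^sub>R G' b h)" for v
  proof (rule has_derivative_unique[OF der])
    have "((\<lambda>y. \<Sum>b\<in>Basis. (v \<bullet> b) *\<^sub>R G y b) has_derivative (\<lambda>h. \<Sum>b\<in>Basis. (v \<bullet> b) *\<^sub>R G' b h)) (at y0)"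
      by (intro has_derivative_sum has_derivative_scaleR_right der)
    then show "((\<lambda>y. G y v) has_derivative (\<lambda>h. \<Sum>b\<in>Basis. (v \<bullet> b) *\<^sub>R G' b h)) (at y0)"
      by (simp only: rep[symmetric])
  qed
  have "((\<lambda>y. \<Sum>b\<in>Basis. (q y \<bullet> b) *\<^sub>R G y b) has_derivative
      (\<lambda>h. \<Sum>b\<in>Basis. (q y0 \<bullet> b) *\<^sub>R G' b h + (q' h \<bullet> b) *\<^sub>R G y0 b)) (at y0)"
    by (intro has_derivative_sum has_derivative_scaleR has_derivative_inner_left q der)
  moreover have "(\<lambda>h. \<Sum>b\<in>Basis. (q y0 \<bullet> b) *\<^sub>R G' b h + (q' h \<bullet> b) *\<^sub>R G y0 b) = (\<lambda>h. G y0 (q' h) + G' (q y0) h)"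
    by (simp add: rep[of y0 "q' _"] rep'[of "q y0"] sum.distrib add.commute)
  moreover have "(\<lambda>y. \<Sum>b\<in>Basis. (q y \<bullet> b) *\<^sub>R G y b) = (\<lambda>y. G y (q y))"
    by (simp add: rep[symmetric])
  ultimately show ?thesis by simp
qed

text \<open>The squared norm of \<open>g\<close> multiplied by the integrating factor exp (- 2 K t)
  is nonincreasing and starts at 0.\<close>

lemma Gronwall_zero:
  fixes g :: "real \<Rightarrow> 'a::real_inner"
  assumes d: "\<And>t. t \<in> {0..1} \<Longrightarrow> (g has_vector_derivative g' t) (at t)" and g0: "g 0 = 0"
    and le: "\<And>t. t \<in> {0..1} \<Longrightarrow> norm (g' t) \<le> K * norm (g t)"
  shows "g 1 = 0"
proof -
  define p where "p t = (g t \<bullet> g t) * exp (- 2 * K * t)" for t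
  have "p 1 \<le> p 0"
  proof (rule DERIV_nonpos_imp_nonincreasing[where f = p])
    fix t :: real assume t: "0 \<le> t" "t \<le> 1"
    have gi: "((\<lambda>t. g t \<bullet> g t) has_real_derivative 2 * (g t \<bullet> g' t)) (at t)"
    proof -
      have "(g has_derivative (\<lambda>r. r *\<^sub>R g' t)) (at t)" using d[of t] t by (simp add: has_vector_derivative_def)
      from has_derivative_inner[OF this this] show ?thesis
        unfolding has_field_derivative_def
        by (rule has_derivative_eq_rhs) (auto simp: fun_eq_iff inner_commute algebra_simps)
    qed
    have "(p has_real_derivative (2 * (g t \<bullet> g' t) - 2 * K * (g t \<bullet> g t)) * exp (- 2 * K * t)) (at t)"
      unfolding p_def by (rule derivative_eq_intros gi refl)+ (simp add: algebra_simps)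
    moreover have "(2 * (g t \<bullet> g' t) - 2 * K * (g t \<bullet> g t)) * exp (- 2 * K * t) \<le> 0"
    proof -
      have "g t \<bullet> g' t \<le> norm (g t) * norm (g' t)" by (rule norm_cauchy_schwarz)
      also have "\<dots> \<le> norm (g t) * (K * norm (g t))" using le[of t] t by (intro mult_left_mono) auto
      also have "\<dots> = K * (g t \<bullet> g t)" by (simp add: dot_square_norm power2_eq_square)
      finally show ?thesis by (intro mult_nonpos_nonneg) auto
    qed
    ultimately show "\<exists>y. (p has_real_derivative y) (at t) \<and> y \<le> 0" by blast
  qed simp
  then have "(g 1 \<bullet> g 1) * exp (- 2 * K) \<le> 0 * exp (- 2 * K)" by (simp add: p_def g0)
  then have "g 1 \<bullet> g 1 \<le> 0" by (subst (asm) mult_le_cancel_right_pos) auto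
  then show ?thesis by (metis inner_eq_zero_iff inner_ge_zero order_antisym)
qed

subsection \<open>Left-invariant fields in exponential coordinates\<close>

text \<open>\<open>ray\<close> says that the lines through the origin are one-parameter subgroups,
  which is what makes the chart exponential. The grading is kept apart from this analytic
  part.\<close>

locale lie_chart =
  fixes gmul :: "'v::euclidean_space \<Rightarrow> 'v \<Rightarrow> 'v"
  assumes assoc: "gmul (gmul x y) z = gmul x (gmul y z)"
    and unit_left: "gmul 0 x = x" and unit_right: "gmul x 0 = x"
    and smooth: "smooth_map (\<lambda>p. gmul (fst p) (snd p))"
    and ray: "gmul (a *\<^sub>R x) (b *\<^sub>R x) = (a + b) *\<^sub>R x"
begin

abbreviation X :: "'v \<Rightarrow> 'v \<Rightarrow> 'v" where "X \<equiv> lie_field gmul"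
abbreviation DX :: "'v \<Rightarrow> 'v \<Rightarrow> 'v \<Rightarrow> 'v" where "DX v x \<equiv> frechet_derivative (X v) (at x)"
abbreviation brk :: "'v \<Rightarrow> 'v \<Rightarrow> 'v" where "brk \<equiv> lie_bracket gmul"

section \<open>Smoothness and bracket of left-invariant fields\<close>

lemma smooth_translation: "smooth_map (gmul x)"
  using smooth_map_affine[OF _ smooth, of "\<lambda>y. (0, y)" "(x, 0)"]
  by (simp add: bounded_linear_Pair bounded_linear_zero bounded_linear_ident)

text \<open>Writes the field as a partial derivative of the joint multiplication, from which its
  smoothness in the base point can be read off.\<close>

lemma lie_field_eq: "X v x = frechet_derivative (\<lambda>p. gmul (fst p) (snd p)) (at (x, 0)) (0, v)"
proof -
  have "((\<lambda>y. gmul (fst ((x, 0) + (0, y))) (snd ((x, 0) + (0, y)))) has_derivative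
      (\<lambda>v. frechet_derivative (\<lambda>p. gmul (fst p) (snd p)) (at ((x, 0) + (0, 0))) (0, v))) (at 0)"
    by (rule frechet_derivative_affine[OF smooth])
       (simp add: bounded_linear_Pair bounded_linear_zero bounded_linear_ident)
  then have "(gmul x has_derivative (\<lambda>v. frechet_derivative (\<lambda>p. gmul (fst p) (snd p)) (at (x, 0)) (0, v))) (at 0)"
    by simp
  then show ?thesis unfolding lie_field_def by (simp add: frechet_derivative_at[symmetric])
qed

lemma smooth_lie_field: "smooth_map (X v)"
proof -
  have "smooth_map (\<lambda>x. frechet_derivative (\<lambda>p. gmul (fst p) (snd p)) (at (0 + (x, 0))) (0, v))"
    by (rule smooth_map_affine[where L = "\<lambda>x. (x, 0)", OF _ smooth_map_deriv[OF smooth]])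
       (simp add: bounded_linear_Pair bounded_linear_zero bounded_linear_ident)
  then show ?thesis by (simp add: lie_field_eq[abs_def])
qed

lemma DX: "(X v has_derivative DX v x) (at x)"
  by (rule smooth_map_has_derivative[OF smooth_lie_field])

lemma linear_DX: "linear (DX v x)"
  by (rule smooth_map_linear_deriv[OF smooth_lie_field])

lemma gmul_has_derivative: "(gmul x has_derivative (\<lambda>v. X v x)) (at 0)"
  using smooth_map_has_derivative[OF smooth_translation, of x 0] by (simp add: lie_field_def[abs_def])

lemma linear_lie_field: "linear (\<lambda>v. X v x)"
  by (rule has_derivative_linear[OF gmul_has_derivative])

lemma lie_field_0: "X v 0 = v"
proof -
  have "gmul 0 = id" by (simp add: fun_eq_iff unit_left)
  then show ?thesis by (simp add: lie_field_def)
qed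

lemma DX_unique: "(X v has_derivative F) (at x) \<Longrightarrow> DX v x = F"
  by (rule has_derivative_unique[OF DX])

lemma DX_add: "DX (v + w) x h = DX v x h + DX w x h"
proof -
  have "X (v + w) = (\<lambda>x. X v x + X w x)" by (simp add: fun_eq_iff linear_add[OF linear_lie_field])
  moreover have "((\<lambda>x. X v x + X w x) has_derivative (\<lambda>h. DX v x h + DX w x h)) (at x)"
    by (intro has_derivative_add DX)
  ultimately have "DX (v + w) x = (\<lambda>h. DX v x h + DX w x h)" by (intro DX_unique) simp
  then show ?thesis by simp
qed

lemma DX_scale: "DX (c *\<^sub>R v) x h = c *\<^sub>R DX v x h"
proof -
  have "X (c *\<^sub>R v) = (\<lambda>x. c *\<^sub>R X v x)" by (simp add: fun_eq_iff linear_scale[OF linear_lie_field])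
  moreover have "((\<lambda>x. c *\<^sub>R X v x) has_derivative (\<lambda>h. c *\<^sub>R DX v x h)) (at x)"
    by (intro has_derivative_scaleR_right DX)
  ultimately have "DX (c *\<^sub>R v) x = (\<lambda>h. c *\<^sub>R DX v x h)" by (intro DX_unique) simp
  then show ?thesis by simp
qed

lemma brk_eq: "brk v w = DX w 0 v - DX v 0 w"
  by (simp add: lie_bracket_def)

lemma brk_anti: "brk v w = - brk w v"
  by (simp add: brk_eq)

lemma bilinear_brk: "bilinear brk"
  unfolding bilinear_def
  by (auto intro!: linearI simp: brk_eq DX_add DX_scale linear_add[OF linear_DX] linear_scale[OF linear_DX] algebra_simps)

text \<open>Left invariance, obtained by differentiating associativity in the last argument at the
  identity.\<close>

lemma translation_lie_field: "frechet_derivative (gmul x) (at y) (X v y) = X v (gmul x y)"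
proof -
  have "(gmul x has_derivative frechet_derivative (gmul x) (at y)) (at (gmul y 0))"
    using smooth_map_has_derivative[OF smooth_translation] by (simp add: unit_right)
  from has_derivative_compose[OF gmul_has_derivative[of y] this]
  have "(gmul (gmul x y) has_derivative (\<lambda>v. frechet_derivative (gmul x) (at y) (X v y))) (at 0)"
    by (simp add: assoc[symmetric])
  from has_derivative_unique[OF gmul_has_derivative this] show ?thesis by metis
qed

text \<open>Differentiate left invariance along the translation by \<open>x\<close> at the identity.
  The second derivative of the translation is symmetric in \<open>v\<close> and \<open>w\<close>, so
  it cancels on antisymmetrising and only the bracket at the origin survives.\<close>

lemma Maurer_Cartan: "DX v x (X w x) - DX w x (X v x) = X (brk w v) x"
proof -
  define H where "H v w = frechet_derivative (\<lambda>y. frechet_derivative (gmul x) (at y) v) (at 0) w" for v w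
  have sym: "H v w = H w v" for v w
    unfolding H_def by (rule smooth_map_second_derivative_symmetric[OF smooth_translation])
  have main: "DX v x (X w x) = X (DX v 0 w) x + H v w" for v w
  proof -
    have "((\<lambda>y. frechet_derivative (gmul x) (at y) (X v y)) has_derivative
        (\<lambda>h. frechet_derivative (gmul x) (at 0) (DX v 0 h) + H (X v 0) h)) (at 0)"
    proof (rule has_derivative_linear_family[OF _ _ DX])
      show "linear (frechet_derivative (gmul x) (at y))" for y
        by (rule smooth_map_linear_deriv[OF smooth_translation])
      show "((\<lambda>y. frechet_derivative (gmul x) (at y) v) has_derivative H v) (at 0)" for v
        unfolding H_def by (intro smooth_map_has_derivative smooth_map_deriv smooth_translation)
    qed
    then have 1: "((\<lambda>y. X v (gmul x y)) has_derivative (\<lambda>h. X (DX v 0 h) x + H v h)) (at 0)"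
      by (simp add: translation_lie_field lie_field_0 lie_field_def[symmetric])
    have "(X v has_derivative DX v x) (at (gmul x 0))" by (simp add: unit_right DX)
    from has_derivative_unique[OF 1 has_derivative_compose[OF gmul_has_derivative this]]
    show ?thesis by metis
  qed
  have "DX v x (X w x) - DX w x (X v x) = X (DX v 0 w) x - X (DX w 0 v) x"
    unfolding main using sym[of v w] by simp
  then show ?thesis by (simp add: brk_eq linear_diff[OF linear_lie_field])
qed

text \<open>By \<open>Maurer_Cartan\<close> the field belonging to a bracket is the commutator of
  the two fields. Differentiating that identity once more at 0 expresses iterated brackets through
  first and second derivatives of the fields; the second derivatives \<open>S\<close> are symmetric
  and cancel in the sum.\<close>

lemma Jacobi: "brk (brk a b) w = brk a (brk b w) - brk b (brk a w)"
proof -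
  define S where "S c a b = frechet_derivative (\<lambda>y. DX c y b) (at 0) a" for c a b
  have sym: "S c a b = S c b a" for c a b
    unfolding S_def by (rule smooth_map_second_derivative_symmetric[OF smooth_lie_field])
  have DD: "((\<lambda>y. DX c y (X b y)) has_derivative (\<lambda>h. DX c 0 (DX b 0 h) + S c h b)) (at 0)" for b c
  proof -
    have "((\<lambda>y. DX c y (X b y)) has_derivative (\<lambda>h. DX c 0 (DX b 0 h) + (\<lambda>v h. S c h v) (X b 0) h)) (at 0)"
      by (rule has_derivative_linear_family[OF linear_DX _ DX])
         (unfold S_def, intro smooth_map_has_derivative smooth_map_deriv smooth_lie_field)
    then show ?thesis by (simp add: lie_field_0)
  qed
  have *: "DX (brk b c) 0 a = DX c 0 (DX b 0 a) + S c a b - (DX b 0 (DX c 0 a) + S b a c)" for a b c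
  proof -
    have "X (brk b c) = (\<lambda>y. DX c y (X b y) - DX b y (X c y))" by (simp add: fun_eq_iff Maurer_Cartan)
    then have "(X (brk b c) has_derivative (\<lambda>h. DX c 0 (DX b 0 h) + S c h b - (DX b 0 (DX c 0 h) + S b h c))) (at 0)"
      using has_derivative_diff[OF DD DD] by simp
    from DX_unique[OF this] show ?thesis by metis
  qed
  have br: "brk a (brk b c) = DX c 0 (DX b 0 a) + S c a b - (DX b 0 (DX c 0 a) + S b a c)
      - (DX a 0 (DX c 0 b) - DX a 0 (DX b 0 c))" for a b c
    by (simp only: brk_eq[of a "brk b c"] *) (simp only: brk_eq[of b c] linear_diff[OF linear_DX])
  show ?thesis
    unfolding brk_anti[of "brk a b" w] br by (simp add: sym[of a w b] sym[of b w a] sym[of w a b])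
qed

section \<open>The frame along rays\<close>

lemma lie_field_ray: "X x (t *\<^sub>R x) = x"
proof -
  have "((\<lambda>b. b *\<^sub>R x) has_derivative (\<lambda>b. b *\<^sub>R x)) (at 0)" by (auto intro!: derivative_eq_intros)
  moreover have "(gmul (t *\<^sub>R x) has_derivative (\<lambda>v. X v (t *\<^sub>R x))) (at (0 *\<^sub>R x))"
    by (simp add: gmul_has_derivative)
  ultimately have "((\<lambda>b. gmul (t *\<^sub>R x) (b *\<^sub>R x)) has_derivative (\<lambda>b. X (b *\<^sub>R x) (t *\<^sub>R x))) (at 0)"
    by (rule has_derivative_compose)
  then have 1: "((\<lambda>b. (t + b) *\<^sub>R x) has_derivative (\<lambda>b. X (b *\<^sub>R x) (t *\<^sub>R x))) (at 0)" by (simp add: ray)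
  have 2: "((\<lambda>b. (t + b) *\<^sub>R x) has_derivative (\<lambda>b. b *\<^sub>R x)) (at 0)" by (auto intro!: derivative_eq_intros)
  from has_derivative_unique[OF 1 2] have "X (1 *\<^sub>R x) (t *\<^sub>R x) = 1 *\<^sub>R x" by metis
  then show ?thesis by simp
qed

text \<open>The derivative of the identity \<open>X y y = y\<close>, which is
  \<open>lie_field_ray\<close> at time 1.\<close>

lemma lie_field_self_derivative: "DX y y z = z - X z y"
proof -
  have 1: "((\<lambda>y. X y y) has_derivative (\<lambda>h. X h y + DX y y h)) (at y)"
    using has_derivative_linear_family[OF linear_lie_field DX has_derivative_ident] by simp
  have "(\<lambda>y. X y y) = (\<lambda>y. y)" using lie_field_ray[of _ 1] by simp
  then have 2: "((\<lambda>y. X y y) has_derivative (\<lambda>h. h)) (at y)" by simp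
  have "X z y + DX y y z = z" using has_derivative_unique[OF 1 2] by metis
  then show ?thesis by (simp add: algebra_simps)
qed

text \<open>Since the field of \<open>x\<close> is constant along its own ray,
  \<open>Maurer_Cartan\<close> moves the derivative from the field of \<open>v\<close> to that of
  \<open>x\<close>. The factor \<open>t\<close> turns \<open>DX x\<close> into the derivative of the
  field belonging to the point \<open>t *\<^sub>R x\<close> itself, where the previous lemma
  applies.\<close>

lemma lie_field_Riccati:
  "t *\<^sub>R DX v (t *\<^sub>R x) x = X v (t *\<^sub>R x) - X (X v (t *\<^sub>R x)) (t *\<^sub>R x) + t *\<^sub>R X (brk x v) (t *\<^sub>R x)"
proof -
  let ?y = "t *\<^sub>R x"
  have "DX v ?y x = DX x ?y (X v ?y) + X (brk x v) ?y"
    using Maurer_Cartan[of v ?y x] by (simp add: lie_field_ray algebra_simps)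
  moreover have "t *\<^sub>R DX x ?y (X v ?y) = X v ?y - X (X v ?y) ?y"
    using lie_field_self_derivative[of ?y "X v ?y"] by (simp add: DX_scale)
  ultimately show ?thesis by (simp add: scaleR_add_right)
qed

text \<open>The frame is the identity at 0 and its derivative is bounded on the compact segment. The
  decay linear in \<open>t\<close> is what compensates for the degeneration of the Riccati equation
  at 0.\<close>

lemma lie_field_near_identity:
  "\<exists>K. \<forall>t\<in>{0..1}. \<forall>v. norm (v - X v (t *\<^sub>R x)) \<le> K * t * norm v"
proof -
  have "\<exists>K. \<forall>t\<in>{0..1}. norm (X b (t *\<^sub>R x) - b) \<le> K * t" for b
  proof -
    have d: "((\<lambda>t. X b (t *\<^sub>R x)) has_derivative (\<lambda>r. DX b (t *\<^sub>R x) (r *\<^sub>R x))) (at t)" for t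
      by (rule has_derivative_compose[OF _ DX]) (auto intro!: derivative_eq_intros)
    have "continuous_on {0..1} (\<lambda>t. DX b (t *\<^sub>R x) x)"
    proof (rule continuous_on_compose2[of UNIV "\<lambda>y. DX b y x"])
      show "continuous_on UNIV (\<lambda>y. DX b y x)"
        using smooth_map_has_derivative[OF smooth_map_deriv[OF smooth_lie_field]]
        by (auto intro!: continuous_at_imp_continuous_on has_derivative_continuous)
    qed (auto intro!: continuous_intros)
    then have "bounded ((\<lambda>t. DX b (t *\<^sub>R x) x) ` {0..1})"
      by (intro compact_imp_bounded compact_continuous_image) auto
    then obtain K where K: "\<And>t. t \<in> {0..1} \<Longrightarrow> norm (DX b (t *\<^sub>R x) x) \<le> K" unfolding bounded_iff by (metis imageI)
    have "norm (X b (t *\<^sub>R x) - X b (0 *\<^sub>R x)) \<le> K * norm (t - 0)" if t: "t \<in> {0..1}" for t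
    proof (rule differentiable_bound[of "{0..1}" "\<lambda>t. X b (t *\<^sub>R x)" "\<lambda>t r. DX b (t *\<^sub>R x) (r *\<^sub>R x)"])
      show "((\<lambda>t. X b (t *\<^sub>R x)) has_derivative (\<lambda>r. DX b (s *\<^sub>R x) (r *\<^sub>R x))) (at s within {0..1})" for s
        by (rule has_derivative_at_withinI[OF d])
      show "onorm (\<lambda>r. DX b (s *\<^sub>R x) (r *\<^sub>R x)) \<le> K" if "s \<in> {0..1}" for s
      proof (rule onorm_bound)
        show "0 \<le> K" by (rule order_trans[OF norm_ge_zero K[of 0]]) simp
        show "norm (DX b (s *\<^sub>R x) (r *\<^sub>R x)) \<le> K * norm r" for r
          using mult_left_mono[OF K[OF that], of "\<bar>r\<bar>"] by (simp add: linear_scale[OF linear_DX] mult.commute)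
      qed
    qed (use t in auto)
    then have "\<forall>t\<in>{0..1}. norm (X b (t *\<^sub>R x) - b) \<le> K * t" by (simp add: lie_field_0)
    then show ?thesis by blast
  qed
  then obtain K where K: "\<And>b t. t \<in> {0..1} \<Longrightarrow> norm (X b (t *\<^sub>R x) - b) \<le> K b * t" by metis
  have "norm (v - X v (t *\<^sub>R x)) \<le> (\<Sum>b\<in>Basis. K b) * t * norm v" if t: "t \<in> {0..1}" for t v
  proof -
    let ?L = "\<lambda>v. v - X v (t *\<^sub>R x)"
    have lin: "linear ?L" by (intro linear_compose_sub linear_ident linear_lie_field)
    interpret L: linear ?L by (rule lin)
    have "?L v = (\<Sum>b\<in>Basis. (v \<bullet> b) *\<^sub>R ?L b)"
      by (subst (1 2) euclidean_representation[of v, symmetric]) (simp only: L.sum L.scale)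
    also have "norm \<dots> \<le> (\<Sum>b\<in>Basis. norm v * (K b * t))"
    proof (rule sum_norm_le)
      fix b :: 'v assume b: "b \<in> Basis"
      have "\<bar>v \<bullet> b\<bar> * norm (?L b) \<le> norm v * (K b * t)"
        using K[OF t, of b] Basis_le_norm[OF b, of v] by (intro mult_mono) (auto simp: norm_minus_commute)
      then show "norm ((v \<bullet> b) *\<^sub>R ?L b) \<le> norm v * (K b * t)" by simp
    qed
    also have "\<dots> = (\<Sum>b\<in>Basis. K b) * t * norm v"
      by (simp add: sum_distrib_left[symmetric] sum_distrib_right[symmetric] mult_ac)
    finally show ?thesis .
  qed
  then show ?thesis by blast
qed

text \<open>Left translation inverts the differential \<open>(1 - exp (- ad x)) / ad x\<close> of the exponential map.
  With \<open>J t = t m(t)\<close> and \<open>m(t)\<close> the sum over \<open>k\<close> of \<open>(- t ad x)^k w / (k+1)!\<close>, the defect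
  \<open>g t = t w - X (J t) (t x)\<close> satisfies \<open>g' = e - X e (t x)\<close> where \<open>g = t e\<close>, and
  \<open>X e (t x) = e + O(t) e\<close> turns this into a linear differential inequality for \<open>g\<close>.\<close>
lemma lie_field_inverse:
  assumes nil: "(brk x ^^ n) w = 0"
  shows "X (\<Sum>k<n. ((-1) ^ k / fact (Suc k)) *\<^sub>R (brk x ^^ k) w) x = w"
proof -
  define ad where "ad k = (brk x ^^ k) w" for k
  define m where "m t = (\<Sum>k<n. ((- t) ^ k / fact (Suc k)) *\<^sub>R ad k)" for t :: real
  define J where "J t = t *\<^sub>R m t" for t
  have lin: "linear (brk x)" using bilinear_brk by (simp add: bilinear_def)
  have ad_Suc: "brk x (ad k) = ad (Suc k)" for k by (simp add: ad_def)
  have J_eq: "J t = (\<Sum>k<n. (- ((- t) ^ Suc k) / fact (Suc k)) *\<^sub>R ad k)" for t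
    by (simp add: J_def m_def scaleR_sum_right)
  \<comment> \<open>\<open>J\<close> is the integral of exp (- t ad x) w starting at 0; the equation
    says that exp (- t ad x) w equals w - ad x (J t).\<close>
  have J': "(J has_vector_derivative w - brk x (J t)) (at t)" for t
  proof -
    have pw: "((\<lambda>t. - ((- t) ^ Suc k) / fact (Suc k)) has_real_derivative (- t) ^ k / fact k) (at t)" for k
    proof -
      have "((\<lambda>t. - ((- t) ^ Suc k) / fact (Suc k)) has_real_derivative (- (real (Suc k) * (- t) ^ k * (- 1))) / fact (Suc k)) (at t)"
        using DERIV_power_Suc[OF DERIV_minus[OF DERIV_ident[of "at t"]], of k]
        by (intro DERIV_cdivide DERIV_minus) (simp add: algebra_simps del: power_Suc)
      moreover have "(- (real (Suc k) * (- t) ^ k * (- 1))) / fact (Suc k) = (- t) ^ k / fact k"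
        by (simp add: fact_Suc del: of_nat_Suc)
      ultimately show ?thesis by simp
    qed
    have "((\<lambda>t. \<Sum>k<n. (- ((- t) ^ Suc k) / fact (Suc k)) *\<^sub>R ad k) has_vector_derivative
        (\<Sum>k<n. ((- t) ^ k / fact k) *\<^sub>R ad k)) (at t)"
    proof (rule has_vector_derivative_sum)
      fix k
      show "((\<lambda>t. (- ((- t) ^ Suc k) / fact (Suc k)) *\<^sub>R ad k) has_vector_derivative ((- t) ^ k / fact k) *\<^sub>R ad k) (at t)"
        using has_vector_derivative_scaleR[OF pw has_vector_derivative_const[of "ad k"]] by simp
    qed
    moreover have "(\<Sum>k<n. ((- t) ^ k / fact k) *\<^sub>R ad k) = w - brk x (J t)"
    proof -
      have "brk x (J t) = (\<Sum>k<n. (- ((- t) ^ Suc k) / fact (Suc k)) *\<^sub>R ad (Suc k))"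
        unfolding J_eq by (simp add: linear_sum[OF lin] linear_scale[OF lin] ad_Suc)
      then have "- brk x (J t) = (\<Sum>k<n. ((- t) ^ Suc k / fact (Suc k)) *\<^sub>R ad (Suc k))"
        by (simp add: sum_negf[symmetric])
      \<comment> \<open>Nilpotency lets the term \<open>k = n\<close> be added for free, so that the
        index shift matches the sum for \<open>brk x (J t)\<close>.\<close>
      moreover have "(\<Sum>k<n. ((- t) ^ k / fact k) *\<^sub>R ad k) = (\<Sum>k<Suc n. ((- t) ^ k / fact k) *\<^sub>R ad k)"
        using nil by (simp add: ad_def)
      moreover have "(\<Sum>k<Suc n. ((- t) ^ k / fact k) *\<^sub>R ad k)
          = w + (\<Sum>k<n. ((- t) ^ Suc k / fact (Suc k)) *\<^sub>R ad (Suc k))"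
        by (subst sum.lessThan_Suc_shift) (simp add: ad_def)
      ultimately show ?thesis by (metis diff_conv_add_uminus)
    qed
    ultimately show ?thesis using J_eq by (simp add: fun_eq_iff[symmetric] J_eq[abs_def])
  qed
  define e where "e t = w - X (m t) (t *\<^sub>R x)" for t
  define g where "g t = t *\<^sub>R w - X (J t) (t *\<^sub>R x)" for t
  have ge: "g t = t *\<^sub>R e t" for t
    by (simp add: g_def e_def J_def linear_scale[OF linear_lie_field] scaleR_diff_right)
  have g': "(g has_vector_derivative e t - X (e t) (t *\<^sub>R x)) (at t)" for t
  proof -
    let ?y = "t *\<^sub>R x"
    have "((\<lambda>s. X (J s) (s *\<^sub>R x)) has_derivative
        (\<lambda>r. X (r *\<^sub>R (w - brk x (J t))) ?y + DX (J t) ?y (r *\<^sub>R x))) (at t)"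
    proof (rule has_derivative_linear_family[where G = "\<lambda>s v. X v (s *\<^sub>R x)" and G' = "\<lambda>v r. DX v ?y (r *\<^sub>R x)"])
      show "((\<lambda>s. X v (s *\<^sub>R x)) has_derivative (\<lambda>r. DX v ?y (r *\<^sub>R x))) (at t)" for v
        by (rule has_derivative_compose[OF _ DX]) (auto intro!: derivative_eq_intros)
      show "(J has_derivative (\<lambda>r. r *\<^sub>R (w - brk x (J t)))) (at t)"
        using J' by (simp add: has_vector_derivative_def)
    qed (rule linear_lie_field)
    then have 1: "((\<lambda>s. X (J s) (s *\<^sub>R x)) has_vector_derivative X (w - brk x (J t)) ?y + DX (J t) ?y x) (at t)"
      unfolding has_vector_derivative_def
      by (rule has_derivative_eq_rhs) (simp add: linear_scale[OF linear_lie_field] linear_scale[OF linear_DX] scaleR_add_right)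
    \<comment> \<open>Used for \<open>m t\<close> rather than \<open>J t\<close>: the factor
      \<open>t\<close> on the left is absorbed into \<open>J t\<close> without a division, so the
      identity holds at \<open>t = 0\<close> as well.\<close>
    have "DX (J t) ?y x = X (m t) ?y - X (X (m t) ?y) ?y + X (brk x (J t)) ?y"
      using lie_field_Riccati[of t "m t" x]
      by (simp add: J_def DX_scale linear_scale[OF lin] linear_scale[OF linear_lie_field])
    then have "w - (X (w - brk x (J t)) ?y + DX (J t) ?y x) = e t - X (e t) ?y"
      by (simp add: e_def linear_diff[OF linear_lie_field])
    moreover have "((\<lambda>s. s *\<^sub>R w) has_vector_derivative w) (at t)"
      by (auto intro!: derivative_eq_intros simp: has_vector_derivative_def)
    ultimately show ?thesis
      using has_vector_derivative_diff[OF _ 1, of "\<lambda>s. s *\<^sub>R w" w] by (simp add: g_def[abs_def])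
  qed
  obtain K where K: "\<And>t v. t \<in> {0..1} \<Longrightarrow> norm (v - X v (t *\<^sub>R x)) \<le> K * t * norm v"
    using lie_field_near_identity by blast
  have "g 1 = 0"
  proof (rule Gronwall_zero[OF g'])
    show "g 0 = 0" by (simp add: ge)
    show "norm (e t - X (e t) (t *\<^sub>R x)) \<le> K * norm (g t)" if "t \<in> {0..1}" for t
      using K[OF that, of "e t"] that by (simp add: ge)
  qed
  then show ?thesis by (simp add: ge e_def m_def ad_def)
qed

end

subsection \<open>Grading\<close>

text \<open>Polynomials of weighted degree at most \<open>d\<close>, with coordinate
  \<open>i\<close> of weight \<open>deg i\<close>. They are given by generators so that substituting
  iterated integrals for the coordinates can follow the derivation rule by rule.\<close>

inductive wpoly :: "('m::finite \<Rightarrow> nat) \<Rightarrow> nat \<Rightarrow> (real^'m \<Rightarrow> real) \<Rightarrow> bool" for deg where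
  const: "wpoly deg 0 (\<lambda>x. c)"
| coord: "wpoly deg (deg i) (\<lambda>x. x $ i)"
| mono: "wpoly deg d P \<Longrightarrow> d \<le> e \<Longrightarrow> wpoly deg e P"
| add: "wpoly deg d P \<Longrightarrow> wpoly deg d Q \<Longrightarrow> wpoly deg d (\<lambda>x. P x + Q x)"
| mult: "wpoly deg d P \<Longrightarrow> wpoly deg e Q \<Longrightarrow> wpoly deg (d + e) (\<lambda>x. P x * Q x)"

lemma wpoly_const: "wpoly deg d (\<lambda>x. c)"
  by (rule wpoly.mono[OF wpoly.const]) simp

lemma wpoly_scale: "wpoly deg d P \<Longrightarrow> wpoly deg d (\<lambda>x. c * P x)"
  using wpoly.mult[OF wpoly.const, of deg d P c] by simp

lemma wpoly_sum: "(\<And>i. i \<in> I \<Longrightarrow> wpoly deg d (P i)) \<Longrightarrow> wpoly deg d (\<lambda>x. \<Sum>i\<in>I. P i x)"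
  by (induction I rule: infinite_finite_induct) (auto intro: wpoly_const wpoly.add)

lemma wpoly_local:
  assumes "wpoly deg d P" "\<And>l. deg l \<le> d \<Longrightarrow> x $ l = y $ l"
  shows "P x = P y"
  using assms
proof (induction rule: wpoly.induct)
  case (mult d P e Q)
  then show ?case by (metis add_leD1 add_leD2 le_add1 le_add2 order_trans)
qed auto

section \<open>The bracket and the layers\<close>

lemma layer_iff: "v \<in> layer deg j \<longleftrightarrow> (\<forall>i. deg i \<noteq> j \<longrightarrow> v $ i = 0)"
proof
  assume "v \<in> layer deg j"
  then show "\<forall>i. deg i \<noteq> j \<longrightarrow> v $ i = 0"
    unfolding layer_def
  proof (induction rule: span_induct)
    case base
    show ?case by (auto simp: subspace_def)
  next
    case (step x)
    then show ?case by (auto simp: axis_def)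
  qed
next
  assume v: "\<forall>i. deg i \<noteq> j \<longrightarrow> v $ i = 0"
  have "(\<Sum>i\<in>UNIV. v $ i *\<^sub>R axis i 1) \<in> layer deg j"
    unfolding layer_def
  proof (rule span_sum)
    fix i
    show "v $ i *\<^sub>R axis i 1 \<in> span {axis i 1 | i. deg i = j}"
    proof (cases "deg i = j")
      case True
      then show ?thesis by (auto intro: span_scale span_base)
    next
      case False
      then show ?thesis using v by (simp add: span_zero)
    qed
  qed
  then show "v \<in> layer deg j" using basis_expansion[of v] by (simp add: scalar_mult_eq_scaleR)
qed

lemma subspace_layer: "subspace (layer deg j)"
  by (simp add: layer_def)

locale carnot =
  fixes gmul :: "real^'m \<Rightarrow> real^'m \<Rightarrow> real^'m" and deg :: "'m::finite \<Rightarrow> nat" and s :: nat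
  assumes carnot: "carnot_exp_coords gmul deg s"
begin

sublocale lie_chart gmul
  using carnot unfolding carnot_exp_coords_def by unfold_locales auto

lemma deg_pos: "1 \<le> deg i" and deg_le: "deg i \<le> s"
  using carnot unfolding carnot_exp_coords_def by auto

lemma layer_above: "s < j \<Longrightarrow> v \<in> layer deg j \<Longrightarrow> v = 0"
  unfolding layer_iff vec_eq_iff using deg_le by (metis not_le zero_index)

lemma brk_zero: "brk 0 w = 0" "brk v 0 = 0"
  using bilinear_lzero[OF bilinear_brk] bilinear_rzero[OF bilinear_brk] by auto

lemma brk_layer_1:
  assumes "1 \<le> j" and v: "v \<in> layer deg 1" and w: "w \<in> layer deg j"
  shows "brk v w \<in> layer deg (Suc j)"
proof -
  consider "j < s" | "j = s" | "s < j" by linarith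
  then show ?thesis
  proof cases
    case 1
    then have "layer deg (Suc j) = span {brk v w | v w. v \<in> layer deg 1 \<and> w \<in> layer deg j}"
      using carnot assms(1) unfolding carnot_exp_coords_def by blast
    then show ?thesis using v w by (auto intro: span_base)
  next
    case 2
    then have "brk v w = 0" using carnot v w unfolding carnot_exp_coords_def by blast
    then show ?thesis by (simp add: subspace_0[OF subspace_layer])
  next
    case 3
    then have "brk v w = 0" using layer_above[OF _ w] by (simp add: brk_zero)
    then show ?thesis by (simp add: subspace_0[OF subspace_layer])
  qed
qed

text \<open>The hypothesis concerns brackets with the first layer only. Layer \<open>Suc i\<close>
  is spanned by brackets of layer 1 with layer \<open>i\<close>, and Jacobi rewrites their bracket
  with \<open>w\<close> into two nested brackets covered by \<open>brk_layer_1\<close> and the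
  induction hypothesis; one of these uses it at \<open>Suc j\<close>, so \<open>j\<close> must vary.
  Layers above \<open>s\<close> are zero.\<close>

lemma brk_layer:
  assumes "1 \<le> i" "1 \<le> j" "v \<in> layer deg i" "w \<in> layer deg j"
  shows "brk v w \<in> layer deg (i + j)"
  using assms
proof (induction i arbitrary: j v w rule: nat_induct_at_least)
  case base
  then show ?case using brk_layer_1 by simp
next
  case (Suc i)
  show ?case
  proof (cases "i < s")
    case True
    have "layer deg (Suc i) = span {brk a b | a b. a \<in> layer deg 1 \<and> b \<in> layer deg i}"
      using carnot Suc.hyps True unfolding carnot_exp_coords_def by blast
    with Suc.prems have "v \<in> span {brk a b | a b. a \<in> layer deg 1 \<and> b \<in> layer deg i}" by simp
    then show ?thesis
    proof (induction rule: span_induct)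
      case base
      show ?case
        using subspace_layer[of deg "Suc i + j"]
        by (auto simp: subspace_def brk_zero bilinear_ladd[OF bilinear_brk] bilinear_lmul[OF bilinear_brk])
    next
      case (step x)
      then obtain a b where x: "x = brk a b" and ab: "a \<in> layer deg 1" "b \<in> layer deg i" by blast
      have "brk a (brk b w) \<in> layer deg (Suc (i + j))"
        using Suc ab by (intro brk_layer_1 Suc.IH) auto
      moreover have "brk b (brk a w) \<in> layer deg (i + Suc j)"
        using Suc ab by (intro Suc.IH brk_layer_1) auto
      ultimately show ?case unfolding x Jacobi by (simp add: subspace_diff[OF subspace_layer])
    qed
  next
    case False
    then have "v = 0" using Suc.prems by (intro layer_above[of "Suc i"]) auto
    then show ?thesis by (simp add: brk_zero subspace_0[OF subspace_layer])
  qed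
qed

definition structure_const :: "'m \<Rightarrow> 'm \<Rightarrow> 'm \<Rightarrow> real" where
  "structure_const i j l = brk (axis i 1) (axis j 1) $ l"

lemma structure_const_eq_0: "deg l \<noteq> deg i + deg j \<Longrightarrow> structure_const i j l = 0"
proof -
  have "axis i 1 \<in> layer deg (deg i)" for i by (auto simp: layer_iff axis_def)
  then have "brk (axis i 1) (axis j 1) \<in> layer deg (deg i + deg j)"
    by (intro brk_layer deg_pos)
  then show "deg l \<noteq> deg i + deg j \<Longrightarrow> structure_const i j l = 0" by (simp add: layer_iff structure_const_def)
qed

lemma brk_component: "brk x v $ l = (\<Sum>i\<in>UNIV. \<Sum>j\<in>UNIV. x $ i * v $ j * structure_const i j l)"
proof -
  have rep: "v = (\<Sum>i\<in>UNIV. v $ i *\<^sub>R axis i 1)" for v :: "real^'m"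
    using basis_expansion[of v] by (simp add: scalar_mult_eq_scaleR)
  have "brk x v = (\<Sum>(i, j)\<in>UNIV \<times> UNIV. brk (x $ i *\<^sub>R axis i 1) (v $ j *\<^sub>R axis j 1))"
    by (subst rep[of x], subst rep[of v]) (rule bilinear_sum[OF bilinear_brk])
  also have "\<dots> = (\<Sum>i\<in>UNIV. \<Sum>j\<in>UNIV. (x $ i * v $ j) *\<^sub>R brk (axis i 1) (axis j 1))"
    unfolding sum.cartesian_product
    by (simp add: bilinear_lmul[OF bilinear_brk] bilinear_rmul[OF bilinear_brk] mult.commute)
  finally show ?thesis by (simp add: structure_const_def)
qed

text \<open>Weights add under the bracket and the weight contributed by \<open>x\<close> is at least
  1, so a component of weight at most \<open>Suc k\<close> involves components of \<open>v\<close>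
  of weight at most \<open>k\<close> only.\<close>

lemma brk_raises_degree:
  assumes "\<And>i. deg i \<le> k \<Longrightarrow> v $ i = 0" "deg l \<le> Suc k"
  shows "brk x v $ l = 0"
  unfolding brk_component
proof (intro sum.neutral ballI)
  fix i j
  show "x $ i * v $ j * structure_const i j l = 0"
  proof (cases "deg l = deg i + deg j")
    case True
    then have "deg j \<le> k" using assms(2) deg_pos[of i] by simp
    then show ?thesis using assms(1) by simp
  qed (simp add: structure_const_eq_0)
qed

lemma brk_pow_raises_degree:
  assumes "\<And>i. deg i \<le> k \<Longrightarrow> v $ i = 0" "deg l \<le> k + n"
  shows "(brk x ^^ n) v $ l = 0"
  using assms(2)
proof (induction n arbitrary: l)
  case 0
  then show ?case using assms(1) by simp
next
  case (Suc n)
  then show ?case using brk_raises_degree[of "k + n" "(brk x ^^ n) v" l x] by simp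
qed

lemma brk_nilpotent: "(brk x ^^ s) w = 0"
proof -
  have "(brk x ^^ s) w $ l = 0" for l
  proof (rule brk_pow_raises_degree[where k = 0])
    show "deg i \<le> 0 \<Longrightarrow> w $ i = 0" for i using deg_pos[of i] by simp
  qed (simp add: deg_le)
  then show ?thesis by (simp add: vec_eq_iff)
qed

text \<open>The differential of the exponential map at \<open>x\<close>, read through left translation:
  \<open>(1 - exp (- ad x)) / ad x\<close>.\<close>
definition dexp :: "real^'m \<Rightarrow> real^'m \<Rightarrow> real^'m" where
  "dexp x v = (\<Sum>k<s. ((-1) ^ k / fact (Suc k)) *\<^sub>R (brk x ^^ k) v)"

definition dexp_defect :: "real^'m \<Rightarrow> real^'m \<Rightarrow> real^'m" where
  "dexp_defect x v = v - dexp x v"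

lemma linear_dexp_defect: "linear (dexp_defect x)"
proof -
  have lin: "linear (brk x)" using bilinear_brk by (simp add: bilinear_def)
  have "linear (brk x ^^ k)" for k
  proof (induction k)
    case 0
    then show ?case using linear_id by (simp add: id_def)
  next
    case (Suc k)
    then show ?case using linear_compose[OF Suc lin] by (simp add: o_def)
  qed
  then show ?thesis
    unfolding dexp_defect_def dexp_def by (intro linear_compose_sub linear_ident linear_compose_sum ballI linear_compose_scale_right)
qed

lemma dexp_defect_raises_degree:
  assumes v: "\<And>i. deg i \<le> k \<Longrightarrow> v $ i = 0" and l: "deg l \<le> Suc k"
  shows "dexp_defect x v $ l = 0"
proof -
  \<comment> \<open>The term \<open>k = 0\<close> of \<open>dexp x v\<close> is \<open>v\<close>
    itself and cancels in the defect; every remaining term contains at least one bracket.\<close>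
  have s: "s = Suc (s - 1)" using deg_pos[of l] deg_le[of l] by simp
  have "dexp_defect x v = - (\<Sum>n<s-1. ((-1) ^ Suc n / fact (Suc (Suc n))) *\<^sub>R (brk x ^^ Suc n) v)"
    unfolding dexp_defect_def dexp_def by (subst s, subst sum.lessThan_Suc_shift) simp
  moreover have "(brk x ^^ Suc n) v $ l = 0" for n
    by (rule brk_pow_raises_degree[OF v]) (use l in auto)
  ultimately show ?thesis by simp
qed

lemma dexp_defect_nilpotent: "(dexp_defect x ^^ s) v = 0"
proof -
  have "deg i \<le> n \<Longrightarrow> (dexp_defect x ^^ n) v $ i = 0" for n i
  proof (induction n arbitrary: i)
    case 0
    then show ?case using deg_pos[of i] by simp
  next
    case (Suc n)
    then show ?case using dexp_defect_raises_degree[of n "(dexp_defect x ^^ n) v" i x] by simp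
  qed
  then show ?thesis using deg_le by (simp add: vec_eq_iff)
qed

text \<open>The partial sums telescope under \<open>dexp x\<close>, which is the identity minus the
  defect. The defect is nilpotent, so \<open>s\<close> terms give an exact preimage of
  \<open>v\<close>, and \<open>lie_field_inverse\<close> recovers that preimage as
  \<open>X v x\<close>.\<close>

lemma lie_field_Neumann: "X v x = (\<Sum>k<s. (dexp_defect x ^^ k) v)"
proof -
  define y where "y n = (\<Sum>k<n. (dexp_defect x ^^ k) v)" for n
  have "dexp x (y n) = v - (dexp_defect x ^^ n) v" for n
  proof -
    have "y n + (dexp_defect x ^^ n) v = v + (\<Sum>k<n. (dexp_defect x ^^ Suc k) v)"
      using sum.lessThan_Suc_shift[of "\<lambda>k. (dexp_defect x ^^ k) v" n] by (simp add: y_def)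
    moreover have "(\<Sum>k<n. (dexp_defect x ^^ Suc k) v) = dexp_defect x (y n)" by (simp add: y_def linear_sum[OF linear_dexp_defect])
    ultimately have "y n + (dexp_defect x ^^ n) v = v + dexp_defect x (y n)" by (simp only:)
    then show ?thesis by (simp add: dexp_defect_def algebra_simps)
  qed
  then have "dexp x (y s) = v" by (simp add: dexp_defect_nilpotent)
  moreover have "X (dexp x (y s)) x = y s" unfolding dexp_def by (rule lie_field_inverse[OF brk_nilpotent])
  ultimately show ?thesis by (simp add: y_def)
qed

section \<open>Weighted degrees of left-invariant fields\<close>

definition weighted_field :: "(real^'m \<Rightarrow> real^'m) \<Rightarrow> bool" where
  "weighted_field f \<longleftrightarrow> (\<forall>i. wpoly deg (deg i - 1) (\<lambda>x. f x $ i))"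

text \<open>The structure constants vanish unless \<open>deg l = deg i + deg j\<close>, and then
  \<open>deg i + (deg j - 1)\<close> is \<open>deg l - 1\<close>: the unit missing from the weight
  is neither lost nor gained.\<close>

lemma weighted_field_brk: assumes f: "weighted_field f" shows "weighted_field (\<lambda>x. brk x (f x))"
  unfolding weighted_field_def brk_component
proof (intro allI wpoly_sum)
  fix l i j
  show "wpoly deg (deg l - 1) (\<lambda>x. x $ i * f x $ j * structure_const i j l)"
  proof (cases "deg l = deg i + deg j")
    case True
    have "wpoly deg (deg i + (deg j - 1)) (\<lambda>x. x $ i * f x $ j)"
      using f by (intro wpoly.mult wpoly.coord) (simp add: weighted_field_def)
    moreover have "deg i + (deg j - 1) = deg l - 1" using True deg_pos[of j] by simp
    ultimately show ?thesis using wpoly_scale[of deg "deg l - 1" "\<lambda>x. x $ i * f x $ j" "structure_const i j l"]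
      by (simp add: mult.commute)
  qed (simp add: structure_const_eq_0 wpoly_const)
qed

lemma weighted_field_brk_pow: "weighted_field f \<Longrightarrow> weighted_field (\<lambda>x. (brk x ^^ k) (f x))"
  by (induction k) (simp_all add: weighted_field_brk)

lemma weighted_field_dexp_defect: assumes f: "weighted_field f" shows "weighted_field (\<lambda>x. dexp_defect x (f x))"
proof -
  have "wpoly deg (deg i - 1) (\<lambda>x. f x $ i + (-1) * (\<Sum>k<s. ((-1) ^ k / fact (Suc k)) * ((brk x ^^ k) (f x) $ i)))" for i
    using f weighted_field_brk_pow[OF f] by (intro wpoly.add wpoly_scale wpoly_sum) (auto simp: weighted_field_def)
  then show ?thesis by (simp add: weighted_field_def dexp_defect_def dexp_def)
qed

lemma wpoly_lie_field: "wpoly deg (deg i - 1) (\<lambda>x. X v x $ i)"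
proof -
  have "weighted_field (\<lambda>x. (dexp_defect x ^^ k) v)" for k
  proof (induction k)
    case 0
    then show ?case by (simp add: weighted_field_def wpoly_const)
  next
    case (Suc k)
    then show ?case using weighted_field_dexp_defect[OF Suc] by simp
  qed
  then have "wpoly deg (deg i - 1) (\<lambda>x. \<Sum>k<s. (dexp_defect x ^^ k) v $ i)"
    by (intro wpoly_sum) (simp add: weighted_field_def)
  then show ?thesis by (simp add: lie_field_Neumann)
qed

end

subsection \<open>The endpoint map\<close>

lemma iterated_sum:
  assumes "finite I" "\<And>i. i \<in> I \<Longrightarrow> \<exists>D. iterated d (\<Phi> i) D"
  shows "\<exists>D. iterated d (\<lambda>u t. \<Sum>i\<in>I. \<Phi> i u t) D"
  using assms
proof (induction I rule: finite_induct)
  case empty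
  then show ?case using iterated.mono[OF iterated.const] by fastforce
next
  case (insert i I)
  then obtain D E where "iterated d (\<Phi> i) D" "iterated d (\<lambda>u t. \<Sum>i\<in>I. \<Phi> i u t) E" by blast
  from iterated.add[OF this] show ?case using insert by auto
qed

text \<open>Converts weighted degree in the coordinates into ordinary degree in the control, given
  that coordinate \<open>i\<close> has degree at most \<open>deg i\<close> there.\<close>

lemma wpoly_iterated:
  assumes P: "wpoly deg d P" and G: "\<And>i. \<exists>D. iterated (deg i) (\<lambda>u t. G u t $ i) D"
  shows "\<exists>D. iterated d (\<lambda>u t. P (G u t)) D"
  using P
proof (induction rule: wpoly.induct)
  case (const c)
  then show ?case using iterated.const by blast
next
  case (coord i)
  then show ?case by (rule G)
next
  case (mono d P e)
  then show ?case using iterated.mono by blast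
next
  case (add d P Q)
  then show ?case using iterated.add[of d "\<lambda>u t. P (G u t)" _ "\<lambda>u t. Q (G u t)"] by blast
next
  case (mult d P e Q)
  then show ?case using iterated.mult[of d "\<lambda>u t. P (G u t)" _ e "\<lambda>u t. Q (G u t)"] by blast
qed

section \<open>From componentwise iterated integrals to the function class\<close>

lemma norm_vec_le_sum:
  fixes x :: "real^'m"
  assumes "\<And>i. \<bar>x $ i\<bar> \<le> C i * r"
  shows "norm x \<le> (\<Sum>i\<in>UNIV. C i) * r"
proof -
  have "norm x \<le> (\<Sum>i\<in>UNIV. \<bar>x $ i\<bar>)" by (rule norm_le_l1_cart)
  also have "\<dots> \<le> (\<Sum>i\<in>UNIV. C i * r)" by (intro sum_mono assms)
  finally show ?thesis by (simp add: sum_distrib_right)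
qed

text \<open>All requirements are uniform estimates at time 1, so they follow component by component
  with the formal derivatives \<open>D i\<close> assembled into \<open>DF\<close>. Agreement of
  \<open>F\<close> with the integrals is assumed on square integrable controls, the only ones that
  the class evaluates.\<close>

lemma P_class_iterated:
  fixes F :: "(real \<Rightarrow> real^'k::finite) \<Rightarrow> real^'m::finite"
  assumes it: "\<And>i. iterated d (\<Phi> i) (D i)" and F: "\<And>u. L2 u \<Longrightarrow> F u = (\<chi> i. \<Phi> i u 1)"
  shows "P_class d F"
proof -
  define DF where "DF u h = (\<chi> i. D i u h 1)" for u h
  have one: "(1::real) \<in> {0..1}" by simp
  have Lip: "\<exists>C. \<forall>u v h. L2 u \<longrightarrow> L2 v \<longrightarrow> L2 h \<longrightarrow> L2_norm u \<le> R \<longrightarrow> L2_norm v \<le> R \<longrightarrow>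
      norm (DF u h - DF v h) \<le> C * L2_norm (\<lambda>t. u t - v t) * L2_norm h" for R
  proof -
    have "\<forall>i. \<exists>C. \<forall>u v h. L2 u \<longrightarrow> L2 v \<longrightarrow> L2 h \<longrightarrow> L2_norm u \<le> R \<longrightarrow> L2_norm v \<le> R \<longrightarrow>
      holder_bound (C * L2_norm (\<lambda>t. u t - v t) * L2_norm h) (\<lambda>t. D i u h t - D i v h t)"
      using iterated_deriv_Lipschitz[OF it] by blast
    from choice[OF this] obtain C where C: "\<And>i u v h. L2 u \<Longrightarrow> L2 v \<Longrightarrow> L2 h \<Longrightarrow> L2_norm u \<le> R \<Longrightarrow> L2_norm v \<le> R \<Longrightarrow>
      holder_bound (C i * L2_norm (\<lambda>t. u t - v t) * L2_norm h) (\<lambda>t. D i u h t - D i v h t)" by blast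
    show ?thesis
    proof (intro exI[of _ "\<Sum>i\<in>UNIV. C i"] allI impI)
      fix u v h :: "real \<Rightarrow> real^'k"
      assume a: "L2 u" "L2 v" "L2 h" "L2_norm u \<le> R" "L2_norm v \<le> R"
      have "norm (DF u h - DF v h) \<le> (\<Sum>i\<in>UNIV. C i) * (L2_norm (\<lambda>t. u t - v t) * L2_norm h)"
        using holder_boundD(1)[OF C[OF a] one] by (intro norm_vec_le_sum) (simp add: DF_def mult.assoc)
      then show "norm (DF u h - DF v h) \<le> (\<Sum>i\<in>UNIV. C i) * L2_norm (\<lambda>t. u t - v t) * L2_norm h"
        by (simp add: mult.assoc)
    qed
  qed
  have locLip: "\<exists>r>0. \<exists>C. \<forall>v w. L2 v \<longrightarrow> L2 w \<longrightarrow>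
       L2_norm (\<lambda>t. v t - u t) < r \<longrightarrow> L2_norm (\<lambda>t. w t - u t) < r \<longrightarrow>
       (\<forall>h. L2 h \<longrightarrow> norm (DF v h - DF w h) \<le> C * L2_norm (\<lambda>t. v t - w t) * L2_norm h)" if u: "L2 u" for u
  proof -
    obtain C where C: "\<And>v w h. L2 v \<Longrightarrow> L2 w \<Longrightarrow> L2 h \<Longrightarrow> L2_norm v \<le> L2_norm u + 1 \<Longrightarrow> L2_norm w \<le> L2_norm u + 1 \<Longrightarrow>
      norm (DF v h - DF w h) \<le> C * L2_norm (\<lambda>t. v t - w t) * L2_norm h" using Lip[of "L2_norm u + 1"] by blast
    have near: "L2_norm v \<le> L2_norm u + 1" if "L2 v" "L2_norm (\<lambda>t. v t - u t) < 1" for v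
      using L2_norm_le_add_diff[OF u that(1)] that(2) by linarith
    show ?thesis by (intro exI[of _ "1::real"] exI[of _ C] conjI allI impI C near) auto
  qed
  have deriv: "has_L2_deriv F u (DF u)" if u: "L2 u" for u
    unfolding has_L2_deriv_def
  proof (intro conjI allI impI)
    fix h g :: "real \<Rightarrow> real^'k" assume "L2 h" "L2 g"
    then show "DF u (\<lambda>t. h t + g t) = DF u h + DF u g"
      by (simp add: DF_def vec_eq_iff iterated_deriv_add[OF it u])
  next
    fix c and h :: "real \<Rightarrow> real^'k"
    show "DF u (\<lambda>t. c *\<^sub>R h t) = c *\<^sub>R DF u h"
      by (simp add: DF_def vec_eq_iff iterated_deriv_scale[OF it])
  next
    have "\<forall>i. \<exists>C. \<forall>v h. L2 v \<longrightarrow> L2 h \<longrightarrow> L2_norm v \<le> L2_norm u \<longrightarrow> holder_bound (C * L2_norm h) (D i v h)"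
      using iterated_deriv_bound[OF it] by blast
    from choice[OF this] obtain C where C: "\<And>i h. L2 h \<Longrightarrow> holder_bound (C i * L2_norm h) (D i u h)"
      using u by blast
    have "norm (DF u h) \<le> (\<Sum>i\<in>UNIV. C i) * L2_norm h" if "L2 h" for h
      using holder_boundD(1)[OF C[OF that] one] by (intro norm_vec_le_sum) (simp add: DF_def)
    then show "\<exists>C. \<forall>h. L2 h \<longrightarrow> norm (DF u h) \<le> C * L2_norm h" by blast
  next
    fix \<epsilon> :: real assume \<epsilon>: "0 < \<epsilon>"
    \<comment> \<open>A ball with room for increments of norm below 1, so that \<open>u\<close> and
      \<open>u + h\<close> both satisfy the norm bound of the Taylor estimate.\<close>
    define R where "R = L2_norm u + 1"
    have "\<forall>i. \<exists>C. \<forall>u h. L2 u \<longrightarrow> L2 h \<longrightarrow> L2_norm u \<le> R \<longrightarrow> L2_norm (\<lambda>t. u t + h t) \<le> R \<longrightarrow>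
      holder_bound (C * L2_norm h * L2_norm h) (\<lambda>t. \<Phi> i (\<lambda>t. u t + h t) t - \<Phi> i u t - D i u h t)"
      using iterated_Taylor[OF it] by blast
    from choice[OF this] obtain C where C: "\<And>i u h. L2 u \<Longrightarrow> L2 h \<Longrightarrow> L2_norm u \<le> R \<Longrightarrow> L2_norm (\<lambda>t. u t + h t) \<le> R \<Longrightarrow>
      holder_bound (C i * L2_norm h * L2_norm h) (\<lambda>t. \<Phi> i (\<lambda>t. u t + h t) t - \<Phi> i u t - D i u h t)" by blast
    \<comment> \<open>The sum of the constants may be 0 or negative; this majorant is positive and
      can be divided by.\<close>
    define K where "K = \<bar>\<Sum>i\<in>UNIV. C i\<bar> + 1"
    have K: "0 < K" "(\<Sum>i\<in>UNIV. C i) \<le> K" by (auto simp: K_def)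
    show "\<exists>\<delta>>0. \<forall>h. L2 h \<longrightarrow> L2_norm h < \<delta> \<longrightarrow> norm (F (\<lambda>t. u t + h t) - F u - DF u h) \<le> \<epsilon> * L2_norm h"
    proof (intro exI[of _ "min 1 (\<epsilon> / K)"] conjI allI impI)
      show "0 < min 1 (\<epsilon> / K)" using \<epsilon> K by simp
      fix h :: "real \<Rightarrow> real^'k" assume h: "L2 h" and small: "L2_norm h < min 1 (\<epsilon> / K)"
      have uh: "L2 (\<lambda>t. u t + h t)" by (rule L2_add[OF u h])
      have nR: "L2_norm u \<le> R" "L2_norm (\<lambda>t. u t + h t) \<le> R"
        using L2_norm_triangle[OF u h] small by (auto simp: R_def)
      have "norm (F (\<lambda>t. u t + h t) - F u - DF u h) \<le> (\<Sum>i\<in>UNIV. C i) * (L2_norm h * L2_norm h)"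
        using holder_boundD(1)[OF C[OF u h nR] one]
        by (intro norm_vec_le_sum) (simp add: DF_def F u uh mult.assoc)
      also have "\<dots> \<le> K * (L2_norm h * L2_norm h)" using K by (intro mult_right_mono) auto
      also have "\<dots> = (K * L2_norm h) * L2_norm h" by simp
      also have "\<dots> \<le> \<epsilon> * L2_norm h"
        using small K by (intro mult_right_mono) (auto simp: field_simps)
      finally show "norm (F (\<lambda>t. u t + h t) - F u - DF u h) \<le> \<epsilon> * L2_norm h" .
    qed
  qed
  have cont: "\<exists>\<delta>>0. \<forall>v. L2 v \<longrightarrow> L2_norm (\<lambda>t. v t - u t) < \<delta> \<longrightarrow>
      (\<forall>h. L2 h \<longrightarrow> norm (DF v h - DF u h) \<le> \<epsilon> * L2_norm h)" if u: "L2 u" and \<epsilon>: "0 < \<epsilon>" for u \<epsilon>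
  proof -
    obtain r C where r: "0 < r" and C: "\<And>v w h. L2 v \<Longrightarrow> L2 w \<Longrightarrow> L2_norm (\<lambda>t. v t - u t) < r \<Longrightarrow>
        L2_norm (\<lambda>t. w t - u t) < r \<Longrightarrow> L2 h \<Longrightarrow>
        norm (DF v h - DF w h) \<le> C * L2_norm (\<lambda>t. v t - w t) * L2_norm h" using locLip[OF u] by blast
    define K where "K = \<bar>C\<bar> + 1"
    have K: "0 < K" "C \<le> K" by (auto simp: K_def)
    have u0: "L2_norm (\<lambda>t. u t - u t) < r" using r L2_norm_scaleR[of 0 u] by simp
    show ?thesis
    proof (intro exI[of _ "min r (\<epsilon> / K)"] conjI allI impI)
      show "0 < min r (\<epsilon> / K)" using r \<epsilon> K by simp
      fix v h :: "real \<Rightarrow> real^'k"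
      assume v: "L2 v" and small: "L2_norm (\<lambda>t. v t - u t) < min r (\<epsilon> / K)" and h: "L2 h"
      have "norm (DF v h - DF u h) \<le> C * L2_norm (\<lambda>t. v t - u t) * L2_norm h"
        using small by (intro C v u u0 h) auto
      also have "\<dots> \<le> K * L2_norm (\<lambda>t. v t - u t) * L2_norm h" using K by (intro mult_right_mono) auto
      also have "\<dots> \<le> \<epsilon> * L2_norm h"
        using small K by (intro mult_right_mono) (auto simp: field_simps)
      finally show "norm (DF v h - DF u h) \<le> \<epsilon> * L2_norm h" .
    qed
  qed
  have weak: "\<exists>N. \<forall>n\<ge>N. \<forall>h. L2 h \<longrightarrow> norm (DF (v n) h - DF u h) \<le> \<epsilon> * L2_norm h"
    if v: "\<forall>n. L2 (v n)" and u: "L2 u"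
      and lim: "\<forall>h. L2 h \<longrightarrow> (\<lambda>n. L2_inner (v n) h) \<longlonglongrightarrow> L2_inner u h" and \<epsilon>: "0 < \<epsilon>" for v u \<epsilon>
  proof -
    have "\<forall>i. \<exists>e. e \<longlonglongrightarrow> 0 \<and> (\<forall>n h. L2 h \<longrightarrow> \<bar>D i (v n) h 1 - D i u h 1\<bar> \<le> e n * L2_norm h)"
    proof
      fix i
      obtain e where "e \<longlonglongrightarrow> 0" "\<forall>n. \<forall>t\<in>{0..1}. \<bar>\<Phi> i (v n) t - \<Phi> i u t\<bar> \<le> e n \<and>
         (\<forall>h. L2 h \<longrightarrow> \<bar>D i (v n) h t - D i u h t\<bar> \<le> e n * L2_norm h)"
        using iterated_weakly_continuous[of v u d "\<Phi> i" "D i"] v u lim it by blast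
      then show "\<exists>e. e \<longlonglongrightarrow> 0 \<and> (\<forall>n h. L2 h \<longrightarrow> \<bar>D i (v n) h 1 - D i u h 1\<bar> \<le> e n * L2_norm h)"
        using one by blast
    qed
    from choice[OF this] obtain e where e: "\<And>i. e i \<longlonglongrightarrow> 0"
      "\<And>i n h. L2 h \<Longrightarrow> \<bar>D i (v n) h 1 - D i u h 1\<bar> \<le> e i n * L2_norm h" by blast
    have "(\<lambda>n. \<Sum>i\<in>UNIV. e i n) \<longlonglongrightarrow> (\<Sum>i\<in>(UNIV :: 'm set). 0)" by (intro tendsto_sum e)
    then have "eventually (\<lambda>n. (\<Sum>i\<in>UNIV. e i n) < \<epsilon>) sequentially"
      using order_tendstoD(2) \<epsilon> by fastforce
    then obtain N where N: "\<And>n. n \<ge> N \<Longrightarrow> (\<Sum>i\<in>UNIV. e i n) < \<epsilon>" by (auto simp: eventually_sequentially)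
    show ?thesis
    proof (intro exI[of _ N] allI impI)
      fix n and h :: "real \<Rightarrow> real^'k" assume n: "N \<le> n" and h: "L2 h"
      have "norm (DF (v n) h - DF u h) \<le> (\<Sum>i\<in>UNIV. e i n) * L2_norm h"
        using e(2)[OF h] by (intro norm_vec_le_sum) (simp add: DF_def)
      also have "\<dots> \<le> \<epsilon> * L2_norm h" using N[OF n] by (intro mult_right_mono) auto
      finally show "norm (DF (v n) h - DF u h) \<le> \<epsilon> * L2_norm h" .
    qed
  qed
  have poly: "poly_le n d (\<lambda>c. F (\<lambda>t. \<Sum>i<n. c i *\<^sub>R hs i t))" if hs: "\<forall>i<n. L2 (hs i)" for n hs
  proof (rule poly_le_vec)
    fix i
    have "L2 (\<lambda>t. \<Sum>i<n. c i *\<^sub>R hs i t)" for c using hs by (intro L2_sum L2_scaleR) auto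
    then show "poly_le n d (\<lambda>c. F (\<lambda>t. \<Sum>i<n. c i *\<^sub>R hs i t) $ i)"
      using iterated_poly_le[OF hs it one] by (simp add: F)
  qed
  show ?thesis
    unfolding P_class_def
  proof (intro exI[of _ DF] conjI allI impI)
    fix u :: "real \<Rightarrow> real^'k" assume "L2 u"
    then show "has_L2_deriv F u (DF u)" by (rule deriv)
  next
    fix u :: "real \<Rightarrow> real^'k" and \<epsilon> :: real assume "L2 u" "0 < \<epsilon>"
    then show "\<exists>\<delta>>0. \<forall>v. L2 v \<longrightarrow> L2_norm (\<lambda>t. v t - u t) < \<delta> \<longrightarrow>
      (\<forall>h. L2 h \<longrightarrow> norm (DF v h - DF u h) \<le> \<epsilon> * L2_norm h)" by (rule cont)
  next
    fix v :: "nat \<Rightarrow> real \<Rightarrow> real^'k" and u and \<epsilon> :: real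
    assume "\<forall>n. L2 (v n)" "L2 u" "\<forall>h. L2 h \<longrightarrow> (\<lambda>n. L2_inner (v n) h) \<longlonglongrightarrow> L2_inner u h" "0 < \<epsilon>"
    then show "\<exists>N. \<forall>n\<ge>N. \<forall>h. L2 h \<longrightarrow> norm (DF (v n) h - DF u h) \<le> \<epsilon> * L2_norm h" by (rule weak)
  next
    fix u :: "real \<Rightarrow> real^'k" assume "L2 u"
    then show "\<exists>r>0. \<exists>C. \<forall>v w. L2 v \<longrightarrow> L2 w \<longrightarrow>
       L2_norm (\<lambda>t. v t - u t) < r \<longrightarrow> L2_norm (\<lambda>t. w t - u t) < r \<longrightarrow>
       (\<forall>h. L2 h \<longrightarrow> norm (DF v h - DF w h) \<le> C * L2_norm (\<lambda>t. v t - w t) * L2_norm h)" by (rule locLip)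
  next
    fix n and hs :: "nat \<Rightarrow> real \<Rightarrow> real^'k" assume "\<forall>i<n. L2 (hs i)"
    then show "poly_le n d (\<lambda>c. F (\<lambda>t. \<Sum>i<n. c i *\<^sub>R hs i t))" by (rule poly)
  qed
qed

context carnot
begin

section \<open>Horizontal curves and Picard iteration\<close>

lemma horizontal_curve_component:
  assumes "horizontal_curve gmul \<iota> u \<gamma>" "t \<in> {0..1}"
  shows "((\<lambda>\<tau>. \<Sum>j\<in>UNIV. u \<tau> $ j * X (axis (\<iota> j) 1) (\<gamma> \<tau>) $ i) has_integral \<gamma> t $ i) {0..t}"
proof -
  have "((\<lambda>\<tau>. \<Sum>j\<in>UNIV. u \<tau> $ j *\<^sub>R X (axis (\<iota> j) 1) (\<gamma> \<tau>)) has_integral \<gamma> t) {0..t}"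
    using assms unfolding horizontal_curve_def by blast
  from has_integral_linear[OF this bounded_linear_vec_nth[of i]] show ?thesis by (simp add: o_def)
qed

text \<open>Induction on the weight takes the place of a Gronwall argument: the integrand for
  coordinate \<open>i\<close> sees coordinates of smaller weight only, where the two curves are
  already known to agree.\<close>

lemma horizontal_curve_unique:
  assumes \<gamma>: "horizontal_curve gmul \<iota> u \<gamma>" and \<eta>: "horizontal_curve gmul \<iota> u \<eta>" and t: "t \<in> {0..1}"
  shows "\<gamma> t = \<eta> t"
proof -
  have "deg i \<le> n \<Longrightarrow> t \<in> {0..1} \<Longrightarrow> \<gamma> t $ i = \<eta> t $ i" for n i t
  proof (induction n arbitrary: i t)
    case 0
    then show ?case using deg_pos[of i] by simp
  next
    case (Suc n)
    have "X (axis (\<iota> j) 1) (\<gamma> \<tau>) $ i = X (axis (\<iota> j) 1) (\<eta> \<tau>) $ i" if "\<tau> \<in> {0..t}" for j \<tau>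
      by (rule wpoly_local[OF wpoly_lie_field]) (use that Suc in auto)
    then have "((\<lambda>\<tau>. \<Sum>j\<in>UNIV. u \<tau> $ j * X (axis (\<iota> j) 1) (\<gamma> \<tau>) $ i) has_integral \<eta> t $ i) {0..t}"
      by (intro has_integral_eq[OF _ horizontal_curve_component[OF \<eta> Suc.prems(2), of i]]) simp
    then show ?case by (rule has_integral_unique[OF horizontal_curve_component[OF \<gamma> Suc.prems(2), of i]])
  qed
  then show ?thesis using deg_le t by (auto simp: vec_eq_iff)
qed

primrec picard :: "('k::finite \<Rightarrow> 'm) \<Rightarrow> nat \<Rightarrow> (real \<Rightarrow> real^'k) \<Rightarrow> real \<Rightarrow> real^'m" where
  "picard \<iota> 0 u t = 0"
| "picard \<iota> (Suc n) u t =
     (\<chi> i. \<Sum>j\<in>UNIV. prim j u (\<lambda>\<tau>. X (axis (\<iota> j) 1) (picard \<iota> n u \<tau>) $ i) t)"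

text \<open>The integrand has degree at most \<open>deg i - 1\<close> in the control and
  \<open>prim\<close> adds 1, so the bound reproduces itself and does not grow with
  \<open>n\<close>. As weights start at 1, \<open>Suc (deg i - 1)\<close> is
  \<open>deg i\<close>.\<close>

lemma iterated_picard: "\<exists>D. iterated (deg i) (\<lambda>u t. picard \<iota> n u t $ i) D"
proof (induction n arbitrary: i)
  case 0
  then show ?case using iterated.mono[OF iterated.const[of 0]] by fastforce
next
  case (Suc n)
  have "\<exists>D. iterated (Suc (deg i - 1)) (\<lambda>u. prim j u (\<lambda>\<tau>. X (axis (\<iota> j) 1) (picard \<iota> n u \<tau>) $ i)) D" for j
    using wpoly_iterated[OF wpoly_lie_field Suc, of i "axis (\<iota> j) 1"] iterated.prim by blast
  then have "\<exists>D. iterated (deg i) (\<lambda>u t. \<Sum>j\<in>UNIV. prim j u (\<lambda>\<tau>. X (axis (\<iota> j) 1) (picard \<iota> n u \<tau>) $ i) t) D"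
    using deg_pos[of i] by (intro iterated_sum) auto
  then show ?case by simp
qed

text \<open>No coordinate has weight 0, so the induction starts vacuously; afterwards each iteration
  settles the coordinates of one further weight, because their integrands depend on settled
  ones.\<close>

lemma picard_stable: "deg i \<le> n \<Longrightarrow> t \<in> {0..1} \<Longrightarrow> picard \<iota> (Suc n) u t $ i = picard \<iota> n u t $ i"
proof (induction n arbitrary: i t)
  case 0
  then show ?case using deg_pos[of i] by simp
next
  case (Suc n)
  have "prim j u (\<lambda>\<tau>. X (axis (\<iota> j) 1) (picard \<iota> (Suc n) u \<tau>) $ i) t
      = prim j u (\<lambda>\<tau>. X (axis (\<iota> j) 1) (picard \<iota> n u \<tau>) $ i) t" for j
  proof (rule prim_cong[OF Suc.prems(2)])
    fix \<tau> :: real assume "\<tau> \<in> {0..1}"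
    then show "X (axis (\<iota> j) 1) (picard \<iota> (Suc n) u \<tau>) $ i = X (axis (\<iota> j) 1) (picard \<iota> n u \<tau>) $ i"
      using Suc by (intro wpoly_local[OF wpoly_lie_field]) (auto simp del: picard.simps)
  qed
  then show ?case by (simp only: picard.simps(2) vec_lambda_beta)
qed

lemma picard_fixpoint:
  "t \<in> {0..1} \<Longrightarrow> picard \<iota> s u t $ i = (\<Sum>j\<in>UNIV. prim j u (\<lambda>\<tau>. X (axis (\<iota> j) 1) (picard \<iota> s u \<tau>) $ i) t)"
  using picard_stable[OF deg_le[of i], of t \<iota> u] by simp

lemma horizontal_curve_picard:
  assumes u: "L2 u" shows "horizontal_curve gmul \<iota> u (picard \<iota> s u)"
  unfolding horizontal_curve_def
proof (intro conjI ballI)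
  have cont: "continuous_on {0..1} (\<lambda>t. picard \<iota> s u t $ i)" for i
    using iterated_picard[of i \<iota> s] iterated_continuous[OF _ u] by blast
  have "continuous_on {0..1} (\<lambda>t. \<chi> i. picard \<iota> s u t $ i)" by (intro continuous_on_vec_lambda cont)
  then show "continuous_on {0..1} (picard \<iota> s u)" by simp
  show "picard \<iota> s u 0 = 0" by (simp add: vec_eq_iff picard_fixpoint prim_def)
  fix t :: real assume t: "t \<in> {0..1}"
  have comp: "((\<lambda>\<tau>. \<Sum>j\<in>UNIV. u \<tau> $ j * X (axis (\<iota> j) 1) (picard \<iota> s u \<tau>) $ i) has_integral picard \<iota> s u t $ i) {0..t}" for i
    unfolding picard_fixpoint[OF t]
  proof (rule has_integral_sum)
    fix j
    have "continuous_on {0..1} (\<lambda>\<tau>. X (axis (\<iota> j) 1) (picard \<iota> s u \<tau>) $ i)"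
      using wpoly_iterated[OF wpoly_lie_field iterated_picard, of i "axis (\<iota> j) 1" \<iota> s] iterated_continuous[OF _ u] by blast
    then show "((\<lambda>\<tau>. u \<tau> $ j * X (axis (\<iota> j) 1) (picard \<iota> s u \<tau>) $ i) has_integral
        prim j u (\<lambda>\<tau>. X (axis (\<iota> j) 1) (picard \<iota> s u \<tau>) $ i) t) {0..t}"
      unfolding prim_def using t by (intro integrable_integral integrable_component_mult[OF u]) auto
  qed simp
  show "((\<lambda>\<tau>. \<Sum>j\<in>UNIV. u \<tau> $ j *\<^sub>R X (axis (\<iota> j) 1) (picard \<iota> s u \<tau>)) has_integral picard \<iota> s u t) {0..t}"
    unfolding has_integral_componentwise_iff[where y = "picard \<iota> s u t"] Basis_vec_def
    using comp by (auto simp: inner_axis)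
qed

lemma endpoint_eq:
  assumes u: "L2 u" shows "endpoint gmul \<iota> u = picard \<iota> s u 1"
  unfolding endpoint_def
proof (rule the_equality)
  show "\<exists>\<gamma>. horizontal_curve gmul \<iota> u \<gamma> \<and> \<gamma> 1 = picard \<iota> s u 1"
    using horizontal_curve_picard[OF u] by blast
  show "p = picard \<iota> s u 1" if "\<exists>\<gamma>. horizontal_curve gmul \<iota> u \<gamma> \<and> \<gamma> 1 = p" for p
    using that horizontal_curve_unique[OF _ horizontal_curve_picard[OF u], where t = 1] by auto
qed

lemma P_class_endpoint: "P_class s (endpoint gmul \<iota>)"
proof -
  have "\<forall>i. \<exists>D. iterated s (\<lambda>u t. picard \<iota> s u t $ i) D"
    using iterated_picard iterated.mono deg_le by blast
  from choice[OF this] obtain D where "\<And>i. iterated s (\<lambda>u t. picard \<iota> s u t $ i) (D i)" by blast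
  then show ?thesis
    by (rule P_class_iterated[where \<Phi> = "\<lambda>i u t. picard \<iota> s u t $ i"]) (simp add: endpoint_eq)
qed

end

theorem theoremH:
  fixes gmul :: "real^'m \<Rightarrow> real^'m \<Rightarrow> real^'m"
    and deg :: "'m::finite \<Rightarrow> nat"
    and s :: nat
    and \<iota> :: "'k::finite \<Rightarrow> 'm"
  assumes "carnot_exp_coords gmul deg s"
    and "bij_betw \<iota> UNIV {i. deg i = 1}"
  shows "P_class s (endpoint gmul \<iota>)"
proof -
  interpret carnot gmul deg s by unfold_locales (rule assms(1))
  show ?thesis by (rule P_class_endpoint)
qed

end
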